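(* Let $\mathcal{R}\subset I\times J$ be a relation between finite sets, $d\ge0$, and let $\mathcal{L}$ be its maxbiclique lattice (with $J$ as the lower part). Say $\mathcal{L}$ satisfies condition (C) if $\mathcal{L}$ is graded and for every element $a\in\mathcal{L}$ of rank $k$, the graph whose vertices are the elements of rank $k-1$ below $a$ and in which two such elements $a_i,a_j$ are adjacent when $a_i\wedge a_j$ has rank $k-2$, is connected. Then: (1) There is a polytope with facets indexed by $I$, vertices indexed by $J$ and facet-vertex incidence $\mathcal{R}$ if and only if $\mathcal{L}$ satisfies (C), has rank $d+1$ and is diamond, and $\mathcal{R}$ has a rank $d$ filled $1$-incidence matrix; and for such $\mathcal{R}$, $M$ is the facet-vertex matrix of a centered type $\mathcal{R}$ polytope in $\mathbb{R}^d$ iff $M$ is a rank $d$ filled $1$-incidence matrix of $\mathcal{R}$, these matrices parameterizing centered type $\mathcal{R}$ polytopes modulo invertible linear transformations. (2) If $\mathcal{L}$ satisfies (C), has rank $d+1$ and is diamond, then $\mathcal{R}$ has a rank $d$ filled $1$-incidence matrix iff it has a rank $d+1$ filled $0$-incidence matrix; and for such $\mathcal{R}$, $N$ is a facet-ray matrix of a type $\mathcal{R}$ cone in $\mathbb{R}^{d+1}$ iff $N$ is a rank $d+1$ filled $0$-incidence matrix of $\mathcal{R}$, and such matrices modulo positive scaling of rows and columns parameterize type $\mathcal{R}$ polytopes modulo projective transformations.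
   Context: A filled $x$-incidence matrix of $\mathcal{R}$ is a real $I\times J$ matrix with entry $x$ at $(i,j)\in\mathcal{R}$ and entries $<x$ elsewhere. A maxbiclique of $\mathcal{R}$ is an inclusion-maximal pair $(I_0,J_0)$ with $I_0\times J_0\subset\mathcal{R}$; the maxbiclique lattice orders them by $(I_0,J_0)\le(I_1,J_1)$ iff $J_0\subset J_1$; $\wedge$ is the meet. Flags are maximal chains; graded means all flags have the same length, the rank (a singleton has rank $0$); the rank of an element is the number of elements below it in a flag. Diamond: graded and every interval $[a,b]$ with $\mathrm{rank}(b)=\mathrm{rank}(a)+2$ has exactly 4 elements. A polytope is the convex hull of finitely many points; it is centered if full-dimensional with the origin in its interior; its covertices $h_i$ are the vertices of the polar $\{y:\langle y,x\rangle\le1\ \forall x\in P\}$ (one per facet) and its facet-vertex matrix is $[M]_{i,j}=\langle h_i,w_j\rangle$ for vertices $w_j$. A cone is the set of nonnegative combinations of finitely many vectors containing no line; with generators $w_j$ and cogenerators $h_i$ (generators of the polar cone $\{y:\langle y,x\rangle\le0\ \forall x\in C\}$) a facet-ray matrix is $[N]_{i,j}=\langle h_i,w_j\rangle$. Type $\mathcal{R}$ means facets indexed by $I$, vertices/rays by $J$, with incidence $\mathcal{R}$. A polytope $P$ corresponds to the cone $\{t(x,1):t\ge0,x\in P\}$.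
   Formalization: Added, as a conjunct in (1) and a hypothesis in (2): every {j} and every {i} occurs as the J-part or I-part of a maxbiclique; without it both parts fail (e.g. I={1,2}, J={1,2,3}, R={(1,1),(2,2)}, d=1). The polytope in (1) is taken to be d-dimensional. *)

theory Defs
  imports "HOL-Analysis.Analysis" "HOL-Library.Function_Algebras" "HOL-Algebra.Lattice"
begin

definition flags :: "('a, 'm) gorder_scheme \<Rightarrow> 'a set set" where
  "flags L = {F. pred_on.maxchain (carrier L) (lless L) F}"

definition graded :: "('a, 'm) gorder_scheme \<Rightarrow> bool" where
  "graded L \<longleftrightarrow> (\<forall>F\<in>flags L. \<forall>G\<in>flags L. card F = card G)"

text \<open>Both ranks are used for finite graded posets only, where they do not depend on the
  chosen flag.\<close>

definition poset_rank :: "('a, 'm) gorder_scheme \<Rightarrow> nat" where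
  "poset_rank L = card (SOME F. F \<in> flags L) - 1"

definition elem_rank :: "('a, 'm) gorder_scheme \<Rightarrow> 'a \<Rightarrow> nat" where
  "elem_rank L a = card {b \<in> (SOME F. F \<in> flags L \<and> a \<in> F). b \<sqsubset>\<^bsub>L\<^esub> a}"

definition diamond :: "('a, 'm) gorder_scheme \<Rightarrow> bool" where
  "diamond L \<longleftrightarrow> graded L \<and>
     (\<forall>a\<in>carrier L. \<forall>b\<in>carrier L. a \<sqsubseteq>\<^bsub>L\<^esub> b \<and> elem_rank L b = elem_rank L a + 2 \<longrightarrow>
        card {c \<in> carrier L. a \<sqsubseteq>\<^bsub>L\<^esub> c \<and> c \<sqsubseteq>\<^bsub>L\<^esub> b} = 4)"

definition lower_covers :: "('a, 'm) gorder_scheme \<Rightarrow> 'a \<Rightarrow> 'a set" where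
  "lower_covers L a = {b \<in> carrier L. b \<sqsubseteq>\<^bsub>L\<^esub> a \<and> elem_rank L b + 1 = elem_rank L a}"

definition cover_graph :: "('a, 'm) gorder_scheme \<Rightarrow> 'a \<Rightarrow> ('a \<times> 'a) set" where
  "cover_graph L a = {(b, c). b \<in> lower_covers L a \<and> c \<in> lower_covers L a \<and>
     elem_rank L (b \<sqinter>\<^bsub>L\<^esub> c) + 2 = elem_rank L a}"

text \<open>The empty graph, which occurs for the least element, counts as connected.\<close>

definition condition_C :: "('a, 'm) gorder_scheme \<Rightarrow> bool" where
  "condition_C L \<longleftrightarrow> graded L \<and>
     (\<forall>a\<in>carrier L. \<forall>b\<in>lower_covers L a. \<forall>c\<in>lower_covers L a. (b, c) \<in> (cover_graph L a)\<^sup>*)"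

definition bicliques :: "'i set \<Rightarrow> 'j set \<Rightarrow> ('i \<times> 'j) set \<Rightarrow> ('i set \<times> 'j set) set" where
  "bicliques I J R = {(I0, J0). I0 \<subseteq> I \<and> J0 \<subseteq> J \<and> I0 \<times> J0 \<subseteq> R}"

definition maxbicliques :: "'i set \<Rightarrow> 'j set \<Rightarrow> ('i \<times> 'j) set \<Rightarrow> ('i set \<times> 'j set) set" where
  "maxbicliques I J R = {(I0, J0) \<in> bicliques I J R.
     \<forall>(I1, J1) \<in> bicliques I J R. I0 \<subseteq> I1 \<and> J0 \<subseteq> J1 \<longrightarrow> I1 = I0 \<and> J1 = J0}"

definition maxbiclique_lattice ::
    "'i set \<Rightarrow> 'j set \<Rightarrow> ('i \<times> 'j) set \<Rightarrow> ('i set \<times> 'j set) gorder" where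
  "maxbiclique_lattice I J R =
     \<lparr>carrier = maxbicliques I J R, eq = (=), le = (\<lambda>p q. snd p \<subseteq> snd q)\<rparr>"

text \<open>Every \<open>j \<in> J\<close> is, as the singleton \<open>{j}\<close>, an element of the maxbiclique lattice (then an
  atom, if the rank is positive), and every \<open>i \<in> I\<close>, as the singleton \<open>{i}\<close>, too (then a
  coatom). This makes precise that \<open>J\<close> and \<open>I\<close> are the lower and the upper part of the
  lattice. Without it the lattice does not see all of \<open>I\<close> and \<open>J\<close>: for
  \<open>R = {(1,1), (2,2)}\<close>, \<open>I = {1,2}\<close>, \<open>J = {1,2,3}\<close> one gets the face lattice of a segment
  and the rank 1 filled 1-incidence matrix with rows \<open>(1, -1, 0)\<close> and \<open>(-1, 1, 0)\<close>,
  but no segment has three vertices.\<close>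

definition reduced_relation :: "'i set \<Rightarrow> 'j set \<Rightarrow> ('i \<times> 'j) set \<Rightarrow> bool" where
  "reduced_relation I J R \<longleftrightarrow>
     (\<forall>j\<in>J. \<exists>I0. (I0, {j}) \<in> maxbicliques I J R) \<and>
     (\<forall>i\<in>I. \<exists>J0. ({i}, J0) \<in> maxbicliques I J R)"

text \<open>An \<open>I \<times> J\<close> matrix is a function \<open>'i \<Rightarrow> 'j \<Rightarrow> real\<close>; only its values on \<open>I \<times> J\<close> matter.\<close>

definition filled_incidence_matrix ::
    "'i set \<Rightarrow> 'j set \<Rightarrow> ('i \<times> 'j) set \<Rightarrow> real \<Rightarrow> ('i \<Rightarrow> 'j \<Rightarrow> real) \<Rightarrow> bool" where
  "filled_incidence_matrix I J R x M \<longleftrightarrow>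
     (\<forall>i\<in>I. \<forall>j\<in>J. if (i, j) \<in> R then M i j = x else M i j < x)"

text \<open>The dimension of the row space, inside the real vector space \<open>'j \<Rightarrow> real\<close>.\<close>

definition matrix_rank :: "'i set \<Rightarrow> 'j set \<Rightarrow> ('i \<Rightarrow> 'j \<Rightarrow> real) \<Rightarrow> nat" where
  "matrix_rank I J M =
     vector_space.dim (\<lambda>(c::real) f. (\<lambda>j. c * f j)) ((\<lambda>i j. if j \<in> J then M i j else 0) ` I)"

definition matrix_eq_on ::
    "'i set \<Rightarrow> 'j set \<Rightarrow> ('i \<Rightarrow> 'j \<Rightarrow> real) \<Rightarrow> ('i \<Rightarrow> 'j \<Rightarrow> real) \<Rightarrow> bool" where
  "matrix_eq_on I J M M' \<longleftrightarrow> (\<forall>i\<in>I. \<forall>j\<in>J. M' i j = M i j)"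

definition scaling_equiv ::
    "'i set \<Rightarrow> 'j set \<Rightarrow> ('i \<Rightarrow> 'j \<Rightarrow> real) \<Rightarrow> ('i \<Rightarrow> 'j \<Rightarrow> real) \<Rightarrow> bool" where
  "scaling_equiv I J N N' \<longleftrightarrow>
     (\<exists>a b. (\<forall>i\<in>I. 0 < a i) \<and> (\<forall>j\<in>J. 0 < b j) \<and> (\<forall>i\<in>I. \<forall>j\<in>J. N' i j = a i * N i j * b j))"

text \<open>The space \<open>\<real>\<^sup>d\<close> is a \<open>d\<close>-dimensional linear subspace \<open>V\<close> of a Euclidean space, because a
  type of class \<^class>\<open>euclidean_space\<close> never has dimension 0.

  Facets differ from \<^const>\<open>facet_of\<close> only in that the empty face is a facet of a point.
  This is needed for \<open>d = 0\<close>, where the polar has the single vertex 0.\<close>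

definition facets :: "'a::euclidean_space set \<Rightarrow> 'a set set" where
  "facets P = {F. F face_of P \<and> aff_dim F = aff_dim P - 1}"

definition vertices :: "'a::euclidean_space set \<Rightarrow> 'a set" where
  "vertices P = {v. v extreme_point_of P}"

definition polytope_of_type ::
    "'i set \<Rightarrow> 'j set \<Rightarrow> ('i \<times> 'j) set \<Rightarrow>
     'a::euclidean_space set \<Rightarrow> ('i \<Rightarrow> 'a set) \<Rightarrow> ('j \<Rightarrow> 'a) \<Rightarrow> bool" where
  "polytope_of_type I J R P F w \<longleftrightarrow>
     polytope P \<and> bij_betw F I (facets P) \<and> bij_betw w J (vertices P) \<and>
     (\<forall>i\<in>I. \<forall>j\<in>J. (i, j) \<in> R \<longleftrightarrow> w j \<in> F i)"

definition full_dim_in :: "'a::euclidean_space set \<Rightarrow> 'a set \<Rightarrow> bool" where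
  "full_dim_in V P \<longleftrightarrow> P \<subseteq> V \<and> aff_dim P = int (dim V)"

definition centered_in :: "'a::euclidean_space set \<Rightarrow> 'a set \<Rightarrow> bool" where
  "centered_in V P \<longleftrightarrow> full_dim_in V P \<and> 0 \<in> top_of_set V interior_of P"

definition polar :: "'a::euclidean_space set \<Rightarrow> 'a set \<Rightarrow> 'a set" where
  "polar V P = {y \<in> V. \<forall>x\<in>P. y \<bullet> x \<le> 1}"

definition facet_vertex_matrix ::
    "'a::euclidean_space set \<Rightarrow> 'i set \<Rightarrow> 'j set \<Rightarrow>
     'a set \<Rightarrow> ('i \<Rightarrow> 'a set) \<Rightarrow> ('j \<Rightarrow> 'a) \<Rightarrow> ('i \<Rightarrow> 'j \<Rightarrow> real) \<Rightarrow> bool" where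
  "facet_vertex_matrix V I J P F w M \<longleftrightarrow>
     (\<exists>h. bij_betw h I (vertices (polar V P)) \<and>
          (\<forall>i\<in>I. F i = {x \<in> P. h i \<bullet> x = 1}) \<and>
          (\<forall>i\<in>I. \<forall>j\<in>J. M i j = h i \<bullet> w j))"

text \<open>A labelled polytope is a triple \<open>(P, F, w)\<close> of a polytope with its facets \<open>F\<close> and vertices
  \<open>w\<close>. Equivalences respect the labels.\<close>

type_synonym ('i, 'j, 'a) labelled_polytope = "'a set \<times> ('i \<Rightarrow> 'a set) \<times> ('j \<Rightarrow> 'a)"

definition linearly_equivalent ::
    "'a::euclidean_space set \<Rightarrow> 'i set \<Rightarrow> 'j set \<Rightarrow>
     ('i, 'j, 'a) labelled_polytope \<Rightarrow> ('i, 'j, 'a) labelled_polytope \<Rightarrow> bool" where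
  "linearly_equivalent V I J = (\<lambda>(P, F, w) (P', F', w').
     \<exists>A. linear A \<and> bij_betw A V V \<and> A ` P = P' \<and>
         (\<forall>i\<in>I. A ` F i = F' i) \<and> (\<forall>j\<in>J. A (w j) = w' j))"

text \<open>The projective map induced by a linear automorphism \<open>g\<close> of \<open>V \<times> \<real>\<close>, in the affine chart
  \<open>x \<mapsto> (x, 1)\<close>. It must be defined (have nonzero denominator) on all of \<open>P\<close>.\<close>

definition projective_map :: "('a::euclidean_space \<times> real \<Rightarrow> 'a \<times> real) \<Rightarrow> 'a \<Rightarrow> 'a" where
  "projective_map g x = fst (g (x, 1)) /\<^sub>R snd (g (x, 1))"

definition projectively_equivalent ::
    "'a::euclidean_space set \<Rightarrow> 'i set \<Rightarrow> 'j set \<Rightarrow>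
     ('i, 'j, 'a) labelled_polytope \<Rightarrow> ('i, 'j, 'a) labelled_polytope \<Rightarrow> bool" where
  "projectively_equivalent V I J = (\<lambda>(P, F, w) (P', F', w').
     \<exists>g. linear g \<and> bij_betw g (V \<times> UNIV) (V \<times> UNIV) \<and> (\<forall>x\<in>P. snd (g (x, 1)) \<noteq> 0) \<and>
         projective_map g ` P = P' \<and>
         (\<forall>i\<in>I. projective_map g ` F i = F' i) \<and> (\<forall>j\<in>J. projective_map g (w j) = w' j))"

definition is_cone :: "'a::euclidean_space set \<Rightarrow> bool" where
  "is_cone C \<longleftrightarrow>
     (\<exists>S. finite S \<and> C = {(\<Sum>v\<in>S. c v *\<^sub>R v) | c. \<forall>v\<in>S. 0 \<le> c v}) \<and>
     \<not> (\<exists>a u. u \<noteq> 0 \<and> (\<forall>t. a + t *\<^sub>R u \<in> C))"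

definition ray :: "'a::euclidean_space \<Rightarrow> 'a set" where
  "ray v = {t *\<^sub>R v | t. 0 \<le> t}"

text \<open>As cones contain no line, their one-dimensional faces are half-lines from the origin.\<close>

definition rays :: "'a::euclidean_space set \<Rightarrow> 'a set set" where
  "rays C = {r. r edge_of C}"

definition cone_of_type ::
    "'i set \<Rightarrow> 'j set \<Rightarrow> ('i \<times> 'j) set \<Rightarrow>
     'a::euclidean_space set \<Rightarrow> ('i \<Rightarrow> 'a set) \<Rightarrow> ('j \<Rightarrow> 'a set) \<Rightarrow> bool" where
  "cone_of_type I J R C F r \<longleftrightarrow>
     is_cone C \<and> bij_betw F I (facets C) \<and> bij_betw r J (rays C) \<and>
     (\<forall>i\<in>I. \<forall>j\<in>J. (i, j) \<in> R \<longleftrightarrow> r j \<subseteq> F i)"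

text \<open>If \<open>C\<close> is full-dimensional in \<open>W\<close>, the polar cone is a cone, i.e. contains no line.\<close>

definition polar_cone :: "'a::euclidean_space set \<Rightarrow> 'a set \<Rightarrow> 'a set" where
  "polar_cone W C = {y \<in> W. \<forall>x\<in>C. y \<bullet> x \<le> 0}"

definition facet_ray_matrix ::
    "'a::euclidean_space set \<Rightarrow> 'i set \<Rightarrow> 'j set \<Rightarrow>
     'a set \<Rightarrow> ('i \<Rightarrow> 'a set) \<Rightarrow> ('j \<Rightarrow> 'a set) \<Rightarrow> ('i \<Rightarrow> 'j \<Rightarrow> real) \<Rightarrow> bool" where
  "facet_ray_matrix W I J C F r N \<longleftrightarrow>
     (\<exists>h w. bij_betw (\<lambda>i. ray (h i)) I (rays (polar_cone W C)) \<and>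
            (\<forall>i\<in>I. F i = {x \<in> C. h i \<bullet> x = 0}) \<and>
            (\<forall>j\<in>J. r j = ray (w j)) \<and>
            (\<forall>i\<in>I. \<forall>j\<in>J. N i j = h i \<bullet> w j))"

text \<open>The origin is inserted explicitly only for the sake of the empty face, to which
  the face \<open>{0}\<close> of the cone corresponds.\<close>

definition cone_over :: "'a::euclidean_space set \<Rightarrow> ('a \<times> real) set" where
  "cone_over P = insert 0 {t *\<^sub>R (x, 1) | t x. 0 \<le> t \<and> x \<in> P}"

definition polytope_cone_matrix ::
    "'a::euclidean_space set \<Rightarrow> 'i set \<Rightarrow> 'j set \<Rightarrow> ('i \<times> 'j) set \<Rightarrow>
     ('i \<Rightarrow> 'j \<Rightarrow> real) \<Rightarrow> ('i, 'j, 'a) labelled_polytope \<Rightarrow> bool" where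
  "polytope_cone_matrix V I J R N = (\<lambda>(P, F, w).
     full_dim_in (V \<times> UNIV) (cone_over P) \<and>
     cone_of_type I J R (cone_over P) (\<lambda>i. cone_over (F i)) (\<lambda>j. cone_over {w j}) \<and>
     facet_ray_matrix (V \<times> UNIV) I J (cone_over P) (\<lambda>i. cone_over (F i)) (\<lambda>j. cone_over {w j}) N)"

text \<open>The relation \<open>\<rho>\<close> (``\<open>m\<close> is a matrix of \<open>x\<close>'') induces a bijection from the elements of
  \<open>Ms\<close> modulo \<open>eqM\<close> to the elements of \<open>Xs\<close> modulo \<open>eqX\<close>.\<close>

definition parameterizes ::
    "'m set \<Rightarrow> ('m \<Rightarrow> 'm \<Rightarrow> bool) \<Rightarrow> 'x set \<Rightarrow> ('x \<Rightarrow> 'x \<Rightarrow> bool) \<Rightarrow> ('m \<Rightarrow> 'x \<Rightarrow> bool) \<Rightarrow> bool" where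
  "parameterizes Ms eqM Xs eqX \<rho> \<longleftrightarrow>
     (\<forall>x\<in>Xs. \<exists>m\<in>Ms. \<rho> m x) \<and>
     (\<forall>m\<in>Ms. \<exists>x\<in>Xs. \<rho> m x) \<and>
     (\<forall>m\<in>Ms. \<forall>m'\<in>Ms. \<forall>x\<in>Xs. \<forall>x'\<in>Xs. \<rho> m x \<and> \<rho> m' x' \<longrightarrow> (eqM m m' \<longleftrightarrow> eqX x x'))"

end

theory Submission
  imports Defs
begin

text \<open>Let \<open>N = (\<langle>h i, w j\<rangle>)\<close> be a rank \<open>d + 1\<close> filled 0-incidence matrix, factored through a space
  of dimension \<open>d + 1\<close>. Every maxbiclique \<open>a\<close> gives the exposed face generated by \<open>w ` snd a\<close> of the
  cone generated by all \<open>w j\<close>. The dimensions of these faces increase strictly along a flag, so in a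
  graded lattice of rank \<open>d + 1\<close> they equal the ranks. The diamond property then implies, by
  induction on the rank, that such a face is cut out of its span by the functionals of its lower
  covers: the ray from a point that satisfies these inequalities, in the direction opposite to an
  interior point, meets one of the hyperplanes first, and there it satisfies the inequalities of the
  corresponding lower cover. Hence the cone of the \<open>w j\<close> is the intersection of the halfspaces of the
  \<open>h i\<close>, and it has type \<open>R\<close>.

  Conversely, in a cone that is the intersection of the halfspaces of the \<open>h i\<close>, an irredundant system of
  inequalities for a face comes from its lower covers. Perturbing points of smaller faces then gives
  gradedness and the diamond property, and the ray argument, applied to the facets that are
  reachable from a given one, gives condition (C).

  Filled 1-incidence matrices \<open>M\<close> correspond to the 0-incidence matrices \<open>M - 1\<close> of the cones over
  centered polytopes. A rank \<open>d + 1\<close> filled 0-incidence matrix is brought to this form by dividing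
  its entries by the products of row and column sums.\<close>

text \<open>Cones treat both kinds of matrices alike: a filled 1-incidence matrix with factors
  \<open>h i\<close>, \<open>w j\<close> becomes the 0-incidence matrix of \<open>(h i, -1)\<close>
  and \<open>(w j, 1)\<close>. The obstacle is that correct signs and rank do not by themselves say
  that a face is bounded by its lower covers. What closes the gap is rigidity of ranks: a strictly
  increasing integer function bounded by the rank of the lattice must be the rank, so the span of a
  lower cover is a full hyperplane in the span of the face. The same rigidity bounds ranks from
  below: no filled 0-incidence matrix has rank less than that of the lattice, so only upper bounds
  of matrix ranks need a construction. The scaling by row and column sums is geometric. Let
  \<open>y\<close> be the sum of the rows and \<open>z\<close> the sum of the columns. The
  generators are moved to the hyperplane on which \<open>y\<close> has the same value as at
  \<open>z\<close>, and \<open>z\<close> becomes the origin of this slice: after scaling, all rows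
  corrected by a multiple of \<open>y\<close> vanish at \<open>z\<close>, and the rank drops by
  one.\<close>

declare split_paired_All [simp del] split_paired_Ex [simp del]

section \<open>The maxbiclique lattice and its ranks\<close>

text \<open>Maximality can be tested one index at a time, since a single row or column compatible
  with the other side would already enlarge the pair. So maxbicliques are the closed pairs of the
  Galois connection of \<open>R\<close> (formal concepts).\<close>

lemma maxbicliques_iff:
  "(A, B) \<in> maxbicliques I J R \<longleftrightarrow>
     A = {i\<in>I. \<forall>j\<in>B. (i, j) \<in> R} \<and> B = {j\<in>J. \<forall>i\<in>A. (i, j) \<in> R}"
proof
  assume mb: "(A, B) \<in> maxbicliques I J R"
  then have bc: "A \<subseteq> I" "B \<subseteq> J" "A \<times> B \<subseteq> R"
    and mx: "\<And>A' B'. (A', B') \<in> bicliques I J R \<Longrightarrow> A \<subseteq> A' \<Longrightarrow> B \<subseteq> B' \<Longrightarrow> A' = A \<and> B' = B"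
    unfolding maxbicliques_def bicliques_def mem_Collect_eq case_prod_conv
    by simp_all (blast | simp add: case_prod_unfold)+
  have "i \<in> A" if "i \<in> I" "\<forall>j\<in>B. (i, j) \<in> R" for i
    using mx[of "insert i A" B] bc that by (auto simp: bicliques_def)
  moreover have "j \<in> B" if "j \<in> J" "\<forall>i\<in>A. (i, j) \<in> R" for j
    using mx[of A "insert j B"] bc that by (auto simp: bicliques_def)
  ultimately show "A = {i\<in>I. \<forall>j\<in>B. (i, j) \<in> R} \<and> B = {j\<in>J. \<forall>i\<in>A. (i, j) \<in> R}"
    using bc by auto
next
  assume h: "A = {i\<in>I. \<forall>j\<in>B. (i, j) \<in> R} \<and> B = {j\<in>J. \<forall>i\<in>A. (i, j) \<in> R}"
  then have bc: "A \<subseteq> I" "B \<subseteq> J" "A \<times> B \<subseteq> R"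
    by blast+
  have "A' = A \<and> B' = B" if "A' \<subseteq> I" "B' \<subseteq> J" "A' \<times> B' \<subseteq> R" "A \<subseteq> A'" "B \<subseteq> B'" for A' B'
  proof -
    have "A' \<subseteq> {i\<in>I. \<forall>j\<in>B. (i, j) \<in> R}" "B' \<subseteq> {j\<in>J. \<forall>i\<in>A. (i, j) \<in> R}"
      using that by blast+
    then show ?thesis
      using h that by blast
  qed
  then show "(A, B) \<in> maxbicliques I J R"
    using bc by (auto simp: maxbicliques_def bicliques_def)
qed

lemma fst_maxbiclique:
  "a \<in> maxbicliques I J R \<Longrightarrow> fst a = {i\<in>I. \<forall>j\<in>snd a. (i, j) \<in> R}"
  by (metis (no_types) maxbicliques_iff prod.collapse)

lemma snd_maxbiclique:
  "a \<in> maxbicliques I J R \<Longrightarrow> snd a = {j\<in>J. \<forall>i\<in>fst a. (i, j) \<in> R}"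
  by (metis (no_types) maxbicliques_iff prod.collapse)

lemma maxbiclique_eqI:
  "a \<in> maxbicliques I J R \<Longrightarrow> b \<in> maxbicliques I J R \<Longrightarrow> snd a = snd b \<Longrightarrow> a = b"
  using fst_maxbiclique[of a I J R] fst_maxbiclique[of b I J R]
  by (intro prod_eqI) (simp_all only:)

lemma finite_maxbicliques: "finite I \<Longrightarrow> finite J \<Longrightarrow> finite (maxbicliques I J R)"
  by (rule finite_subset[of _ "Pow I \<times> Pow J"]) (auto simp: maxbicliques_def bicliques_def)

text \<open>The closure of a set of rows under the Galois connection. For a cone it is the face on
  which all rows of \<open>A\<close> vanish.\<close>

lemma closure_maxbiclique:
  assumes "A \<subseteq> I"
  obtains a where "a \<in> maxbicliques I J R" "snd a = {j\<in>J. \<forall>i\<in>A. (i, j) \<in> R}" "A \<subseteq> fst a"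
proof
  let ?B = "{j\<in>J. \<forall>i\<in>A. (i, j) \<in> R}"
  let ?a = "({i\<in>I. \<forall>j\<in>?B. (i, j) \<in> R}, ?B)"
  show "?a \<in> maxbicliques I J R"
    unfolding maxbicliques_iff
  proof (intro conjI refl equalityI subsetI)
    fix j assume "j \<in> {j\<in>J. \<forall>i\<in>{i\<in>I. \<forall>j\<in>?B. (i, j) \<in> R}. (i, j) \<in> R}"
    then show "j \<in> ?B"
      using assms by blast
  qed simp
  show "snd ?a = ?B" "A \<subseteq> fst ?a"
    using assms by auto
qed

lemma meet_maxbiclique:
  assumes "a \<in> maxbicliques I J R" "b \<in> maxbicliques I J R"
  obtains m where "m \<in> maxbicliques I J R" "snd m = snd a \<inter> snd b"
proof -
  have "fst a \<union> fst b \<subseteq> I"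
    using fst_maxbiclique[OF assms(1)] fst_maxbiclique[OF assms(2)] by auto
  then obtain m where "m \<in> maxbicliques I J R" "snd m = {j\<in>J. \<forall>i\<in>fst a \<union> fst b. (i, j) \<in> R}"
    by (rule closure_maxbiclique)
  moreover have "{j\<in>J. \<forall>i\<in>fst a \<union> fst b. (i, j) \<in> R} = snd a \<inter> snd b"
    using snd_maxbiclique[OF assms(1)] snd_maxbiclique[OF assms(2)] by blast
  ultimately show thesis
    using that by simp
qed

lemma carrier_maxbiclique_lattice [simp]:
  "carrier (maxbiclique_lattice I J R) = maxbicliques I J R"
  by (simp add: maxbiclique_lattice_def)

lemma le_maxbiclique_lattice [simp]:
  "a \<sqsubseteq>\<^bsub>maxbiclique_lattice I J R\<^esub> b \<longleftrightarrow> snd a \<subseteq> snd b"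
  by (simp add: maxbiclique_lattice_def)

lemma lless_maxbiclique_lattice:
  "a \<sqsubset>\<^bsub>maxbiclique_lattice I J R\<^esub> b \<longleftrightarrow> snd a \<subseteq> snd b \<and> a \<noteq> b"
  by (simp add: lless_def maxbiclique_lattice_def)

lemma lless_iff_psubset:
  assumes "a \<in> maxbicliques I J R" "b \<in> maxbicliques I J R"
  shows "a \<sqsubset>\<^bsub>maxbiclique_lattice I J R\<^esub> b \<longleftrightarrow> snd a \<subset> snd b"
  using maxbiclique_eqI[OF assms] by (auto simp: lless_maxbiclique_lattice)

lemma snd_meet_maxbiclique_lattice:
  assumes a: "a \<in> maxbicliques I J R" and b: "b \<in> maxbicliques I J R"
  shows "a \<sqinter>\<^bsub>maxbiclique_lattice I J R\<^esub> b \<in> maxbicliques I J R"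
    and "snd (a \<sqinter>\<^bsub>maxbiclique_lattice I J R\<^esub> b) = snd a \<inter> snd b"
proof -
  let ?L = "maxbiclique_lattice I J R"
  obtain m where m: "m \<in> maxbicliques I J R" "snd m = snd a \<inter> snd b"
    using meet_maxbiclique[OF a b] .
  \<comment> \<open>The meet is a Hilbert choice of a greatest lower bound, so uniqueness is needed
    as well as existence.\<close>
  have iff: "greatest ?L x (Lower ?L {a, b}) \<longleftrightarrow> x = m" for x
  proof
    assume g: "greatest ?L x (Lower ?L {a, b})"
    then have x: "x \<in> maxbicliques I J R" "snd x \<subseteq> snd a" "snd x \<subseteq> snd b"
      using a b unfolding greatest_def Lower_def
      by (simp_all del: split_paired_All)
    have "m \<in> Lower ?L {a, b}"
      using m by (auto simp: Lower_def)
    then have "snd m \<subseteq> snd x"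
      using g unfolding greatest_def by simp
    then show "x = m"
      using x m by (intro maxbiclique_eqI[of _ I J R]) auto
  next
    assume "x = m"
    then show "greatest ?L x (Lower ?L {a, b})"
      using m a b unfolding greatest_def Lower_def
      by (simp add: Ball_def del: split_paired_All)
  qed
  then have "a \<sqinter>\<^bsub>?L\<^esub> b = m"
    by (simp add: meet_def inf_def)
  then show "a \<sqinter>\<^bsub>?L\<^esub> b \<in> maxbicliques I J R" "snd (a \<sqinter>\<^bsub>?L\<^esub> b) = snd a \<inter> snd b"
    using m by auto
qed

section \<open>Flags and rank functions\<close>

lemma chain_maxbicliques_iff:
  "pred_on.chain (maxbicliques I J R) (lless (maxbiclique_lattice I J R)) F \<longleftrightarrow>
     F \<subseteq> maxbicliques I J R \<and> (\<forall>a\<in>F. \<forall>b\<in>F. snd a \<subseteq> snd b \<or> snd b \<subseteq> snd a)"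
proof -
  have "(a \<sqsubset>\<^bsub>maxbiclique_lattice I J R\<^esub> b \<or> a = b) \<or> (b \<sqsubset>\<^bsub>maxbiclique_lattice I J R\<^esub> a \<or> b = a)
      \<longleftrightarrow> snd a \<subseteq> snd b \<or> snd b \<subseteq> snd a"
    if "a \<in> maxbicliques I J R" "b \<in> maxbicliques I J R" for a b
    using maxbiclique_eqI[OF that] by (auto simp: lless_maxbiclique_lattice)
  then show ?thesis
    unfolding pred_on.chain_def by (simp add: subset_eq) blast
qed

lemma flagsD:
  assumes "F \<in> flags (maxbiclique_lattice I J R)"
  shows "F \<subseteq> maxbicliques I J R"
    and "a \<in> F \<Longrightarrow> b \<in> F \<Longrightarrow> snd a \<subseteq> snd b \<or> snd b \<subseteq> snd a"
    and "c \<in> maxbicliques I J R \<Longrightarrow> (\<And>a. a \<in> F \<Longrightarrow> snd a \<subseteq> snd c \<or> snd c \<subseteq> snd a) \<Longrightarrow> c \<in> F"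
proof -
  let ?ch = "pred_on.chain (maxbicliques I J R) (lless (maxbiclique_lattice I J R))"
  have mx: "?ch F" "\<And>S. ?ch S \<Longrightarrow> \<not> F \<subset> S"
    using assms by (auto simp: flags_def pred_on.maxchain_def)
  then show "F \<subseteq> maxbicliques I J R"
    "a \<in> F \<Longrightarrow> b \<in> F \<Longrightarrow> snd a \<subseteq> snd b \<or> snd b \<subseteq> snd a"
    by (auto simp: chain_maxbicliques_iff)
  assume c: "c \<in> maxbicliques I J R" "\<And>a. a \<in> F \<Longrightarrow> snd a \<subseteq> snd c \<or> snd c \<subseteq> snd a"
  then have "?ch (insert c F)"
    using mx(1) by (auto simp: chain_maxbicliques_iff)
  then show "c \<in> F"
    using mx(2) by auto
qed

lemma flag_exists:
  assumes "finite I" "finite J" "a \<in> maxbicliques I J R"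
  obtains F where "F \<in> flags (maxbiclique_lattice I J R)" "a \<in> F"
proof -
  let ?ch = "pred_on.chain (maxbicliques I J R) (lless (maxbiclique_lattice I J R))"
  have "finite {F. ?ch F}"
    by (rule finite_subset[of _ "Pow (maxbicliques I J R)"])
      (auto simp: chain_maxbicliques_iff finite_maxbicliques assms)
  moreover have "{a} \<in> {F. ?ch F}"
    using assms by (auto simp: chain_maxbicliques_iff)
  ultimately have "\<exists>F\<in>{F. ?ch F}. {a} \<subseteq> F \<and> (\<forall>S\<in>{F. ?ch F}. F \<subseteq> S \<longrightarrow> F = S)"
    by (rule finite_has_maximal2)
  then obtain F where "?ch F" "{a} \<subseteq> F" "\<And>S. ?ch S \<Longrightarrow> F \<subseteq> S \<Longrightarrow> F = S"
    by blast
  then have "F \<in> flags (maxbiclique_lattice I J R)"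
    by (auto simp: flags_def pred_on.maxchain_def)
  then show thesis
    using that \<open>{a} \<subseteq> F\<close> by auto
qed

lemma rank_compare:
  fixes r :: "'i set \<times> 'j set \<Rightarrow> nat"
  assumes mono: "\<And>a b. a \<in> maxbicliques I J R \<Longrightarrow> b \<in> maxbicliques I J R \<Longrightarrow> snd a \<subset> snd b \<Longrightarrow> r a < r b"
    and mb: "a \<in> maxbicliques I J R" "b \<in> maxbicliques I J R"
    and cmp: "snd a \<subseteq> snd b \<or> snd b \<subseteq> snd a"
  shows "snd a \<subset> snd b \<longleftrightarrow> r a < r b"
proof
  assume "r a < r b"
  then have "\<not> snd b \<subset> snd a" "a \<noteq> b"
    using mono[OF mb(2,1)] by auto
  then show "snd a \<subset> snd b"
    using cmp maxbiclique_eqI[OF mb] by auto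
qed (rule mono[OF mb])

text \<open>The elements below \<open>a\<close> in the flag correspond under \<open>r\<close> to the
  values below \<open>r a\<close>, all of which are taken. A rank defined by counting in a flag can
  thus be read off from \<open>r\<close>.\<close>

lemma flag_rank_image:
  fixes r :: "'i set \<times> 'j set \<Rightarrow> nat"
  assumes F: "F \<in> flags (maxbiclique_lattice I J R)"
    and mono: "\<And>a b. a \<in> maxbicliques I J R \<Longrightarrow> b \<in> maxbicliques I J R \<Longrightarrow> snd a \<subset> snd b \<Longrightarrow> r a < r b"
    and img: "r ` F = {0..n}"
  shows "card F = n + 1"
    and "a \<in> F \<Longrightarrow> card {b\<in>F. b \<sqsubset>\<^bsub>maxbiclique_lattice I J R\<^esub> a} = r a"
proof -
  note FD = flagsD[OF F]
  have less: "b \<sqsubset>\<^bsub>maxbiclique_lattice I J R\<^esub> a \<longleftrightarrow> r b < r a" if "a \<in> F" "b \<in> F" for a b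
  proof -
    have mb: "b \<in> maxbicliques I J R" "a \<in> maxbicliques I J R"
      using that FD(1) by auto
    show ?thesis
      unfolding lless_iff_psubset[OF mb] using mb FD(2)[OF that(2,1)]
      by (rule rank_compare[rotated]) (rule mono)
  qed
  have inj: "inj_on r F"
  proof (rule inj_onI)
    fix a b assume ab: "a \<in> F" "b \<in> F" "r a = r b"
    then have mb: "a \<in> maxbicliques I J R" "b \<in> maxbicliques I J R"
      using FD(1) by auto
    show "a = b"
      using FD(2)[OF ab(1,2)] mono[OF mb] mono[OF mb(2,1)] maxbiclique_eqI[OF mb] ab(3)
      by (metis less_irrefl psubsetI)
  qed
  then show "card F = n + 1"
    using card_image[OF inj] img by simp
  assume a: "a \<in> F"
  have "{b\<in>F. b \<sqsubset>\<^bsub>maxbiclique_lattice I J R\<^esub> a} = {b\<in>F. r b < r a}"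
    using less[OF a] by (simp add: set_eq_iff del: split_paired_All) blast
  moreover have "r ` {b\<in>F. r b < r a} = {k\<in>r ` F. k < r a}"
    by auto
  moreover have "{k\<in>r ` F. k < r a} = {..<r a}"
  proof -
    have "r a \<le> n"
      using img a by (metis atLeastAtMost_iff imageI)
    then show ?thesis
      unfolding img by auto
  qed
  moreover have "card (r ` {b\<in>F. r b < r a}) = card {b\<in>F. r b < r a}"
    using inj by (intro card_image inj_on_subset[OF inj]) auto
  ultimately show "card {b\<in>F. b \<sqsubset>\<^bsub>maxbiclique_lattice I J R\<^esub> a} = r a"
    by simp
qed

text \<open>\<open>elem_rank\<close> counts in an arbitrarily chosen flag through \<open>a\<close>,
  so a count common to all such flags determines it.\<close>

lemma elem_rank_in_flag:
  assumes "finite I" "finite J" "a \<in> maxbicliques I J R"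
    and "\<And>F. F \<in> flags (maxbiclique_lattice I J R) \<Longrightarrow> a \<in> F \<Longrightarrow>
      card {b\<in>F. b \<sqsubset>\<^bsub>maxbiclique_lattice I J R\<^esub> a} = k"
  shows "elem_rank (maxbiclique_lattice I J R) a = k"
proof -
  let ?Q = "\<lambda>F. F \<in> flags (maxbiclique_lattice I J R) \<and> a \<in> F"
  have "?Q (SOME F. ?Q F)"
    using flag_exists[OF assms(1-3)] by (metis (mono_tags, lifting) someI_ex)
  then show ?thesis
    using assms(4) unfolding elem_rank_def by blast
qed

lemma poset_rank_flag:
  assumes "graded (maxbiclique_lattice I J R)" "F \<in> flags (maxbiclique_lattice I J R)"
  shows "poset_rank (maxbiclique_lattice I J R) = card F - 1"
  using assms unfolding poset_rank_def graded_def by (metis someI_ex)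

definition top_mb :: "'i set \<Rightarrow> 'j set \<Rightarrow> ('i \<times> 'j) set \<Rightarrow> 'i set \<times> 'j set" where
  "top_mb I J R = ({i\<in>I. \<forall>j\<in>J. (i, j) \<in> R}, J)"

definition bot_mb :: "'i set \<Rightarrow> 'j set \<Rightarrow> ('i \<times> 'j) set \<Rightarrow> 'i set \<times> 'j set" where
  "bot_mb I J R = (I, {j\<in>J. \<forall>i\<in>I. (i, j) \<in> R})"

lemma top_mb: "top_mb I J R \<in> maxbicliques I J R" "snd (top_mb I J R) = J"
  by (auto simp: top_mb_def maxbicliques_iff)

lemma bot_mb: "bot_mb I J R \<in> maxbicliques I J R" "fst (bot_mb I J R) = I"
  by (auto simp: bot_mb_def maxbicliques_iff)

lemma snd_le_top: "a \<in> maxbicliques I J R \<Longrightarrow> snd a \<subseteq> J"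
  using snd_maxbiclique[of a I J R] by blast

lemma bot_le_snd: "a \<in> maxbicliques I J R \<Longrightarrow> snd (bot_mb I J R) \<subseteq> snd a"
  by (subst (2) snd_maxbiclique) (auto simp: bot_mb_def dest: fst_maxbiclique)

text \<open>No flag can skip a value \<open>k\<close>: between its last element below
  \<open>k\<close> and its first element at or above \<open>k\<close>, \<open>cov\<close> would
  insert a further element comparable with the whole flag. Hence every flag takes exactly the values
  from 0 to \<open>n\<close>.\<close>

lemma graded_by_rank_function:
  fixes r :: "'i set \<times> 'j set \<Rightarrow> nat"
  assumes fin: "finite I" "finite J"
    and mono: "\<And>a b. a \<in> maxbicliques I J R \<Longrightarrow> b \<in> maxbicliques I J R \<Longrightarrow> snd a \<subset> snd b \<Longrightarrow> r a < r b"
    and cov: "\<And>a b. a \<in> maxbicliques I J R \<Longrightarrow> b \<in> maxbicliques I J R \<Longrightarrow> snd a \<subset> snd b \<Longrightarrow>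
      \<exists>c\<in>maxbicliques I J R. snd a \<subseteq> snd c \<and> snd c \<subset> snd b \<and> r c + 1 = r b"
    and bot: "r (bot_mb I J R) = 0" and top: "r (top_mb I J R) = n"
  shows "graded (maxbiclique_lattice I J R)"
    and "poset_rank (maxbiclique_lattice I J R) = n"
    and "a \<in> maxbicliques I J R \<Longrightarrow> elem_rank (maxbiclique_lattice I J R) a = r a"
proof -
  have img: "r ` F = {0..n}" if F: "F \<in> flags (maxbiclique_lattice I J R)" for F
  proof -
    note FD = flagsD[OF F]
    have finF: "finite F"
      using FD(1) finite_maxbicliques[OF fin] finite_subset by blast
    have botF: "bot_mb I J R \<in> F"
      using FD(1) bot_le_snd by (intro FD(3) bot_mb) blast
    have topF: "top_mb I J R \<in> F"
      using FD(1) snd_le_top[of _ I J R] by (intro FD(3) top_mb(1)) (metis subsetD top_mb(2))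
    have le: "r a \<le> n" if "a \<in> maxbicliques I J R" for a
      using mono[OF that top_mb(1)] snd_le_top[OF that] top maxbiclique_eqI[OF that top_mb(1)] top_mb(2)
      by (metis less_imp_le_nat order_refl psubsetI)
    have "k \<in> r ` F" if k: "k \<le> n" for k
    proof -
      let ?G = "{b\<in>F. k \<le> r b}"
      have "finite ?G" "top_mb I J R \<in> ?G"
        using finF topF top k by simp_all
      then have "finite ?G" "?G \<noteq> {}"
        by blast+
      then obtain b where b: "b \<in> ?G" "\<And>c. c \<in> ?G \<Longrightarrow> r b \<le> r c"
        using ex_min_if_finite[of "r ` ?G"] by (metis (no_types, lifting) arg_min_if_finite(1) arg_min_least)
      have "r b = k"
      proof (rule ccontr)
        assume "r b \<noteq> k"
        then have gt: "r b > k"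
          using b by auto
        let ?A = "{a\<in>F. r a < k}"
        have mbb: "b \<in> maxbicliques I J R"
          using b FD(1) by auto
        show False
        proof (cases "?A = {}")
          case True
          then have "\<not> r (bot_mb I J R) < k"
            using botF by blast
          then have "k = 0"
            using bot by simp
          then show False
            using b(2)[of "bot_mb I J R"] botF bot gt by auto
        next
          case False
          then have "Max (r ` ?A) \<in> r ` ?A"
            using finF by (intro Max_in) auto
          then obtain a where a': "Max (r ` ?A) = r a" and a: "a \<in> ?A"
            by (rule imageE)
          then have a_max: "r c \<le> r a" if "c \<in> ?A" for c
            using finF that unfolding a'[symmetric] by simp
          have mba: "a \<in> maxbicliques I J R"
            using a FD(1) by auto
          have "snd a \<subset> snd b"
            using FD(2)[of a b] a(1) b(1) mono[OF mbb mba] maxbiclique_eqI[OF mba mbb]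
            by (smt (verit) gt mem_Collect_eq not_less_iff_gr_or_eq order_less_trans psubsetI)
          then obtain c where c: "c \<in> maxbicliques I J R" "snd a \<subseteq> snd c" "snd c \<subset> snd b" "r c + 1 = r b"
            using cov[OF mba mbb] by auto
          \<comment> \<open>As \<open>r c\<close> is still at least \<open>k\<close> but below
            \<open>r b\<close>, membership in the flag contradicts the choice of
            \<open>b\<close>.\<close>
          have "c \<in> F"
          proof (rule FD(3)[OF c(1)])
            fix x assume x: "x \<in> F"
            then have mbx: "x \<in> maxbicliques I J R"
              using FD(1) by auto
            show "snd x \<subseteq> snd c \<or> snd c \<subseteq> snd x"
            proof (cases "r x < k")
              case True
              then have "r x \<le> r a"
                using a_max x by simp
              then have "snd x \<subseteq> snd a"
                using FD(2)[of x a] x a mono[OF mba mbx] maxbiclique_eqI[OF mba mbx]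
                by (metis (no_types, lifting) leD mem_Collect_eq psubsetI subset_refl)
              then show ?thesis
                using c by auto
            next
              case False
              then have "r b \<le> r x"
                using b x by auto
              then have "snd b \<subseteq> snd x"
                using FD(2)[of x b] x b mono[OF mbx mbb]
                by (metis (no_types, lifting) leD mem_Collect_eq psubsetI subset_refl)
              then show ?thesis
                using c by auto
            qed
          qed
          then show False
            using b(2)[of c] c gt by auto
        qed
      qed
      then show ?thesis
        using b by auto
    qed
    then show ?thesis
      using le FD(1) by auto
  qed
  note fr = flag_rank_image[OF _ mono img]
  show gr: "graded (maxbiclique_lattice I J R)"
    unfolding graded_def using fr(1) by metis
  obtain F where F: "F \<in> flags (maxbiclique_lattice I J R)"
    using flag_exists[OF fin top_mb(1)] .
  show "poset_rank (maxbiclique_lattice I J R) = n"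
    using poset_rank_flag[OF gr F] fr(1)[OF F] F by simp
  show "elem_rank (maxbiclique_lattice I J R) a = r a" if "a \<in> maxbicliques I J R"
    using that by (intro elem_rank_in_flag fin fr(2))
qed

text \<open>Pigeonhole: a flag has \<open>n + 1\<close> elements and \<open>r\<close> is injective
  on it with values in \<open>{0..n}\<close>, so all values occur. A bound for \<open>r\<close> at
  the top alone thereby determines \<open>r\<close> everywhere.\<close>

lemma elem_rank_unique:
  fixes r :: "'i set \<times> 'j set \<Rightarrow> nat"
  assumes fin: "finite I" "finite J"
    and gr: "graded (maxbiclique_lattice I J R)"
    and rk: "poset_rank (maxbiclique_lattice I J R) = n" and n: "0 < n"
    and mono: "\<And>a b. a \<in> maxbicliques I J R \<Longrightarrow> b \<in> maxbicliques I J R \<Longrightarrow> snd a \<subset> snd b \<Longrightarrow> r a < r b"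
    and le: "r (top_mb I J R) \<le> n"
  shows "r (top_mb I J R) = n"
    and "r (bot_mb I J R) = 0"
    and "a \<in> maxbicliques I J R \<Longrightarrow> elem_rank (maxbiclique_lattice I J R) a = r a"
    and "a \<in> maxbicliques I J R \<Longrightarrow> 0 < r a \<Longrightarrow>
      \<exists>b\<in>maxbicliques I J R. snd b \<subset> snd a \<and> r b + 1 = r a"
proof -
  have le': "r a \<le> n" if "a \<in> maxbicliques I J R" for a
    using mono[OF that top_mb(1)] snd_le_top[OF that] le maxbiclique_eqI[OF that top_mb(1)] top_mb(2)
    by (metis dual_order.trans less_imp_le_nat psubsetI)
  have img: "r ` F = {0..n}" if F: "F \<in> flags (maxbiclique_lattice I J R)" for F
  proof -
    note FD = flagsD[OF F]
    \<comment> \<open>\<open>poset_rank\<close> is a truncated difference; \<open>0 < n\<close>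
      rules out \<open>card F = 0\<close>.\<close>
    have "card F = n + 1"
      using poset_rank_flag[OF gr F] rk n by linarith
    moreover have "inj_on r F"
    proof (rule inj_onI)
      fix a b assume ab: "a \<in> F" "b \<in> F" "r a = r b"
      then have mb: "a \<in> maxbicliques I J R" "b \<in> maxbicliques I J R"
        using FD(1) by auto
      show "a = b"
        using FD(2)[OF ab(1,2)] mono[OF mb] mono[OF mb(2,1)] maxbiclique_eqI[OF mb] ab(3)
        by (metis less_irrefl psubsetI)
    qed
    ultimately have "card (r ` F) = card {0..n}"
      by (simp add: card_image)
    moreover have "r ` F \<subseteq> {0..n}"
      using le' FD(1) by auto
    ultimately show ?thesis
      by (intro card_subset_eq) auto
  qed
  note fr = flag_rank_image[OF _ mono img]
  show "elem_rank (maxbiclique_lattice I J R) a = r a" if "a \<in> maxbicliques I J R" for a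
    using that by (intro elem_rank_in_flag fin fr(2))
  \<comment> \<open>A flag through \<open>a\<close> takes the value \<open>k\<close>, and by
    monotonicity it can only do so below \<open>a\<close>.\<close>
  have lower: "\<exists>b\<in>maxbicliques I J R. snd b \<subset> snd a \<and> r b = k"
    if a: "a \<in> maxbicliques I J R" "k < r a" for a k
  proof -
    obtain F where F: "F \<in> flags (maxbiclique_lattice I J R)" "a \<in> F"
      using flag_exists[OF fin a(1)] .
    note FD = flagsD[OF F(1)]
    have "k \<in> r ` F"
      using img[OF F(1)] a le'[OF a(1)] by auto
    then obtain b where b: "b \<in> F" "r b = k"
      by auto
    then have mbb: "b \<in> maxbicliques I J R"
      using FD(1) by auto
    have "snd b \<subset> snd a"
      using FD(2)[OF F(2) b(1)] mono[OF a(1) mbb] b a(2) maxbiclique_eqI[OF a(1) mbb]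
      by (metis less_asym psubsetI nat_neq_iff)
    then show ?thesis
      using mbb b by auto
  qed
  show "\<exists>b\<in>maxbicliques I J R. snd b \<subset> snd a \<and> r b + 1 = r a"
    if "a \<in> maxbicliques I J R" "0 < r a" for a
    using lower[OF that(1), of "r a - 1"] that by force
  show "r (bot_mb I J R) = 0"
    using lower[OF bot_mb(1)] bot_le_snd by (metis bot_nat_0.not_eq_extremum leD psubset_eq psubset_subset_trans)
  obtain F where F: "F \<in> flags (maxbiclique_lattice I J R)"
    using flag_exists[OF fin top_mb(1)] .
  then obtain a where "a \<in> F" "r a = n"
    using img[OF F] by (metis atLeastAtMost_iff image_iff order_refl zero_le)
  then show "r (top_mb I J R) = n"
    using le mono[OF _ top_mb(1)] flagsD(1)[OF F] snd_le_top
    by (metis antisym_conv2 leD maxbiclique_eqI psubsetI subset_iff top_mb(1) top_mb(2))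
qed

section \<open>Matrix rank and factorizations\<close>

interpretation fun_space: vector_space "\<lambda>(c::real) (f :: 'j \<Rightarrow> real). (\<lambda>j. c * f j)"
  by unfold_locales (auto simp: fun_eq_iff algebra_simps)

text \<open>On \<open>W\<close>, a functional is represented by the orthogonal projection of its
  normal, so normals can always be chosen inside the subspace that carries the cone.\<close>

lemma subspace_projection:
  fixes W :: "'v::euclidean_space set"
  assumes "subspace W"
  obtains p where "p \<in> W" "\<And>x. x \<in> W \<Longrightarrow> p \<bullet> x = y \<bullet> x"
proof -
  obtain p q where "p \<in> span W" "\<And>w. w \<in> span W \<Longrightarrow> orthogonal q w" "y = p + q"
    using orthogonal_subspace_decomp_exists[of W y] by metis
  then show thesis
    using that[of p] assms[folded span_eq_iff] by (simp add: orthogonal_def inner_add_left)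
qed

text \<open>Row \<open>i\<close> is the image of \<open>h i\<close> under the linear map
  \<open>\<phi>\<close> that evaluates against all \<open>w j\<close>, so the images of a basis of
  \<open>W\<close> span the row space.\<close>

lemma rank_le_dim_rows:
  fixes W :: "'v::euclidean_space set"
  assumes "subspace W" and h: "\<And>i. i \<in> I \<Longrightarrow> h i \<in> W"
    and M: "\<And>i j. i \<in> I \<Longrightarrow> j \<in> J \<Longrightarrow> M i j = h i \<bullet> w j"
  shows "matrix_rank I J M \<le> dim W"
proof -
  obtain E where E: "E \<subseteq> W" "independent E" "W \<subseteq> span E" "card E = dim W"
    using basis_exists[of W] by metis
  have finE: "finite E"
    using E(2) finiteI_independent by blast
  define \<phi> where "\<phi> = (\<lambda>x j. if j \<in> J then x \<bullet> w j else 0)"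
  have "\<phi> x \<in> fun_space.span (\<phi> ` E)" if "x \<in> span E" for x
    using that
  proof (induction rule: span_induct_alt)
    case base
    have "\<phi> 0 = 0"
      by (auto simp: \<phi>_def)
    then show ?case
      using fun_space.span_zero by metis
  next
    case (step c x y)
    have "\<phi> (c *\<^sub>R x + y) = (\<lambda>j. c * \<phi> x j) + \<phi> y"
      by (auto simp: \<phi>_def fun_eq_iff inner_add_left)
    then show ?case
      using step fun_space.span_add[OF fun_space.span_scale[OF fun_space.span_base[of "\<phi> x"]]]
      by (metis imageI)
  qed
  moreover have "(\<lambda>j. if j \<in> J then M i j else 0) = \<phi> (h i)" if "i \<in> I" for i
    using that by (auto simp: \<phi>_def M)
  ultimately have "(\<lambda>i j. if j \<in> J then M i j else 0) ` I \<subseteq> fun_space.span (\<phi> ` E)"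
    using h E(3) by auto
  then have "matrix_rank I J M \<le> card (\<phi> ` E)"
    unfolding matrix_rank_def using finE by (intro fun_space.dim_le_card) auto
  also have "\<dots> \<le> dim W"
    using card_image_le[OF finE] E(4) by metis
  finally show ?thesis .
qed

text \<open>Only the values of the functionals \<open>h i\<close> on \<open>W\<close> enter the
  matrix, so the rows may first be projected into \<open>W\<close>.\<close>

lemma rank_le_dim_columns:
  fixes W :: "'v::euclidean_space set"
  assumes W: "subspace W" and w: "\<And>j. j \<in> J \<Longrightarrow> w j \<in> W"
    and M: "\<And>i j. i \<in> I \<Longrightarrow> j \<in> J \<Longrightarrow> M i j = h i \<bullet> w j"
  shows "matrix_rank I J M \<le> dim W"
proof -
  have "\<forall>i. \<exists>p. p \<in> W \<and> (\<forall>x\<in>W. p \<bullet> x = h i \<bullet> x)"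
    by (metis subspace_projection[OF W])
  then obtain p where "\<And>i. p i \<in> W" "\<And>i x. x \<in> W \<Longrightarrow> p i \<bullet> x = h i \<bullet> x"
    by metis
  then show ?thesis
    by (intro rank_le_dim_rows[OF W, where h = p and w = w]) (auto simp: M w)
qed

text \<open>The members of a row basis \<open>B\<close> are sent to distinct orthonormal vectors of
  \<open>W\<close>. Then \<open>h i\<close> carries the coordinates of row \<open>i\<close> in
  \<open>B\<close>, and \<open>w j\<close> the \<open>j\<close>-th entries of the basis rows; their
  inner product expands row \<open>i\<close> at \<open>j\<close>.\<close>

lemma rank_factorization:
  fixes W :: "'v::euclidean_space set"
  assumes finI: "finite I" and W: "subspace W" and rk: "matrix_rank I J M \<le> dim W"
  obtains h w where "\<And>i. h i \<in> W" "\<And>j. w j \<in> W"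
    "\<And>i j. i \<in> I \<Longrightarrow> j \<in> J \<Longrightarrow> M i j = h i \<bullet> w j"
proof -
  define \<rho> where "\<rho> = (\<lambda>i j. if j \<in> J then M i j else 0)"
  obtain B where B: "B \<subseteq> \<rho> ` I" "\<rho> ` I \<subseteq> fun_space.span B" "card B = fun_space.dim (\<rho> ` I)"
    using fun_space.basis_exists[of "\<rho> ` I"] by metis
  have finB: "finite B"
    using B(1) finI finite_subset by blast
  obtain E where E: "E \<subseteq> W" "pairwise orthogonal E" "\<And>x. x \<in> E \<Longrightarrow> norm x = 1"
    "independent E" "card E = dim W"
    using orthonormal_basis_subspace[OF W] by metis
  have finE: "finite E"
    using E(4) finiteI_independent by blast
  have "card B \<le> card E"
    using B(3) E(5) rk by (simp add: matrix_rank_def \<rho>_def)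
  then obtain e where e: "e ` B \<subseteq> E" "inj_on e B"
    using card_le_inj[OF finB finE] by auto
  have on: "e b \<bullet> e b' = (if b = b' then 1 else 0)" if "b \<in> B" "b' \<in> B" for b b'
  proof (cases "b = b'")
    case True
    have "norm (e b) = 1"
      using that e(1) E(3) by blast
    then show ?thesis
      using True by (simp add: norm_eq_1)
  next
    case False
    then have "e b \<noteq> e b'"
      using that e(2) by (meson inj_onD)
    then show ?thesis
      using that e(1) E(2) False by (auto simp: pairwise_def orthogonal_def)
  qed
  have "\<exists>c. \<rho> i = (\<Sum>b\<in>B. (\<lambda>j. c b * b j))" if "i \<in> I" for i
    using B(2) that fun_space.span_finite[OF finB] by auto
  then obtain c where c: "\<And>i. i \<in> I \<Longrightarrow> \<rho> i = (\<Sum>b\<in>B. (\<lambda>j. c i b * b j))"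
    by metis
  define h where "h = (\<lambda>i. \<Sum>b\<in>B. c i b *\<^sub>R e b)"
  define w where "w = (\<lambda>j. \<Sum>b\<in>B. b j *\<^sub>R e b)"
  have eW: "e b \<in> W" if "b \<in> B" for b
    using that e(1) E(1) by auto
  show thesis
  proof
    show "h i \<in> W" "w j \<in> W" for i j
      unfolding h_def w_def using W eW by (auto intro!: subspace_sum subspace_scale)
    fix i j assume ij: "i \<in> I" "j \<in> J"
    have "h i \<bullet> w j = (\<Sum>b\<in>B. (c i b *\<^sub>R e b) \<bullet> w j)"
      by (simp only: h_def inner_sum_left)
    also have "\<dots> = (\<Sum>b\<in>B. \<Sum>b'\<in>B. c i b * (b' j * (e b \<bullet> e b')))"
      by (simp add: w_def inner_sum_right sum_distrib_left mult.left_commute)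
    also have "\<dots> = (\<Sum>b\<in>B. \<Sum>b'\<in>B. if b = b' then c i b * b' j else 0)"
      by (intro sum.cong) (auto simp: on)
    also have "\<dots> = (\<Sum>b\<in>B. c i b * b j)"
      using finB by (simp add: sum.delta')
    also have "\<dots> = (\<Sum>b\<in>B. (\<lambda>j. c i b * b j)) j"
      by (induction B rule: infinite_finite_induct) auto
    also have "\<dots> = M i j"
      using c[OF ij(1), symmetric] ij by (simp add: \<rho>_def)
    finally show "M i j = h i \<bullet> w j" ..
  qed
qed

text \<open>Otherwise the rank bound, applied to the smaller span, would contradict the full
  rank.\<close>

lemma span_rows_of_factorization:
  fixes W :: "'v::euclidean_space set"
  assumes W: "subspace W" and h: "\<And>i. i \<in> I \<Longrightarrow> h i \<in> W"
    and M: "\<And>i j. i \<in> I \<Longrightarrow> j \<in> J \<Longrightarrow> M i j = h i \<bullet> w j" and rk: "dim W \<le> matrix_rank I J M"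
  shows "span (h ` I) = W"
proof -
  have "matrix_rank I J M \<le> dim (span (h ` I))"
    by (rule rank_le_dim_rows[where h = h and w = w]) (auto simp: M span_base)
  moreover have "span (h ` I) \<subseteq> W"
    using h W by (intro span_minimal) auto
  ultimately show ?thesis
    using rk W by (intro subspace_dim_equal) auto
qed

lemma span_columns_of_factorization:
  fixes W :: "'v::euclidean_space set"
  assumes W: "subspace W" and w: "\<And>j. j \<in> J \<Longrightarrow> w j \<in> W"
    and M: "\<And>i j. i \<in> I \<Longrightarrow> j \<in> J \<Longrightarrow> M i j = h i \<bullet> w j" and rk: "dim W \<le> matrix_rank I J M"
  shows "span (w ` J) = W"
proof -
  have "matrix_rank I J M \<le> dim (span (w ` J))"
    by (rule rank_le_dim_columns[where h = h and w = w]) (auto simp: M span_base)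
  moreover have "span (w ` J) \<subseteq> W"
    using w W by (intro span_minimal) auto
  ultimately show ?thesis
    using rk W by (intro subspace_dim_equal) auto
qed

lemma zero_if_orthogonal_to_span:
  fixes x :: "'v::real_inner"
  assumes "span (h ` I) = W" "x \<in> W" "\<And>i. i \<in> I \<Longrightarrow> h i \<bullet> x = 0"
  shows "x = 0"
proof -
  have "y \<bullet> x = 0" if "y \<in> span (h ` I)" for y
    using that by (induction rule: span_induct_alt) (auto simp: inner_add_left assms(3))
  then have "x \<bullet> x = 0"
    using assms(1,2) by auto
  then show ?thesis
    by simp
qed

text \<open>A full-rank factorization is unique up to a linear automorphism. The map is prescribed
  on a basis taken from the \<open>w j\<close>; on the remaining columns it is correct because the
  \<open>h' i\<close> span \<open>W\<close> and therefore separate its points.\<close>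

lemma linear_map_of_factorizations:
  fixes W :: "'v::euclidean_space set"
  assumes W: "subspace W"
    and w: "span (w ` J) = W" and w': "span (w' ` J) = W" 
    and h: "span (h ` I) = W" and h': "span (h' ` I) = W"
    and eq: "\<And>i j. i \<in> I \<Longrightarrow> j \<in> J \<Longrightarrow> h i \<bullet> w j = h' i \<bullet> w' j"
  obtains g where "linear g" "bij_betw g W W" "\<And>j. j \<in> J \<Longrightarrow> g (w j) = w' j"
    "\<And>i x. i \<in> I \<Longrightarrow> x \<in> W \<Longrightarrow> h' i \<bullet> g x = h i \<bullet> x"
proof -
  obtain B where B: "B \<subseteq> w ` J" "independent B" "w ` J \<subseteq> span B" "card B = dim (w ` J)"
    using basis_exists[of "w ` J"] by metis
  have spB: "span B = W"
  proof
    show "span B \<subseteq> W"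
      using span_mono[OF B(1)] w by simp
    show "W \<subseteq> span B"
      using span_minimal[OF B(3) subspace_span] w by simp
  qed
  obtain s where s: "\<And>b. b \<in> B \<Longrightarrow> s b \<in> J \<and> w (s b) = b"
    using B(1) by (metis image_iff subsetD)
  obtain g where g: "linear g" "\<And>b. b \<in> B \<Longrightarrow> g b = w' (s b)"
    using linear_independent_extend[OF B(2), of "\<lambda>b. w' (s b)"] by metis
  interpret g: linear g by fact
  have w'W: "w' j \<in> W" if "j \<in> J" for j
    using span_base[OF imageI[OF that, of w']] unfolding w' .
  have gB: "h' i \<bullet> g b = h i \<bullet> b" "g b \<in> W" if "b \<in> B" "i \<in> I" for b i
    using eq[of i "s b"] s[OF that(1)] g(2)[OF that(1)] w'W that by simp_all
  have gh: "h' i \<bullet> g x = h i \<bullet> x" if i: "i \<in> I" and x: "x \<in> span B" for x i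
    using x
  proof (induction rule: span_induct_alt)
    case (step c x y)
    then show ?case
      using gB(1)[OF _ i] by (simp add: g.add g.scale inner_add_right)
  qed (simp add: g.zero)
  have gW: "g x \<in> W" if "x \<in> W" for x
  proof -
    have "g ` B \<subseteq> W"
      using g(2) s w'W by auto
    then have "span (g ` B) \<subseteq> W"
      using W by (rule span_minimal)
    then have "g ` span B \<subseteq> W"
      unfolding linear_span_image[OF g(1)] .
    then show ?thesis
      using that spB by auto
  qed
  note gh = gh[unfolded spB]
  have wW: "w j \<in> W" if "j \<in> J" for j
    using span_base[OF imageI[OF that, of w]] unfolding w .
  have gw: "g (w j) = w' j" if j: "j \<in> J" for j
  proof -
    have "g (w j) - w' j = 0"
      using gW[OF wW[OF j]] w'W[OF j] gh[OF _ wW[OF j]] eq[OF _ j]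
      by (intro zero_if_orthogonal_to_span[OF h'] subspace_diff[OF W]) (simp_all add: inner_diff_right)
    then show ?thesis
      by simp
  qed
  have "W \<subseteq> g ` W"
  proof -
    have "w' ` J \<subseteq> g ` W"
      using gw wW by (metis image_eqI image_subsetI)
    then have "span (w' ` J) \<subseteq> g ` W"
      using W g(1) by (intro span_minimal) (auto intro: linear_subspace_image)
    then show ?thesis
      using w' by simp
  qed
  then have surj: "g ` W = W"
    using gW by auto
  have "inj_on g W"
  proof (rule inj_onI)
    fix x y assume xy: "x \<in> W" "y \<in> W" "g x = g y"
    then have "h i \<bullet> (x - y) = 0" if "i \<in> I" for i
      using gh[OF that] by (metis inner_diff_right right_minus_eq)
    then have "x - y = 0"
      using xy W by (intro zero_if_orthogonal_to_span[OF h] subspace_diff)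
    then show "x = y"
      by simp
  qed
  with surj have "bij_betw g W W"
    by (simp add: bij_betw_def)
  then show thesis
    using that g(1) gw gh by metis
qed

section \<open>Cones spanned by a configuration of vectors\<close>

text \<open>The generators form an indexed family and coefficients belong to indices, since
  injectivity of \<open>w\<close> is only a later consequence (\<open>inj_w\<close>).\<close>

definition gcone :: "('j \<Rightarrow> 'v::real_vector) \<Rightarrow> 'j set \<Rightarrow> 'v set" where
  "gcone w B = {\<Sum>j\<in>B. c j *\<^sub>R w j | c. \<forall>j\<in>B. 0 \<le> c j}"

lemma gconeI: "(\<And>j. j \<in> B \<Longrightarrow> 0 \<le> c j) \<Longrightarrow> (\<Sum>j\<in>B. c j *\<^sub>R w j) \<in> gcone w B"
  unfolding gcone_def by auto

lemma gconeE:
  assumes "x \<in> gcone w B"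
  obtains c where "\<And>j. j \<in> B \<Longrightarrow> 0 \<le> c j" "x = (\<Sum>j\<in>B. c j *\<^sub>R w j)"
  using assms unfolding gcone_def by auto

lemma gcone_zero [simp]: "0 \<in> gcone w B"
  using gconeI[of B "\<lambda>_. 0" w] by simp

lemma gcone_add: "x \<in> gcone w B \<Longrightarrow> y \<in> gcone w B \<Longrightarrow> x + y \<in> gcone w B"
  by (elim gconeE, simp add: sum.distrib[symmetric] scaleR_add_left[symmetric])
    (intro gconeI add_nonneg_nonneg)

lemma gcone_scale: "x \<in> gcone w B \<Longrightarrow> 0 \<le> t \<Longrightarrow> t *\<^sub>R x \<in> gcone w B"
  by (elim gconeE, simp add: scaleR_sum_right) (intro gconeI mult_nonneg_nonneg)

lemma gcone_mono:
  assumes "finite B" "A \<subseteq> B"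
  shows "gcone w A \<subseteq> gcone w B"
proof
  fix x assume "x \<in> gcone w A"
  then obtain c where c: "\<And>j. j \<in> A \<Longrightarrow> 0 \<le> c j" "x = (\<Sum>j\<in>A. c j *\<^sub>R w j)"
    by (metis gconeE)
  have "x = (\<Sum>j\<in>B. (if j \<in> A then c j else 0) *\<^sub>R w j)"
    unfolding c(2) using assms by (intro sum.mono_neutral_cong_left) auto
  also have "\<dots> \<in> gcone w B"
    using c(1) by (intro gconeI) auto
  finally show "x \<in> gcone w B" .
qed

text \<open>A vanishing sum of terms of one sign has only zero terms, so every generator with a
  nonzero coefficient lies on the hyperplane.\<close>

lemma gcone_face:
  assumes fin: "finite B" and y: "\<And>j. j \<in> B \<Longrightarrow> y \<bullet> w j \<le> 0" and x: "x \<in> gcone w B" "y \<bullet> x = 0"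
  shows "x \<in> gcone w {j\<in>B. y \<bullet> w j = 0}"
proof -
  obtain c where c: "\<And>j. j \<in> B \<Longrightarrow> 0 \<le> c j" "x = (\<Sum>j\<in>B. c j *\<^sub>R w j)"
    using x(1) by (metis gconeE)
  have "(\<Sum>j\<in>B. - (c j * (y \<bullet> w j))) = 0"
    using x(2) by (simp add: c(2) inner_sum_right sum_negf)
  then have "\<forall>j\<in>B. - (c j * (y \<bullet> w j)) = 0"
    using c(1) y by (subst (asm) sum_nonneg_eq_0_iff[OF fin]) (auto simp: mult_nonneg_nonpos)
  then have "x = (\<Sum>j\<in>{j\<in>B. y \<bullet> w j = 0}. c j *\<^sub>R w j)"
    unfolding c(2) using fin by (intro sum.mono_neutral_right) auto
  also have "\<dots> \<in> gcone w {j\<in>B. y \<bullet> w j = 0}"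
    using c(1) by (intro gconeI) auto
  finally show ?thesis .
qed

lemma gcone_base: "finite B \<Longrightarrow> j \<in> B \<Longrightarrow> w j \<in> gcone w B"
  using gcone_mono[of B "{j}" w] gconeI[of "{j}" "\<lambda>_. 1" w] by auto

lemma gcone_subset_span: "gcone w B \<subseteq> span (w ` B)"
  by (auto elim!: gconeE intro!: span_sum span_scale intro: span_base)

lemma gcone_sum_in: "finite B \<Longrightarrow> (\<Sum>j\<in>B. w j) \<in> gcone w B"
  using gconeI[of B "\<lambda>_. 1" w] by simp

text \<open>The openness argument behind all perturbations: \<open>\<alpha>\<close> holds the values
  of finitely many functionals at a point where they are strictly negative, \<open>\<beta>\<close>
  their values at the direction of the move.\<close>

lemma strict_perturbation:
  fixes \<alpha> \<beta> :: "'k \<Rightarrow> real"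
  assumes "finite S" "\<And>k. k \<in> S \<Longrightarrow> \<alpha> k < 0"
  obtains \<epsilon> where "\<epsilon> > 0" "\<And>k. k \<in> S \<Longrightarrow> \<alpha> k + \<epsilon> * \<beta> k \<le> 0"
proof -
  have "\<exists>\<epsilon>>0. \<forall>k\<in>S. \<alpha> k + \<epsilon> * \<beta> k \<le> 0"
    using assms
  proof (induction S)
    case empty
    then show ?case
      by (auto intro: exI[of _ 1])
  next
    case (insert k S)
    then obtain \<epsilon> where \<epsilon>: "\<epsilon> > 0" "\<And>l. l \<in> S \<Longrightarrow> \<alpha> l + \<epsilon> * \<beta> l \<le> 0"
      by auto
    \<comment> \<open>The added 1 keeps the denominator positive when \<open>\<beta> k\<close> is
      zero; the minimum with \<open>\<epsilon>\<close> preserves the inequalities already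
      obtained.\<close>
    define \<delta> where "\<delta> = min \<epsilon> (- \<alpha> k / (\<bar>\<beta> k\<bar> + 1))"
    have ak: "\<alpha> k < 0"
      using insert by auto
    have d: "\<delta> > 0" "\<delta> \<le> \<epsilon>"
      using \<epsilon>(1) divide_neg_pos[OF ak, of "\<bar>\<beta> k\<bar> + 1"] by (auto simp: \<delta>_def)
    have "\<delta> * (\<bar>\<beta> k\<bar> + 1) \<le> - \<alpha> k / (\<bar>\<beta> k\<bar> + 1) * (\<bar>\<beta> k\<bar> + 1)"
      by (intro mult_right_mono) (auto simp: \<delta>_def)
    then have "\<delta> * (\<bar>\<beta> k\<bar> + 1) \<le> - \<alpha> k"
      by (simp add: add_pos_nonneg)
    moreover have "\<delta> * \<beta> k \<le> \<delta> * (\<bar>\<beta> k\<bar> + 1)"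
      using d by (intro mult_left_mono) auto
    ultimately have "\<alpha> k + \<delta> * \<beta> k \<le> 0"
      by linarith
    moreover have "\<alpha> l + \<delta> * \<beta> l \<le> 0" if "l \<in> S" for l
    proof (cases "\<beta> l \<ge> 0")
      case True
      then have "\<delta> * \<beta> l \<le> \<epsilon> * \<beta> l"
        using d by (intro mult_right_mono) auto
      then show ?thesis
        using \<epsilon>(2)[OF that] by linarith
    next
      case False
      then have "\<delta> * \<beta> l \<le> 0"
        using d by (simp add: mult_nonneg_nonpos)
      then show ?thesis
        using insert.prems[of l] that by auto
    qed
    ultimately show ?case
      using d(1) by auto
  qed
  then show thesis
    using that by blast
qed

section \<open>Vectors whose inner products have the signs of a filled 0-incidence matrix\<close>

locale configuration =
  fixes I :: "'i set" and J :: "'j set" and R :: "('i \<times> 'j) set"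
    and h :: "'i \<Rightarrow> 'v::euclidean_space" and w :: "'j \<Rightarrow> 'v"
  assumes finite_I: "finite I" and finite_J: "finite J"
    and le0: "\<And>i j. i \<in> I \<Longrightarrow> j \<in> J \<Longrightarrow> h i \<bullet> w j \<le> 0"
    and eq0_iff: "\<And>i j. i \<in> I \<Longrightarrow> j \<in> J \<Longrightarrow> h i \<bullet> w j = 0 \<longleftrightarrow> (i, j) \<in> R"
begin

abbreviation MB :: "('i set \<times> 'j set) set" where "MB \<equiv> maxbicliques I J R"
abbreviation L :: "('i set \<times> 'j set) gorder" where "L \<equiv> maxbiclique_lattice I J R"

text \<open>A maxbiclique \<open>a\<close> stands for the cone over \<open>w ` snd a\<close>, which has the span \<open>U a\<close>. The
  functional \<open>H a\<close> exposes this cone as a face, and \<open>Z a\<close> is a point in its relative interior.\<close>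

definition U :: "'i set \<times> 'j set \<Rightarrow> 'v set" where "U a = span (w ` snd a)"
definition r :: "'i set \<times> 'j set \<Rightarrow> nat" where "r a = dim (U a)"
definition H :: "'i set \<times> 'j set \<Rightarrow> 'v" where "H a = (\<Sum>i\<in>fst a. h i)"
definition Z :: "'i set \<times> 'j set \<Rightarrow> 'v" where "Z a = (\<Sum>j\<in>snd a. w j)"
definition lcover :: "'i set \<times> 'j set \<Rightarrow> 'i set \<times> 'j set \<Rightarrow> bool" where
  "lcover a b \<longleftrightarrow> a \<in> MB \<and> b \<in> MB \<and> snd b \<subset> snd a \<and> r b + 1 = r a"

lemma fst_sub: "a \<in> MB \<Longrightarrow> fst a \<subseteq> I"
  using fst_maxbiclique[of a I J R] by blast

lemma snd_sub: "a \<in> MB \<Longrightarrow> snd a \<subseteq> J"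
  by (rule snd_le_top)

lemma finite_snd: "a \<in> MB \<Longrightarrow> finite (snd a)"
  using snd_sub finite_J finite_subset by blast

lemma finite_MB: "finite MB"
  by (rule finite_maxbicliques[OF finite_I finite_J])

lemma H_le0:
  assumes "a \<in> MB" "j \<in> J"
  shows "H a \<bullet> w j \<le> 0"
  unfolding H_def inner_sum_left using fst_sub[OF assms(1)] assms(2)
  by (intro sum_nonpos le0) auto

text \<open>A sum of nonpositive numbers vanishes only termwise, and the columns incident with all
  of \<open>fst a\<close> are exactly \<open>snd a\<close> because the pair is closed. So
  \<open>H a\<close> exposes the generators of \<open>a\<close> and no others.\<close>

lemma H_eq0_iff:
  assumes a: "a \<in> MB" and j: "j \<in> J"
  shows "H a \<bullet> w j = 0 \<longleftrightarrow> j \<in> snd a"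
proof -
  have fin: "finite (fst a)"
    using fst_sub[OF a] finite_I finite_subset by blast
  have "H a \<bullet> w j = 0 \<longleftrightarrow> (\<Sum>i\<in>fst a. - (h i \<bullet> w j)) = 0"
    by (simp add: H_def inner_sum_left sum_negf)
  also have "\<dots> \<longleftrightarrow> (\<forall>i\<in>fst a. - (h i \<bullet> w j) = 0)"
    using fin le0 fst_sub[OF a] j by (intro sum_nonneg_eq_0_iff) auto
  also have "\<dots> \<longleftrightarrow> (\<forall>i\<in>fst a. (i, j) \<in> R)"
    using eq0_iff fst_sub[OF a] j by auto
  also have "\<dots> \<longleftrightarrow> j \<in> snd a"
    using snd_maxbiclique[OF a] j by blast
  finally show ?thesis .
qed

lemma H_neg: "a \<in> MB \<Longrightarrow> j \<in> J \<Longrightarrow> j \<notin> snd a \<Longrightarrow> H a \<bullet> w j < 0"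
  using H_le0 H_eq0_iff by (metis less_eq_real_def)

lemma inner_gcone_le0:
  assumes "\<And>j. j \<in> B \<Longrightarrow> y \<bullet> w j \<le> 0" "x \<in> gcone w B"
  shows "y \<bullet> x \<le> 0"
  using assms by (elim gconeE) (auto simp: inner_sum_right intro!: sum_nonpos mult_nonneg_nonpos)

lemma h_gcone_le0: "i \<in> I \<Longrightarrow> x \<in> gcone w J \<Longrightarrow> h i \<bullet> x \<le> 0"
  by (rule inner_gcone_le0) (auto intro: le0)

lemma H_gcone_le0: "a \<in> MB \<Longrightarrow> x \<in> gcone w J \<Longrightarrow> H a \<bullet> x \<le> 0"
  by (rule inner_gcone_le0) (auto intro: H_le0)

lemma subspace_U: "subspace (U a)"
  by (simp add: U_def)

lemma w_in_U: "j \<in> snd a \<Longrightarrow> w j \<in> U a"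
  by (simp add: U_def span_base)

lemma U_mono: "snd a \<subseteq> snd b \<Longrightarrow> U a \<subseteq> U b"
  unfolding U_def by (intro span_mono) auto

lemma inner_U_eq0:
  assumes "x \<in> U a" "\<And>j. j \<in> snd a \<Longrightarrow> y \<bullet> w j = 0"
  shows "y \<bullet> x = 0"
  using assms(1) unfolding U_def
  by (induction rule: span_induct_alt) (auto simp: inner_add_right assms(2))

lemma H_U_eq0:
  assumes a: "a \<in> MB" and x: "x \<in> U a"
  shows "H a \<bullet> x = 0"
  using x by (rule inner_U_eq0) (use H_eq0_iff[OF a] snd_sub[OF a] in blast)

lemma H_U_eq0': "a \<in> MB \<Longrightarrow> b \<in> MB \<Longrightarrow> snd a \<subseteq> snd b \<Longrightarrow> x \<in> U a \<Longrightarrow> H b \<bullet> x = 0"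
  using H_U_eq0 U_mono by blast

lemma h_U_eq0:
  assumes a: "a \<in> MB" and "i \<in> fst a" and x: "x \<in> U a"
  shows "h i \<bullet> x = 0"
  using x
proof (rule inner_U_eq0)
  fix j assume "j \<in> snd a"
  then show "h i \<bullet> w j = 0"
    using assms eq0_iff fst_maxbiclique[OF a] snd_sub[OF a] by blast
qed

lemma gcone_sub_U: "gcone w (snd a) \<subseteq> U a"
  unfolding U_def by (rule gcone_subset_span)

lemma Z_gcone: "a \<in> MB \<Longrightarrow> Z a \<in> gcone w (snd a)"
  unfolding Z_def by (intro gcone_sum_in finite_snd)

lemma Z_in_U: "a \<in> MB \<Longrightarrow> Z a \<in> U a"
  using Z_gcone gcone_sub_U by blast

lemma H_Z_neg:
  assumes "a \<in> MB" "b \<in> MB" "\<not> snd a \<subseteq> snd b"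
  shows "H b \<bullet> Z a < 0"
proof -
  obtain j where j: "j \<in> snd a" "j \<notin> snd b"
    using assms by blast
  have "H b \<bullet> Z a = (\<Sum>j\<in>snd a. H b \<bullet> w j)"
    by (simp add: Z_def inner_sum_right)
  also have "\<dots> = H b \<bullet> w j + (\<Sum>j\<in>snd a - {j}. H b \<bullet> w j)"
    using finite_snd[OF assms(1)] j by (intro sum.remove) auto
  also have "\<dots> < 0"
    using H_neg[OF assms(2), of j] j snd_sub[OF assms(1)] H_le0[OF assms(2)]
    by (intro add_neg_nonpos sum_nonpos) auto
  finally show ?thesis .
qed

text \<open>\<open>H a\<close> vanishes on \<open>U a\<close> but is negative at a generator that
  belongs to \<open>b\<close> and not to \<open>a\<close>, so the span grows.\<close>

lemma r_mono:
  assumes a: "a \<in> MB" and b: "b \<in> MB" and less: "snd a \<subset> snd b"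
  shows "r a < r b"
proof -
  obtain j where j: "j \<in> snd b" "j \<notin> snd a"
    using less by blast
  have "w j \<notin> U a"
    using H_U_eq0[OF a, of "w j"] H_neg[OF a, of j] j snd_sub[OF b] by auto
  then have "U a \<subset> U b"
    using U_mono less w_in_U[OF j(1)] by blast
  then show ?thesis
    unfolding r_def by (metis dim_psubset span_eq_iff subspace_U)
qed

text \<open>By the dimension count, \<open>U b\<close> fills the whole hyperplane
  \<open>H b = 0\<close> of \<open>U a\<close>.\<close>

lemma lcover_U:
  assumes lc: "lcover a b" and x: "x \<in> U a" "H b \<bullet> x = 0"
  shows "x \<in> U b"
proof -
  have a: "a \<in> MB" and b: "b \<in> MB" and less: "snd b \<subset> snd a" and rk: "r b + 1 = r a"
    using lc by (auto simp: lcover_def)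
  let ?T = "{x \<in> U a. H b \<bullet> x = 0}"
  have T: "subspace ?T"
    using subspace_U[of a] by (auto simp: subspace_def inner_add_right)
  obtain j where j: "j \<in> snd a" "j \<notin> snd b"
    using less by blast
  have "w j \<notin> ?T" "w j \<in> U a"
    using H_neg[OF b, of j] j snd_sub[OF a] w_in_U by auto
  then have "?T \<subset> U a"
    by blast
  then have "dim ?T < r a"
    unfolding r_def using T subspace_U by (metis dim_psubset span_eq_iff)
  moreover have "U b \<subseteq> ?T"
    using U_mono[of b a] less H_U_eq0[OF b] by auto
  ultimately have "U b = ?T"
    using rk T subspace_U by (intro subspace_dim_equal) (auto simp: r_def)
  then show ?thesis
    using x by auto
qed

lemma lcover_decompose:
  assumes lc: "lcover b c" and j: "j \<in> snd b" "j \<notin> snd c" and x: "x \<in> U b"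
  obtains t where "x - t *\<^sub>R w j \<in> U c"
proof
  let ?t = "(H c \<bullet> x) / (H c \<bullet> w j)"
  have "H c \<bullet> w j < 0"
    using lc j snd_sub[of b] by (intro H_neg) (auto simp: lcover_def)
  then show "x - ?t *\<^sub>R w j \<in> U c"
    using x w_in_U[OF j(1)] subspace_U
    by (intro lcover_U[OF lc] subspace_diff subspace_scale) (auto simp: inner_diff_right)
qed

text \<open>On \<open>U b\<close>, the functional \<open>H b'\<close> is a positive multiple of \<open>H c\<close>.\<close>

lemma lcover_transfer:
  assumes ab: "lcover a b" and ab': "lcover a b'" and ne: "b \<noteq> b'"
    and bc: "lcover b c" and cb': "snd c \<subseteq> snd b'"
    and x: "x \<in> U b" "H b' \<bullet> x \<le> 0"
  shows "H c \<bullet> x \<le> 0"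
proof -
  have mb: "b \<in> MB" "b' \<in> MB" "c \<in> MB" and less: "snd c \<subset> snd b"
    using ab ab' bc by (auto simp: lcover_def)
  \<comment> \<open>The meet lies strictly below \<open>b\<close> and contains \<open>c\<close>,
    which is only one rank below \<open>b\<close>; so it equals \<open>c\<close>.\<close>
  have int: "snd b \<inter> snd b' = snd c"
  proof -
    obtain m where m: "m \<in> MB" "snd m = snd b \<inter> snd b'"
      using meet_maxbiclique[OF mb(1,2)] .
    have "\<not> snd b \<subseteq> snd b'"
    proof
      assume "snd b \<subseteq> snd b'"
      then have "snd b \<subset> snd b'"
        using ne maxbiclique_eqI[OF mb(1,2)] by blast
      then have "r b < r b'"
        by (rule r_mono[OF mb(1,2)])
      then show False
        using ab ab' by (simp add: lcover_def)
    qed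
    then have "r m < r b"
      using m by (intro r_mono mb) auto
    then have "\<not> snd c \<subset> snd m"
      using r_mono[OF mb(3) m(1)] bc by (auto simp: lcover_def)
    then show ?thesis
      using m(2) less cb' by blast
  qed
  obtain j where j: "j \<in> snd b" "j \<notin> snd c"
    using less by blast
  then have jb': "j \<notin> snd b'" "j \<in> J"
    using int snd_sub[OF mb(1)] by auto
  obtain t where t: "x - t *\<^sub>R w j \<in> U c"
    using lcover_decompose[OF bc j x(1)] .
  have "H b' \<bullet> x = t * (H b' \<bullet> w j)" "H c \<bullet> x = t * (H c \<bullet> w j)"
    using H_U_eq0'[OF mb(3,2) cb' t] H_U_eq0[OF mb(3) t] by (auto simp: inner_diff_right)
  moreover have "H b' \<bullet> w j < 0" "H c \<bullet> w j < 0"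
    using H_neg mb j jb' by auto
  ultimately show ?thesis
    using x(2) by (simp add: mult_le_0_iff)
qed

text \<open>One moves from \<open>x\<close> along the line of direction \<open>Z a\<close> to the hyperplane \<open>H b = 0\<close> with the
  smallest parameter \<open>t\<close>.\<close>

lemma ray_shooting:
  assumes a: "a \<in> MB" and S: "S \<noteq> {}" "\<And>b. b \<in> S \<Longrightarrow> lcover a b"
    and x: "x \<in> U a"
  obtains b t where "b \<in> S" "x - t *\<^sub>R Z a \<in> U b" "t * (H b \<bullet> Z a) = H b \<bullet> x"
    "\<And>b'. b' \<in> S \<Longrightarrow> H b' \<bullet> (x - t *\<^sub>R Z a) \<le> 0"
proof -
  define q where "q = (\<lambda>b. (H b \<bullet> x) / (H b \<bullet> Z a))"
  have "finite S"
    using S(2) finite_MB by (metis finite_subset lcover_def subsetI)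
  then have "Min (q ` S) \<in> q ` S"
    using S(1) by (intro Min_in) auto
  then obtain b where b: "Min (q ` S) = q b" "b \<in> S"
    by (rule imageE)
  have q_min: "q b \<le> q b'" if "b' \<in> S" for b'
    using \<open>finite S\<close> that unfolding b(1)[symmetric] by simp
  have neg: "H b' \<bullet> Z a < 0" if "b' \<in> S" for b'
    using S(2)[OF that] by (intro H_Z_neg a) (auto simp: lcover_def)
  \<comment> \<open>\<open>H b'\<close> is negative at \<open>Z a\<close>, so its value at
    \<open>x - t *\<^sub>R Z a\<close> increases with \<open>t\<close> and reaches 0 at
    \<open>t = q b'\<close>. At the smallest of these parameters no value is positive yet.\<close>
  have le: "H b' \<bullet> (x - q b *\<^sub>R Z a) \<le> 0" if "b' \<in> S" for b'
  proof -
    have "H b' \<bullet> x = q b' * (H b' \<bullet> Z a)"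
      using neg[OF that] by (simp add: q_def)
    also have "\<dots> \<le> q b * (H b' \<bullet> Z a)"
      using q_min[OF that] neg[OF that] by (intro mult_right_mono_neg) auto
    finally show ?thesis
      by (simp add: inner_diff_right)
  qed
  have eq: "q b * (H b \<bullet> Z a) = H b \<bullet> x"
    using neg[OF b(2)] by (simp add: q_def)
  have "x - q b *\<^sub>R Z a \<in> U b"
    using x Z_in_U[OF a] subspace_U eq
    by (intro lcover_U[OF S(2)[OF b(2)]] subspace_diff subspace_scale) (auto simp: inner_diff_right)
  then show thesis
    using that b(2) eq le by blast
qed

text \<open>If the hyperplane that is met first belongs to \<open>b\<close>, the diamond property transfers the
  inequalities of the other lower covers of \<open>a\<close> to those of the lower covers of \<open>b\<close>, which allows
  an induction.\<close>

lemma facets_bound_cone: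
  assumes ex: "\<And>a. a \<in> MB \<Longrightarrow> 0 < r a \<Longrightarrow> \<exists>b. lcover a b"
    and dia: "\<And>a b c. lcover a b \<Longrightarrow> lcover b c \<Longrightarrow> \<exists>b'. b' \<noteq> b \<and> lcover a b' \<and> snd c \<subseteq> snd b'"
    and "a \<in> MB" "x \<in> U a" "\<And>b. lcover a b \<Longrightarrow> H b \<bullet> x \<le> 0"
  shows "x \<in> gcone w (snd a)"
  using assms(3-)
proof (induction "r a" arbitrary: a x rule: less_induct)
  case less
  note a = \<open>a \<in> MB\<close>
  show ?case
  proof (cases "r a = 0")
    case True
    then have "x = 0"
      using less.prems(2) unfolding r_def by (metis dim_eq_0 singletonD subsetD)
    then show ?thesis
      by simp
  next
    case False
    then have ne: "{b. lcover a b} \<noteq> {}"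
      using ex[OF a] by auto
    obtain b t where b: "lcover a b" and y: "x - t *\<^sub>R Z a \<in> U b"
      and t: "t * (H b \<bullet> Z a) = H b \<bullet> x"
      and le: "\<And>b'. lcover a b' \<Longrightarrow> H b' \<bullet> (x - t *\<^sub>R Z a) \<le> 0"
      using ray_shooting[OF a ne _ less.prems(2)] unfolding mem_Collect_eq by metis
    have mb: "b \<in> MB" and sub: "snd b \<subset> snd a" and "r b < r a"
      using b by (auto simp: lcover_def)
    have "x - t *\<^sub>R Z a \<in> gcone w (snd b)"
    proof (rule less.hyps[OF \<open>r b < r a\<close> mb y])
      fix c assume c: "lcover b c"
      obtain b' where "b' \<noteq> b" "lcover a b'" "snd c \<subseteq> snd b'"
        using dia[OF b c] by blast
      then show "H c \<bullet> (x - t *\<^sub>R Z a) \<le> 0"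
        using lcover_transfer[OF b _ _ c _ y] le by blast
    qed
    then have "x - t *\<^sub>R Z a \<in> gcone w (snd a)"
      using gcone_mono[OF finite_snd[OF a], of "snd b"] sub by blast
    \<comment> \<open>\<open>x\<close> satisfies the inequality of \<open>b\<close>, and
      \<open>Z a\<close> satisfies it strictly, so the parameter is nonnegative; then
      \<open>x\<close> is recovered by adding a nonnegative multiple of a point of the cone.\<close>
    moreover have "t \<ge> 0"
    proof (rule ccontr)
      assume "\<not> t \<ge> 0"
      moreover have "H b \<bullet> Z a < 0"
        using sub by (intro H_Z_neg a mb) auto
      ultimately have "H b \<bullet> x > 0"
        using t by (metis mult_neg_neg not_le)
      then show False
        using less.prems(3)[OF b] by simp
    qed
    ultimately have "(x - t *\<^sub>R Z a) + t *\<^sub>R Z a \<in> gcone w (snd a)"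
      by (intro gcone_add gcone_scale Z_gcone a)
    then show ?thesis
      by simp
  qed
qed

end

section \<open>Lattices of polyhedral cones\<close>

text \<open>\<open>cone_eq\<close> is what has to be proved when starting from the lattice, and what
  is given when starting from a polytope. With \<open>le0\<close> it makes the generated cone the
  polyhedron in \<open>W\<close> cut out by the rows; \<open>pointed\<close> excludes lines in
  it.\<close>

locale cone_configuration = configuration I J R h w
  for I :: "'i set" and J :: "'j set" and R and h :: "'i \<Rightarrow> 'v::euclidean_space" and w :: "'j \<Rightarrow> 'v" +
  fixes W :: "'v set"
  assumes subspace_W: "subspace W"
    and w_in_W: "\<And>j. j \<in> J \<Longrightarrow> w j \<in> W"
    and cone_eq: "\<And>x. x \<in> W \<Longrightarrow> (\<And>i. i \<in> I \<Longrightarrow> h i \<bullet> x \<le> 0) \<Longrightarrow> x \<in> gcone w J"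
    and pointed: "\<And>x. x \<in> W \<Longrightarrow> (\<And>i. i \<in> I \<Longrightarrow> h i \<bullet> x = 0) \<Longrightarrow> x = 0"
begin

lemma U_sub_W: "a \<in> MB \<Longrightarrow> U a \<subseteq> W"
  unfolding U_def using snd_sub w_in_W by (intro span_minimal subspace_W) blast

text \<open>\<open>H a\<close> vanishes on \<open>U a\<close>, and inside the whole cone its zeros
  are generated by the columns of \<open>a\<close>.\<close>

lemma face_cone:
  assumes a: "a \<in> MB" and x: "x \<in> U a" "\<And>i. i \<in> I \<Longrightarrow> h i \<bullet> x \<le> 0"
  shows "x \<in> gcone w (snd a)"
proof -
  have "x \<in> gcone w J"
    using x U_sub_W[OF a] by (intro cone_eq) auto
  then have "x \<in> gcone w {j\<in>J. H a \<bullet> w j = 0}"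
    using H_le0[OF a] H_U_eq0[OF a x(1)] by (intro gcone_face finite_J)
  moreover have "{j\<in>J. H a \<bullet> w j = 0} = snd a"
    using H_eq0_iff[OF a] snd_sub[OF a] by auto
  ultimately show ?thesis
    by simp
qed

text \<open>Since \<open>S\<close> is irredundant, there is a point \<open>p\<close> where the inequality \<open>i\<close> is tight and the
  others are strict. All points of \<open>U a\<close> near \<open>p\<close> with \<open>h i = 0\<close> lie in the cone, so \<open>i\<close> defines
  a facet.\<close>

lemma irredundant_lcover:
  assumes a: "a \<in> MB"
    and S: "S \<subseteq> I" "\<forall>x\<in>U a. (\<forall>i\<in>S. h i \<bullet> x \<le> 0) \<longrightarrow> x \<in> gcone w (snd a)"
    and irr: "\<forall>i\<in>S. \<exists>x\<in>U a. h i \<bullet> x > 0 \<and> (\<forall>m\<in>S - {i}. h m \<bullet> x \<le> 0)"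
    and i: "i \<in> S"
  obtains b where "lcover a b" "\<And>x. x \<in> U a \<Longrightarrow> H b \<bullet> x \<le> 0 \<Longrightarrow> h i \<bullet> x \<le> 0"
proof -
  have iI: "i \<in> I"
    using i S(1) by blast
  have hZ: "h m \<bullet> Z a < 0" if m: "m \<in> S" for m
  proof -
    have mI: "m \<in> I"
      using m S(1) by blast
    obtain x where x: "x \<in> U a" "h m \<bullet> x > 0"
      using irr m by blast
    obtain j where j: "j \<in> snd a" "h m \<bullet> w j \<noteq> 0"
      using inner_U_eq0[OF x(1), of "h m"] x(2) by force
    have "h m \<bullet> Z a = (\<Sum>j\<in>snd a. h m \<bullet> w j)"
      by (simp add: Z_def inner_sum_right)
    also have "\<dots> = h m \<bullet> w j + (\<Sum>j\<in>snd a - {j}. h m \<bullet> w j)"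
      using finite_snd[OF a] j by (intro sum.remove) auto
    also have "\<dots> < 0"
    proof (intro add_neg_nonpos sum_nonpos)
      show "h m \<bullet> w j < 0"
        using le0[OF mI, of j] j snd_sub[OF a] by force
      show "h m \<bullet> w k \<le> 0" if "k \<in> snd a - {j}" for k
        using that le0[OF mI, of k] snd_sub[OF a] by blast
    qed
    finally show ?thesis .
  qed
  obtain x where x: "x \<in> U a" "h i \<bullet> x > 0" "\<And>m. m \<in> S - {i} \<Longrightarrow> h m \<bullet> x \<le> 0"
    using irr i by blast
  \<comment> \<open>Up to scaling, the point where the segment from \<open>x\<close> to
    \<open>Z a\<close> crosses \<open>h i = 0\<close>. Both coefficients are positive, and the
    strict inequalities at \<open>Z a\<close> make the other rows of \<open>S\<close> strict at
    \<open>p\<close>.\<close>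
  define p where "p = (- (h i \<bullet> Z a)) *\<^sub>R x + (h i \<bullet> x) *\<^sub>R Z a"
  have pU: "p \<in> U a"
    unfolding p_def using x(1) Z_in_U[OF a] subspace_U by (intro subspace_add subspace_scale)
  have hp: "h i \<bullet> p = 0"
    by (simp add: p_def inner_add_right inner_diff_right mult.commute)
  have hp': "h m \<bullet> p < 0" if m: "m \<in> S - {i}" for m
  proof -
    have "- (h i \<bullet> Z a) * (h m \<bullet> x) \<le> 0"
      using hZ[OF i] x(3)[OF m] by (intro mult_nonneg_nonpos) auto
    moreover have "(h i \<bullet> x) * (h m \<bullet> Z a) < 0"
      using hZ[of m] m x(2) by (intro mult_pos_neg) auto
    ultimately show ?thesis
      by (simp add: p_def inner_add_right inner_diff_right)
  qed
  \<comment> \<open>The candidate for the facet closes the rows of \<open>a\<close> together with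
    \<open>i\<close>; its columns are those of \<open>a\<close> on the hyperplane
    \<open>h i = 0\<close>.\<close>
  obtain b0 where b0: "b0 \<in> MB" "snd b0 = {j\<in>J. \<forall>i'\<in>insert i (fst a). (i', j) \<in> R}" "insert i (fst a) \<subseteq> fst b0"
    using closure_maxbiclique[of "insert i (fst a)" I J R] fst_sub[OF a] iI by auto
  have sb: "snd b0 = {j\<in>snd a. h i \<bullet> w j = 0}"
    unfolding b0(2) using snd_maxbiclique[OF a] eq0_iff[OF iI] snd_sub[OF a] by blast
  have in_Ub: "u \<in> U b0" if u: "u \<in> gcone w (snd a)" "h i \<bullet> u = 0" for u
  proof -
    have "u \<in> gcone w {j\<in>snd a. h i \<bullet> w j = 0}"
      using u le0[OF iI] snd_sub[OF a] by (intro gcone_face finite_snd a) auto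
    then show ?thesis
      using gcone_sub_U[of b0] sb by auto
  qed
  let ?T = "{u\<in>U a. h i \<bullet> u = 0}"
  have TU: "u \<in> U b0" if u: "u \<in> ?T" for u
  proof -
    obtain \<epsilon> where \<epsilon>: "\<epsilon> > 0" "\<And>m. m \<in> S - {i} \<Longrightarrow> h m \<bullet> p + \<epsilon> * (h m \<bullet> u) \<le> 0"
      using strict_perturbation[of "S - {i}" "\<lambda>m. h m \<bullet> p" "\<lambda>m. h m \<bullet> u"]
        finite_subset[OF S(1) finite_I] hp' by auto
    have "p + \<epsilon> *\<^sub>R u \<in> gcone w (snd a)"
    proof (rule S(2)[rule_format])
      show "p + \<epsilon> *\<^sub>R u \<in> U a"
        using pU u subspace_U by (intro subspace_add subspace_scale) auto
      show "h m \<bullet> (p + \<epsilon> *\<^sub>R u) \<le> 0" if "m \<in> S" for m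
        using \<epsilon>(2)[of m] that hp u by (cases "m = i") (auto simp: inner_add_right)
    qed
    then have 1: "p + \<epsilon> *\<^sub>R u \<in> U b0"
      using hp u by (intro in_Ub) (auto simp: inner_add_right)
    have "h m \<bullet> p \<le> 0" if "m \<in> S" for m
      using hp hp'[of m] that by (cases "m = i") auto
    then have "p \<in> gcone w (snd a)"
      using S(2) pU by blast
    then have 2: "p \<in> U b0"
      using hp by (intro in_Ub)
    have "(1 / \<epsilon>) *\<^sub>R ((p + \<epsilon> *\<^sub>R u) - p) \<in> U b0"
      using 1 2 subspace_U by (intro subspace_scale subspace_diff)
    then show ?thesis
      using \<epsilon>(1) by simp
  qed
  have sub: "snd b0 \<subset> snd a"
  proof -
    have "snd b0 \<noteq> snd a"
    proof
      assume "snd b0 = snd a"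
      then have "h i \<bullet> w j = 0" if "j \<in> snd a" for j
        using sb that by blast
      then have "h i \<bullet> x = 0"
        by (rule inner_U_eq0[OF x(1)])
      then show False
        using x(2) by simp
    qed
    then show ?thesis
      using sb by blast
  qed
  have "r a \<le> r b0 + 1"
  proof -
    \<comment> \<open>The hyperplane \<open>h i = 0\<close> of \<open>U a\<close> lies in
      \<open>U b0\<close> and \<open>x\<close> is off it, so one further vector suffices.\<close>
    have "U a \<subseteq> span (insert x (U b0))"
    proof
      fix u assume u: "u \<in> U a"
      let ?t = "(h i \<bullet> u) / (h i \<bullet> x)"
      have "u - ?t *\<^sub>R x \<in> ?T"
        using u x(1,2) by (auto intro!: subspace_U subspace_diff subspace_scale simp: inner_diff_right)
      then have "u - ?t *\<^sub>R x \<in> U b0"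
        using TU by blast
      then have "(u - ?t *\<^sub>R x) + ?t *\<^sub>R x \<in> span (insert x (U b0))"
        by (intro span_add span_scale) (auto intro: span_base)
      then show "u \<in> span (insert x (U b0))"
        by simp
    qed
    then have "r a \<le> dim (insert x (U b0))"
      unfolding r_def by (metis dim_span dim_subset)
    also have "\<dots> \<le> r b0 + 1"
      by (simp add: dim_insert r_def)
    finally show ?thesis .
  qed
  then have lc: "lcover a b0"
    using r_mono[OF b0(1) a sub] a b0(1) sub by (simp add: lcover_def)
  obtain j where j: "j \<in> snd a" "j \<notin> snd b0"
    using sub by blast
  have hj: "h i \<bullet> w j < 0" "H b0 \<bullet> w j < 0"
  proof -
    have "j \<in> J" "h i \<bullet> w j \<noteq> 0"
      using j sb snd_sub[OF a] by auto
    then show "h i \<bullet> w j < 0" "H b0 \<bullet> w j < 0"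
      using le0[OF iI, of j] H_neg[OF b0(1), of j] j by auto
  qed
  show thesis
  proof (rule that[OF lc])
    fix u assume u: "u \<in> U a" "H b0 \<bullet> u \<le> 0"
    \<comment> \<open>\<open>H b0\<close> and \<open>h i\<close> both vanish on \<open>U b0\<close>
      and are negative at \<open>w j\<close>, so on \<open>U a\<close> their signs are governed by
      the same coefficient \<open>t\<close>.\<close>
    obtain t where t: "u - t *\<^sub>R w j \<in> U b0"
      using lcover_decompose[OF lc j u(1)] .
    then have "H b0 \<bullet> u = t * (H b0 \<bullet> w j)" "h i \<bullet> u = t * (h i \<bullet> w j)"
      using H_U_eq0[OF b0(1) t] h_U_eq0[OF b0(1) _ t, of i] b0(3) by (auto simp: inner_diff_right)
    then show "h i \<bullet> u \<le> 0"
      using u(2) hj by (simp add: mult_le_0_iff)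
  qed
qed

lemma lcovers_cut_out_cone:
  assumes a: "a \<in> MB" and x: "x \<in> U a" "\<And>b. lcover a b \<Longrightarrow> H b \<bullet> x \<le> 0"
  shows "x \<in> gcone w (snd a)"
proof -
  define Q where "Q = (\<lambda>S. \<forall>x\<in>U a. (\<forall>i\<in>S. h i \<bullet> x \<le> 0) \<longrightarrow> x \<in> gcone w (snd a))"
  have "I \<in> {S\<in>Pow I. Q S}"
    unfolding Q_def using face_cone[OF a] by auto
  then have "\<exists>S\<in>{S\<in>Pow I. Q S}. S \<subseteq> I \<and> (\<forall>T\<in>{S\<in>Pow I. Q S}. T \<subseteq> S \<longrightarrow> S = T)"
    using finite_I by (intro finite_has_minimal2) auto
  then obtain S where S': "S \<in> {S\<in>Pow I. Q S}" "\<forall>T\<in>{S\<in>Pow I. Q S}. T \<subseteq> S \<longrightarrow> S = T"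
    by metis
  then have S: "S \<subseteq> I" "Q S"
    by simp_all
  have min: "S = T" if "T \<subseteq> I" "Q T" "T \<subseteq> S" for T
    using S'(2) that by simp
  have irr: "\<forall>i\<in>S. \<exists>x\<in>U a. h i \<bullet> x > 0 \<and> (\<forall>m\<in>S - {i}. h m \<bullet> x \<le> 0)"
  proof
    fix i assume i: "i \<in> S"
    have "\<not> Q (S - {i})"
      using min[of "S - {i}"] i S(1) by blast
    then obtain y where y: "y \<in> U a" "\<And>m. m \<in> S - {i} \<Longrightarrow> h m \<bullet> y \<le> 0" "y \<notin> gcone w (snd a)"
      unfolding Q_def by blast
    then have "\<not> h i \<bullet> y \<le> 0"
      using S(2) unfolding Q_def by blast
    then show "\<exists>x\<in>U a. h i \<bullet> x > 0 \<and> (\<forall>m\<in>S - {i}. h m \<bullet> x \<le> 0)"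
      using y by (intro bexI[of _ y]) auto
  qed
  have "h i \<bullet> x \<le> 0" if iS: "i \<in> S" for i
  proof -
    obtain b where "lcover a b" "\<And>x. x \<in> U a \<Longrightarrow> H b \<bullet> x \<le> 0 \<Longrightarrow> h i \<bullet> x \<le> 0"
      using irredundant_lcover[OF a S(1) S(2)[unfolded Q_def] irr iS] by metis
    then show ?thesis
      using x by blast
  qed
  then show ?thesis
    using S(2) x(1) unfolding Q_def by blast
qed

text \<open>If every lower cover above \<open>a\<close> contained \<open>j\<close>, then
  \<open>Z a - \<epsilon> *\<^sub>R w j\<close> would, for small \<open>\<epsilon>\<close>, satisfy
  the inequalities of all lower covers and lie in the cone, although \<open>H a\<close> is positive
  there. Both the existence of covers and the second middle element of rank-two intervals come from
  this.\<close>

lemma separating_lcover: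
  assumes a: "a \<in> MB" and b: "b \<in> MB" and sub: "snd a \<subseteq> snd b" and j: "j \<in> snd b" "j \<notin> snd a"
  obtains c where "lcover b c" "snd a \<subseteq> snd c" "j \<notin> snd c"
proof (rule ccontr)
  assume contra: "\<not> thesis"
  let ?S = "{c. lcover b c \<and> \<not> snd a \<subseteq> snd c}"
  have mbc: "c \<in> MB" if "lcover b c" for c
    using that by (simp add: lcover_def)
  have "finite ?S"
    using finite_MB mbc by (metis (no_types, lifting) finite_subset mem_Collect_eq subsetI)
  then obtain \<epsilon> where \<epsilon>: "\<epsilon> > 0" "\<And>c. c \<in> ?S \<Longrightarrow> H c \<bullet> Z a + \<epsilon> * (- (H c \<bullet> w j)) \<le> 0"
    using strict_perturbation[of ?S "\<lambda>c. H c \<bullet> Z a" "\<lambda>c. - (H c \<bullet> w j)"] H_Z_neg[OF a mbc] by auto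
  let ?x = "Z a - \<epsilon> *\<^sub>R w j"
  have "?x \<in> gcone w (snd b)"
  proof (rule lcovers_cut_out_cone[OF b])
    show "?x \<in> U b"
      using Z_in_U[OF a] U_mono[OF sub] w_in_U[OF j(1)] subspace_U
      by (intro subspace_diff subspace_scale) auto
    fix c assume c: "lcover b c"
    show "H c \<bullet> ?x \<le> 0"
    proof (cases "snd a \<subseteq> snd c")
      case True
      then have "j \<in> snd c"
        using contra that c by blast
      then have "H c \<bullet> w j = 0" "H c \<bullet> Z a = 0"
        using H_U_eq0[OF mbc[OF c] w_in_U] H_U_eq0'[OF a mbc[OF c] True Z_in_U[OF a]] by auto
      then show ?thesis
        by (simp add: inner_diff_right)
    next
      case False
      then show ?thesis
        using \<epsilon>(2)[of c] c by (simp add: inner_diff_right)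
    qed
  qed
  then have "H a \<bullet> ?x \<le> 0"
    using gcone_mono[OF finite_J snd_sub[OF b]] by (intro H_gcone_le0 a) auto
  moreover have "H a \<bullet> Z a = 0" "H a \<bullet> w j < 0"
    using H_U_eq0[OF a Z_in_U[OF a]] H_neg[OF a, of j] j snd_sub[OF b] by auto
  ultimately show False
    using mult_pos_neg[OF \<epsilon>(1), of "H a \<bullet> w j"] by (simp add: inner_diff_right)
qed

section \<open>Gradedness and the diamond property\<close>

lemma r_bot: "r (bot_mb I J R) = 0"
proof -
  have "w j = 0" if "j \<in> snd (bot_mb I J R)" for j
  proof (rule pointed)
    show "w j \<in> W"
      using that snd_sub[OF bot_mb(1)] w_in_W by blast
    show "h i \<bullet> w j = 0" if "i \<in> I" for i
      using that \<open>j \<in> _\<close> h_U_eq0[OF bot_mb(1) _ w_in_U] by (metis bot_mb(2))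
  qed
  then have "w ` snd (bot_mb I J R) \<subseteq> {0}"
    by auto
  then show ?thesis
    by (simp add: r_def U_def dim_eq_0)
qed

lemma
  assumes "r (top_mb I J R) = n"
  shows graded_L: "graded L" and poset_rank_L: "poset_rank L = n"
    and elem_rank_L: "a \<in> MB \<Longrightarrow> elem_rank L a = r a"
proof -
  have cov: "\<exists>c\<in>MB. snd a \<subseteq> snd c \<and> snd c \<subset> snd b \<and> r c + 1 = r b"
    if ab: "a \<in> MB" "b \<in> MB" "snd a \<subset> snd b" for a b
  proof -
    obtain j where j: "j \<in> snd b" "j \<notin> snd a"
      using ab(3) by blast
    obtain c where "lcover b c" "snd a \<subseteq> snd c"
      using separating_lcover[OF ab(1,2) _ j] ab(3) by blast
    then show ?thesis
      by (auto simp: lcover_def)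
  qed
  show "graded L"
    by (rule graded_by_rank_function(1)[where r = r, OF finite_I finite_J _ _ r_bot assms]) (erule (2) r_mono cov)+
  show "poset_rank L = n"
    by (rule graded_by_rank_function(2)[where r = r, OF finite_I finite_J _ _ r_bot assms]) (erule (2) r_mono cov)+
  show "elem_rank L a = r a" if "a \<in> MB"
    by (rule graded_by_rank_function(3)[where r = r, OF finite_I finite_J _ _ r_bot assms that]) (erule (2) r_mono cov)+
qed

lemma elem_rank_r: "a \<in> MB \<Longrightarrow> elem_rank L a = r a"
  using elem_rank_L[OF refl] .

lemma graded_lattice: "graded L"
  using graded_L[OF refl] .

lemma lcover_intervalI:
  assumes "a \<in> MB" "b \<in> MB" "c \<in> MB" "r b = r a + 2" "snd a \<subset> snd c" "snd c \<subset> snd b"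
  shows "lcover b c" "lcover c a"
  using r_mono[of a c] r_mono[of c b] assms by (auto simp: lcover_def)

lemma lcover_lowerI:
  assumes bc: "lcover b c" and a: "a \<in> MB" and rk: "r b = r a + 2" and sub: "snd a \<subseteq> snd c"
  shows "lcover c a"
proof -
  have c: "c \<in> MB" and rc: "r c = r a + 1"
    using bc rk by (auto simp: lcover_def)
  have "snd a \<noteq> snd c"
  proof
    assume "snd a = snd c"
    then have "a = c"
      by (rule maxbiclique_eqI[OF a c])
    then show False
      using rc by simp
  qed
  then show ?thesis
    using a c rc sub by (auto simp: lcover_def)
qed

text \<open>For a column \<open>j\<close> that distinguishes \<open>c1\<close> from
  \<open>a\<close>, a lower cover of \<open>b\<close> that keeps \<open>a\<close> and drops
  \<open>j\<close> cannot be \<open>c1\<close>.\<close>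

lemma two_lcovers:
  assumes bc: "lcover b c1" and ca: "lcover c1 a"
  obtains c2 where "lcover b c2" "lcover c2 a" "c2 \<noteq> c1"
proof -
  have mb: "a \<in> MB" "b \<in> MB" "c1 \<in> MB" and sub: "snd a \<subset> snd c1" "snd c1 \<subset> snd b"
    and rk: "r b = r a + 2"
    using bc ca by (auto simp: lcover_def)
  obtain j where j: "j \<in> snd c1" "j \<notin> snd a"
    using sub by blast
  obtain c2 where c2: "lcover b c2" "snd a \<subseteq> snd c2" "j \<notin> snd c2"
    using separating_lcover[OF mb(1,2) _ _ j(2)] sub j(1) by blast
  then have "lcover c2 a"
    by (intro lcover_lowerI[OF _ mb(1) rk])
  then show thesis
    using that c2 j by blast
qed

lemma lcovers_inter:
  assumes "lcover b c1" "lcover c1 a" "lcover b c2" "lcover c2 a" "c1 \<noteq> c2"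
  shows "snd c1 \<inter> snd c2 = snd a"
proof -
  have mb: "a \<in> MB" "c1 \<in> MB" "c2 \<in> MB" and rk: "r c1 = r a + 1" "r c1 = r c2"
    and sub: "snd a \<subset> snd c1" "snd a \<subset> snd c2"
    using assms by (auto simp: lcover_def)
  obtain m where m: "m \<in> MB" "snd m = snd c1 \<inter> snd c2"
    using meet_maxbiclique[OF mb(2,3)] .
  have "\<not> snd c1 \<subseteq> snd c2"
    using r_mono[OF mb(2,3)] rk(2) maxbiclique_eqI[OF mb(2,3)] assms(5) by auto
  then have "r m < r c1"
    using m by (intro r_mono mb) auto
  then have "\<not> snd a \<subset> snd m"
    using r_mono[OF mb(1) m(1)] rk by auto
  then show ?thesis
    using m(2) sub by blast
qed

text \<open>A plane cone has only two boundary rays. Modulo \<open>U a\<close> the three generators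
  lie in a plane, and each \<open>H c\<close> vanishes at its own generator and is negative at the
  others. With the third written as a combination of the first two, \<open>H c1\<close> and
  \<open>H c2\<close> force positive coefficients, which \<open>H c3\<close> forbids.\<close>

lemma no_three_lcovers:
  assumes bc: "lcover b c1" "lcover b c2" "lcover b c3"
    and ca: "lcover c1 a" "lcover c2 a" "lcover c3 a"
    and ne: "c1 \<noteq> c2" "c1 \<noteq> c3" "c2 \<noteq> c3"
  shows False
proof -
  have mb: "a \<in> MB" "b \<in> MB" "c1 \<in> MB" "c2 \<in> MB" "c3 \<in> MB"
    and sub: "snd a \<subset> snd c1" "snd a \<subset> snd c2" "snd a \<subset> snd c3"
      "snd c1 \<subset> snd b" "snd c2 \<subset> snd b" "snd c3 \<subset> snd b"
    using bc ca by (auto simp: lcover_def)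
  note int = lcovers_inter[OF bc(1) ca(1) bc(2) ca(2) ne(1)]
    lcovers_inter[OF bc(1) ca(1) bc(3) ca(3) ne(2)]
    lcovers_inter[OF bc(2) ca(2) bc(3) ca(3) ne(3)]
  obtain j1 j2 j3 where j1: "j1 \<in> snd c1" "j1 \<notin> snd a" and j2: "j2 \<in> snd c2" "j2 \<notin> snd a"
    and j3: "j3 \<in> snd c3" "j3 \<notin> snd a"
    using sub by blast
  have jJ: "j1 \<in> J" "j2 \<in> J" "j3 \<in> J"
    using j1 j2 j3 snd_sub[OF mb(3)] snd_sub[OF mb(4)] snd_sub[OF mb(5)] by auto
  have nin: "j1 \<notin> snd c2" "j1 \<notin> snd c3" "j2 \<notin> snd c1" "j2 \<notin> snd c3" "j3 \<notin> snd c1" "j3 \<notin> snd c2"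
    using int j1 j2 j3 by blast+
  have "w j3 \<in> U b"
    using j3 sub by (intro w_in_U) auto
  moreover have "j2 \<in> snd b"
    using j2 sub by auto
  ultimately obtain q where q: "w j3 - q *\<^sub>R w j2 \<in> U c1"
    using lcover_decompose[OF bc(1) _ nin(3)] by blast
  obtain p where p: "w j3 - q *\<^sub>R w j2 - p *\<^sub>R w j1 \<in> U a"
    using lcover_decompose[OF ca(1) j1 q] .
  have *: "H c \<bullet> w j3 = q * (H c \<bullet> w j2) + p * (H c \<bullet> w j1)"
    if "c \<in> MB" "snd a \<subseteq> snd c" for c
    using H_U_eq0'[OF mb(1) that p] by (simp add: inner_diff_right)
  have neg: "H c1 \<bullet> w j2 < 0" "H c1 \<bullet> w j3 < 0" "H c2 \<bullet> w j1 < 0" "H c2 \<bullet> w j3 < 0"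
    "H c3 \<bullet> w j1 < 0" "H c3 \<bullet> w j2 < 0"
    using H_neg mb nin jJ by auto
  have zero: "H c1 \<bullet> w j1 = 0" "H c2 \<bullet> w j2 = 0" "H c3 \<bullet> w j3 = 0"
    using H_eq0_iff mb jJ j1 j2 j3 by auto
  have "q > 0" "p > 0"
    using *[OF mb(3)] *[OF mb(4)] sub neg zero
    by (auto simp: mult_less_0_iff)
  then have "q * (H c3 \<bullet> w j2) + p * (H c3 \<bullet> w j1) < 0"
    using neg by (intro add_neg_neg mult_pos_neg)
  then show False
    using *[OF mb(5)] sub zero by auto
qed

lemma diamond_L: "diamond L"
  unfolding diamond_def
proof (intro conjI graded_lattice ballI impI)
  fix a b assume ab: "a \<in> carrier L" "b \<in> carrier L"
    and le: "a \<sqsubseteq>\<^bsub>L\<^esub> b \<and> elem_rank L b = elem_rank L a + 2"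
  then have mb: "a \<in> MB" "b \<in> MB" and sub: "snd a \<subseteq> snd b" and rk: "r b = r a + 2"
    using elem_rank_r by auto
  then have "snd a \<noteq> snd b"
    using maxbiclique_eqI[OF mb] by auto
  then obtain j where j: "j \<in> snd b" "j \<notin> snd a"
    using sub by blast
  obtain c1 where c1: "lcover b c1" "snd a \<subseteq> snd c1"
    using separating_lcover[OF mb sub j] by blast
  then have c1a: "lcover c1 a"
    by (intro lcover_lowerI[OF _ mb(1) rk])
  obtain c2 where c2: "lcover b c2" "lcover c2 a" "c2 \<noteq> c1"
    using two_lcovers[OF c1(1) c1a] .
  have "{c \<in> carrier L. a \<sqsubseteq>\<^bsub>L\<^esub> c \<and> c \<sqsubseteq>\<^bsub>L\<^esub> b} = {a, c1, c2, b}"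
  proof (intro equalityI subsetI)
    fix c assume "c \<in> {c \<in> carrier L. a \<sqsubseteq>\<^bsub>L\<^esub> c \<and> c \<sqsubseteq>\<^bsub>L\<^esub> b}"
    then have c: "c \<in> MB" "snd a \<subseteq> snd c" "snd c \<subseteq> snd b"
      by auto
    show "c \<in> {a, c1, c2, b}"
    proof (rule ccontr)
      assume n: "c \<notin> {a, c1, c2, b}"
      then have "snd a \<subset> snd c" "snd c \<subset> snd b"
        using c maxbiclique_eqI[OF mb(1) c(1)] maxbiclique_eqI[OF mb(2) c(1)] by auto
      then have "lcover b c" "lcover c a"
        using lcover_intervalI[OF mb c(1) rk] by auto
      then show False
        using no_three_lcovers[OF c1(1) c2(1) _ c1a c2(2)] c2(3) n by blast
    qed
  next
    fix c assume "c \<in> {a, c1, c2, b}"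
    then show "c \<in> {c \<in> carrier L. a \<sqsubseteq>\<^bsub>L\<^esub> c \<and> c \<sqsubseteq>\<^bsub>L\<^esub> b}"
      using mb sub c1 c1a c2 by (auto simp: lcover_def)
  qed
  moreover have "card {a, c1, c2, b} = 4"
  proof -
    have "a \<noteq> b" "c1 \<noteq> a" "c1 \<noteq> b" "c2 \<noteq> a" "c2 \<noteq> b"
      using rk c1 c1a c2 by (auto simp: lcover_def)
    then show ?thesis
      using c2(3) by auto
  qed
  ultimately show "card {c \<in> carrier L. a \<sqsubseteq>\<^bsub>L\<^esub> c \<and> c \<sqsubseteq>\<^bsub>L\<^esub> b} = 4"
    by simp
qed

lemma lower_covers_iff:
  assumes a: "a \<in> MB"
  shows "b \<in> lower_covers L a \<longleftrightarrow> lcover a b"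
proof -
  have "snd b \<subseteq> snd a \<and> r b + 1 = r a \<longleftrightarrow> snd b \<subset> snd a \<and> r b + 1 = r a" if "b \<in> MB"
    using maxbiclique_eqI[OF that a] by auto
  then show ?thesis
    unfolding lower_covers_def lcover_def using a elem_rank_r[OF a] elem_rank_r[of b] by auto
qed

lemma cover_graph_lcovers:
  assumes "lcover a b" "lcover a b'" "b \<noteq> b'" "lcover b c" "snd c \<subseteq> snd b'"
  shows "(b, b') \<in> cover_graph L a"
proof -
  have mb: "a \<in> MB" "b \<in> MB" "b' \<in> MB" "c \<in> MB"
    using assms by (auto simp: lcover_def)
  have "snd c \<noteq> snd b'"
    using assms maxbiclique_eqI[OF mb(4,3)] by (auto simp: lcover_def)
  then have "lcover b' c"
    using assms by (auto simp: lcover_def)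
  then have "snd b \<inter> snd b' = snd c"
    using lcovers_inter[OF assms(1,4,2) _ assms(3)] by simp
  then have "b \<sqinter>\<^bsub>L\<^esub> b' = c"
    using snd_meet_maxbiclique_lattice[OF mb(2,3)] mb(4) by (intro maxbiclique_eqI) auto
  then show ?thesis
    using assms mb lower_covers_iff elem_rank_r by (auto simp: cover_graph_def lcover_def)
qed

text \<open>Ray shooting from a point in the relative interior of the facet \<open>c\<close> towards the facets
  that are reachable from \<open>b\<close>; compare the simplex method on the polar cone.\<close>

lemma condition_C_L: "condition_C L"
  unfolding condition_C_def
proof (intro conjI graded_lattice ballI)
  fix a b c assume "a \<in> carrier L" "b \<in> lower_covers L a" "c \<in> lower_covers L a"
  then have a: "a \<in> MB" and ab: "lcover a b" and ac: "lcover a c"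
    using lower_covers_iff by auto
  show "(b, c) \<in> (cover_graph L a)\<^sup>*"
  proof (rule ccontr)
    assume nr: "(b, c) \<notin> (cover_graph L a)\<^sup>*"
    define S where "S = {b'. lcover a b' \<and> (b, b') \<in> (cover_graph L a)\<^sup>*}"
    have mbc: "c \<in> MB" and sub: "snd c \<subset> snd a"
      using ac by (auto simp: lcover_def)
    have bS: "b \<in> S"
      using ab by (simp add: S_def)
    have xU: "Z c \<in> U a"
      using Z_in_U[OF mbc] U_mono[of c a] sub by auto
    obtain b1 t where b1: "b1 \<in> S" and q: "Z c - t *\<^sub>R Z a \<in> U b1"
      and t: "t * (H b1 \<bullet> Z a) = H b1 \<bullet> Z c"
      and le: "\<And>b'. b' \<in> S \<Longrightarrow> H b' \<bullet> (Z c - t *\<^sub>R Z a) \<le> 0"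
      using ray_shooting[OF a _ _ xU, of S] bS unfolding S_def by blast
    have ab1: "lcover a b1" and mb1: "b1 \<in> MB" "snd b1 \<subset> snd a"
      using b1 by (auto simp: S_def lcover_def)
    have "b1 \<noteq> c"
      using b1 nr by (auto simp: S_def)
    then have "\<not> snd c \<subseteq> snd b1"
      using r_mono[OF mbc mb1(1)] ab1 ac maxbiclique_eqI[OF mbc mb1(1)] by (auto simp: lcover_def)
    then have "H b1 \<bullet> Z c < 0" "H b1 \<bullet> Z a < 0"
      using mb1 by (auto intro!: H_Z_neg mbc a)
    then have "t > 0"
      using t by (metis mult_less_0_iff less_asym)
    have "Z c - t *\<^sub>R Z a \<in> gcone w (snd b1)"
    proof (rule lcovers_cut_out_cone[OF mb1(1) q])
      fix c' assume c': "lcover b1 c'"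
      obtain b2 where b2: "lcover a b2" "lcover b2 c'" "b2 \<noteq> b1"
        using two_lcovers[OF ab1 c'] .
      then have s: "snd c' \<subseteq> snd b2"
        by (auto simp: lcover_def)
      \<comment> \<open>The second middle element over \<open>c'\<close> is adjacent to
        \<open>b1\<close>, hence reachable, so its inequality is among those that the first hit
        respects.\<close>
      have "(b1, b2) \<in> cover_graph L a"
        using b2(3) by (intro cover_graph_lcovers[OF ab1 b2(1) _ c' s]) auto
      then have "b2 \<in> S"
        using b1 b2(1) by (auto simp: S_def)
      then show "H c' \<bullet> (Z c - t *\<^sub>R Z a) \<le> 0"
        using b2 by (intro lcover_transfer[OF ab1 b2(1) _ c' s q] le) auto
    qed
    \<comment> \<open>The contradiction: \<open>H c\<close> vanishes at \<open>Z c\<close> and is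
      negative at \<open>Z a\<close>, so for \<open>t > 0\<close> it is positive at the point just
      placed in the cone.\<close>
    then have "H c \<bullet> (Z c - t *\<^sub>R Z a) \<le> 0"
      using gcone_mono[OF finite_J snd_sub[OF mb1(1)]] by (intro H_gcone_le0 mbc) auto
    moreover have "H c \<bullet> Z c = 0"
      by (intro H_U_eq0 mbc Z_in_U)
    moreover have "H c \<bullet> Z a < 0"
      using sub by (intro H_Z_neg a mbc) auto
    ultimately show False
      using mult_pos_neg[OF \<open>t > 0\<close>, of "H c \<bullet> Z a"] by (simp add: inner_diff_right)
  qed
qed

end

section \<open>Facets, rays and polars\<close>

lemma convex_gcone: "convex (gcone w B)"
  by (intro convexI gcone_add gcone_scale)

lemma conic_gcone: "conic (gcone w B)"
  by (simp add: conic_def gcone_scale)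

lemma span_gcone:
  assumes "finite B"
  shows "span (gcone w B) = span (w ` B)"
proof
  show "span (gcone w B) \<subseteq> span (w ` B)"
    by (intro span_minimal gcone_subset_span subspace_span)
  show "span (w ` B) \<subseteq> span (gcone w B)"
    using gcone_base[OF assms] by (intro span_mono) auto
qed

lemma aff_dim_gcone: "finite B \<Longrightarrow> aff_dim (gcone w B) = int (dim (span (w ` B)))"
  using aff_dim_zero[of "gcone w B"] span_gcone[of B w] hull_inc[OF gcone_zero, of affine w B]
  by (metis dim_span)

lemma ray_eq_gcone: "ray (w j) = gcone w {j}"
  unfolding ray_def gcone_def by (auto intro: exI[of _ "\<lambda>_. t" for t])

lemma ray_base: "v \<in> ray v"
  unfolding ray_def using zero_le_one scaleR_one by (metis (mono_tags, lifting) mem_Collect_eq)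

lemma ray_eqD:
  assumes "ray v = ray u" "u \<noteq> 0"
  obtains t where "0 < t" "v = t *\<^sub>R u"
proof -
  have "u \<in> ray v"
    using ray_base assms(1) by metis
  then obtain t where t: "0 \<le> t" "u = t *\<^sub>R v"
    by (auto simp: ray_def)
  then have "0 < t" "v = (1 / t) *\<^sub>R u"
    using assms(2) by (cases "t = 0", auto)
  then show thesis
    using that[of "1 / t"] by simp
qed

lemma gcone_exposed:
  assumes fin: "finite B" and le: "\<And>k. k \<in> B \<Longrightarrow> y \<bullet> w k \<le> 0" and A: "A = {k\<in>B. y \<bullet> w k = 0}"
  shows "gcone w A = gcone w B \<inter> {x. y \<bullet> x = 0}" and "gcone w A face_of gcone w B"
proof -
  have "x \<in> gcone w B \<and> y \<bullet> x = 0" if "x \<in> gcone w A" for x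
  proof
    show "x \<in> gcone w B"
      using that gcone_mono[OF fin, of A w] A by auto
    show "y \<bullet> x = 0"
      using that A by (auto elim!: gconeE simp: inner_sum_right)
  qed
  moreover have "x \<in> gcone w A" if "x \<in> gcone w B" "y \<bullet> x = 0" for x
    unfolding A using fin le that by (rule gcone_face)
  ultimately show eq: "gcone w A = gcone w B \<inter> {x. y \<bullet> x = 0}"
    by blast
  have "y \<bullet> x \<le> 0" if "x \<in> gcone w B" for x
    using that le by (elim gconeE) (auto simp: inner_sum_right intro!: sum_nonpos mult_nonneg_nonpos)
  then show "gcone w A face_of gcone w B"
    unfolding eq by (intro face_of_Int_supporting_hyperplane_le convex_gcone)
qed

text \<open>Some term in a representation of a nonzero point \<open>x\<close> of the edge is
  nonzero. As \<open>x\<close> is the midpoint of twice this term and twice the rest, the face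
  property puts the term on the edge.\<close>

lemma edge_contains_generator:
  assumes fin: "finite B" and E: "E edge_of gcone w B"
  obtains j where "j \<in> B" "w j \<noteq> 0" "ray (w j) \<subseteq> E"
proof -
  have face: "E face_of gcone w B" and dim: "aff_dim E = 1"
    using E by (auto simp: edge_of_def)
  have conE: "conic E"
    using face_of_conic[OF conic_gcone face] .
  have "\<not> E \<subseteq> {0}"
    using dim aff_dim_subset[of E "{0}"] by auto
  then obtain x where x: "x \<in> E" "x \<noteq> 0"
    by auto
  then have "x \<in> gcone w B"
    using face face_of_imp_subset by blast
  then obtain c where c: "\<And>j. j \<in> B \<Longrightarrow> 0 \<le> c j" "x = (\<Sum>j\<in>B. c j *\<^sub>R w j)"
    by (metis gconeE)
  obtain j where j: "j \<in> B" "c j *\<^sub>R w j \<noteq> 0"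
    using x(2) c(2) by (metis (mono_tags, lifting) sum.neutral)
  then have cj: "c j > 0" "w j \<noteq> 0"
    using c(1)[OF j(1)] by auto
  define y where "y = (\<Sum>k\<in>B - {j}. c k *\<^sub>R w k)"
  have yC: "y \<in> gcone w B"
    using gcone_mono[OF fin, of "B - {j}" w] gconeI[of "B - {j}" c w] c(1) by (auto simp: y_def)
  have xy: "x = c j *\<^sub>R w j + y"
    unfolding c(2) y_def using fin j(1) by (rule sum.remove)
  have "(2 * c j) *\<^sub>R w j \<in> E"
  proof (cases "(2 * c j) *\<^sub>R w j = 2 *\<^sub>R y")
    case True
    then have "c j *\<^sub>R w j = y"
      by (metis scaleR_scaleR scaleR_cancel_left zero_neq_numeral)
    then have "x = (2 * c j) *\<^sub>R w j"
      using xy True by (simp add: scaleR_2)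
    then show ?thesis
      using x(1) by simp
  next
    case False
    have "x = (1 - 1 / 2) *\<^sub>R ((2 * c j) *\<^sub>R w j) + (1 / 2) *\<^sub>R (2 *\<^sub>R y)"
      by (simp add: xy)
    then have "x \<in> open_segment ((2 * c j) *\<^sub>R w j) (2 *\<^sub>R y)"
      using False unfolding in_segment by (intro conjI exI[of _ "1/2"]) auto
    moreover have "(2 * c j) *\<^sub>R w j \<in> gcone w B" "2 *\<^sub>R y \<in> gcone w B"
      using gcone_scale[OF gcone_base[OF fin j(1)], of "2 * c j" w] gcone_scale[OF yC] cj(1) by auto
    ultimately show ?thesis
      using face x(1) unfolding face_of_def by blast
  qed
  then have *: "s *\<^sub>R ((2 * c j) *\<^sub>R w j) \<in> E" if "0 \<le> s" for s
    using conE that unfolding conic_def by blast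
  have "t *\<^sub>R w j \<in> E" if "0 \<le> t" for t
    using *[of "t / (2 * c j)"] cj(1) that by simp
  then have "ray (w j) \<subseteq> E"
    by (auto simp: ray_def)
  then show thesis
    using that j(1) cj(2) by blast
qed

text \<open>An edge contains the ray of some generator, and nested faces of the same dimension
  coincide.\<close>

lemma edge_gcone_iff:
  assumes fin: "finite B" and face: "\<And>j. j \<in> B \<Longrightarrow> ray (w j) face_of gcone w B" and nz: "\<And>j. j \<in> B \<Longrightarrow> w j \<noteq> 0"
  shows "E edge_of gcone w B \<longleftrightarrow> (\<exists>j\<in>B. E = ray (w j))"
proof -
  have dim1: "aff_dim (ray (w j)) = 1" if "j \<in> B" for j
    unfolding ray_eq_gcone using nz[OF that] by (simp add: aff_dim_gcone dim_insert)
  show ?thesis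
  proof
    assume E: "E edge_of gcone w B"
    obtain j where j: "j \<in> B" "ray (w j) \<subseteq> E"
      using edge_contains_generator[OF fin E] by metis
    have fE: "E face_of gcone w B" "aff_dim E = 1"
      using E by (auto simp: edge_of_def)
    have "ray (w j) face_of E"
      using face_of_subset[OF face[OF j(1)] j(2)] face_of_imp_subset[OF fE(1)] by blast
    then have "E = ray (w j)"
      using face_of_aff_dim_lt[OF face_of_imp_convex[OF fE(1)], of "ray (w j)"] dim1[OF j(1)] fE(2)
        convex_gcone by force
    then show "\<exists>j\<in>B. E = ray (w j)"
      using j(1) by blast
  next
    assume "\<exists>j\<in>B. E = ray (w j)"
    then show "E edge_of gcone w B"
      using face dim1 by (auto simp: edge_of_def)
  qed
qed

lemma polyhedron_gcone:
  fixes w :: "'j \<Rightarrow> 'v::euclidean_space"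
  assumes "finite B"
  shows "polyhedron (gcone w B)"
proof (cases "B = {}")
  case True
  then have "gcone w B = {0}"
    by (auto simp: gcone_def)
  then show ?thesis
    using polytope_imp_polyhedron[OF polytope_sing, of 0] by simp
next
  case False
  have "gcone w B = convex_cone hull (w ` B)"
  proof
    have cc: "convex_cone (convex_cone hull (w ` B))"
      by (rule convex_cone_convex_cone_hull)
    have "(\<Sum>j\<in>A. c j *\<^sub>R w j) \<in> convex_cone hull (w ` B)"
      if "\<And>j. j \<in> B \<Longrightarrow> 0 \<le> c j" "finite A" "A \<subseteq> B" for A c
      using that(2,3)
    proof (induction A)
      case empty
      then show ?case
        using convex_cone_hull_contains_0[of "w ` B"] by simp
    next
      case (insert j A)
      then have "c j *\<^sub>R w j \<in> convex_cone hull (w ` B)"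
        using that(1) by (intro convex_cone_hull_mul hull_inc) auto
      then show ?case
        using insert by (auto intro: convex_cone_hull_add)
    qed
    then show "gcone w B \<subseteq> convex_cone hull (w ` B)"
      using assms by (auto elim!: gconeE)
    have "convex_cone (gcone w B)"
      using gcone_zero[of w B] unfolding convex_cone_def by (metis convex_gcone conic_gcone emptyE)
    then show "convex_cone hull (w ` B) \<subseteq> gcone w B"
      using gcone_base[OF assms] by (intro hull_minimal) auto
  qed
  then show ?thesis
    using polyhedron_convex_cone_hull[of "w ` B"] assms by simp
qed

text \<open>Farkas' lemma relative to a subspace: a hyperplane that separates \<open>y\<close> from
  the closed cone yields, after projecting its normal to \<open>W\<close>, a point that satisfies
  all inequalities \<open>h i\<close> and violates the one of \<open>y\<close>.\<close>

lemma farkas: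
  fixes h :: "'i \<Rightarrow> 'v::euclidean_space"
  assumes fin: "finite I" and sW: "subspace W" and hW: "\<And>i. i \<in> I \<Longrightarrow> h i \<in> W" and y: "y \<in> W"
    and imp: "\<And>x. x \<in> W \<Longrightarrow> (\<And>i. i \<in> I \<Longrightarrow> h i \<bullet> x \<le> 0) \<Longrightarrow> y \<bullet> x \<le> 0"
  shows "y \<in> gcone h I"
proof (rule ccontr)
  assume n: "y \<notin> gcone h I"
  obtain a b where ab: "a \<bullet> y < b" "\<And>x. x \<in> gcone h I \<Longrightarrow> a \<bullet> x > b"
    using separating_hyperplane_closed_point[OF convex_gcone _ n] polyhedron_gcone[OF fin] polyhedron_imp_closed
    by metis
  have b: "b < 0"
    using ab(2)[OF gcone_zero] by simp
  \<comment> \<open>A point of the cone with \<open>a \<bullet> x < 0\<close> could be scaled until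
    it reaches the value \<open>b\<close> itself, which the separation excludes.\<close>
  have ge: "a \<bullet> x \<ge> 0" if "x \<in> gcone h I" for x
  proof (rule ccontr)
    assume neg: "\<not> a \<bullet> x \<ge> 0"
    have "(b / (a \<bullet> x)) *\<^sub>R x \<in> gcone h I"
      using neg b that by (intro gcone_scale) (auto simp: divide_nonpos_neg)
    then show False
      using ab(2)[of "(b / (a \<bullet> x)) *\<^sub>R x"] neg by simp
  qed
  obtain p where p: "p \<in> W" "\<And>x. x \<in> W \<Longrightarrow> p \<bullet> x = a \<bullet> x"
    using subspace_projection[OF sW] by metis
  have "y \<bullet> (- p) \<le> 0"
  proof (rule imp)
    show "- p \<in> W"
      using p(1) sW by (rule subspace_neg[rotated])
    show "h i \<bullet> (- p) \<le> 0" if "i \<in> I" for i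
      using ge[OF gcone_base[OF fin that]] p(2)[OF hW[OF that]] by (simp add: inner_commute)
  qed
  then show False
    using p(2)[OF y] ab(1) b by (simp add: inner_commute)
qed

section \<open>From lattice conditions to a polyhedral cone\<close>

context configuration
begin

text \<open>The generators span at most \<open>n\<close> dimensions, so \<open>r\<close> is forced
  to be the rank function. This translates gradedness and the diamond property into the hypotheses
  on \<open>lcover\<close> of \<open>facets_bound_cone\<close>; its inequalities follow from the
  rows because each \<open>H b\<close> is a sum of rows.\<close>

lemma cone_configuration_of_lattice:
  assumes sW: "subspace W" and dimW: "dim W = n" and n: "0 < n"
    and wW: "\<And>j. j \<in> J \<Longrightarrow> w j \<in> W"
    and dia: "diamond L" and rk: "poset_rank L = n"
  shows "cone_configuration I J R h w W" and "span (w ` J) = W"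
proof -
  have gr: "graded L"
    using dia by (simp add: diamond_def)
  have spanW: "span (w ` J) \<subseteq> W"
    using wW sW by (intro span_minimal) auto
  have Utop: "U (top_mb I J R) = span (w ` J)"
    by (simp add: U_def top_mb(2))
  have "r (top_mb I J R) \<le> n"
    using dim_subset[OF spanW] dimW by (simp add: r_def Utop)
  note eru = elem_rank_unique[where r = r, OF finite_I finite_J gr rk n _ this]
  have rtop: "r (top_mb I J R) = n"
    by (rule eru) (rule r_mono)
  have rbot: "r (bot_mb I J R) = 0"
    by (rule eru) (rule r_mono)
  have er: "elem_rank L a = r a" if "a \<in> MB" for a
    using that by (rule eru(3)[rotated]) (rule r_mono)
  have ex: "\<exists>b. lcover a b" if "a \<in> MB" "0 < r a" for a
  proof -
    have "\<exists>b\<in>MB. snd b \<subset> snd a \<and> r b + 1 = r a"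
      using that by (rule eru(4)[rotated]) (rule r_mono)
    then show ?thesis
      using that(1) unfolding lcover_def by metis
  qed
  show eqW: "span (w ` J) = W"
    using spanW rtop dimW sW unfolding r_def Utop by (intro subspace_dim_equal) auto
  have diam: "\<exists>b'. b' \<noteq> b \<and> lcover a b' \<and> snd c \<subseteq> snd b'" if ab: "lcover a b" and bc: "lcover b c" for a b c
  proof -
    have mb: "a \<in> MB" "b \<in> MB" "c \<in> MB" and sub: "snd b \<subset> snd a" "snd c \<subset> snd b"
      and rks: "r b + 1 = r a" "r c + 1 = r b"
      using ab bc by (auto simp: lcover_def)
    let ?X = "{x \<in> carrier L. c \<sqsubseteq>\<^bsub>L\<^esub> x \<and> x \<sqsubseteq>\<^bsub>L\<^esub> a}"
    have "card ?X = 4"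
      using dia mb sub er rks unfolding diamond_def by auto
    \<comment> \<open>An interval of four elements must contain one besides \<open>a\<close>,
      \<open>b\<close> and \<open>c\<close>: the second middle element.\<close>
    moreover have "card {a, b, c} \<le> 3"
      by (simp add: card_insert_le_m1)
    moreover have "?X \<subseteq> {a, b, c} \<Longrightarrow> card ?X \<le> card {a, b, c}"
      by (intro card_mono) auto
    ultimately have "\<not> ?X \<subseteq> {a, b, c}"
      by linarith
    then obtain b' where b': "b' \<in> MB" "snd c \<subseteq> snd b'" "snd b' \<subseteq> snd a" "b' \<notin> {a, b, c}"
      by auto
    then have "snd c \<subset> snd b'" "snd b' \<subset> snd a"
      using maxbiclique_eqI[OF b'(1) mb(1)] maxbiclique_eqI[OF b'(1) mb(3)] by auto
    then have "lcover a b'"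
      using r_mono[OF mb(3) b'(1)] r_mono[OF b'(1) mb(1)] rks b'(1) mb(1) by (auto simp: lcover_def)
    then show ?thesis
      using b' by blast
  qed
  have cone: "x \<in> gcone w J" if x: "x \<in> W" "\<And>i. i \<in> I \<Longrightarrow> h i \<bullet> x \<le> 0" for x
  proof -
    have "x \<in> gcone w (snd (top_mb I J R))"
    proof (rule facets_bound_cone)
      show "top_mb I J R \<in> MB"
        by (rule top_mb)
      show "x \<in> U (top_mb I J R)"
        using x(1) Utop eqW by simp
      show "H b \<bullet> x \<le> 0" if "lcover (top_mb I J R) b" for b
      proof -
        have "fst b \<subseteq> I"
          using that by (intro fst_sub) (simp add: lcover_def)
        then show ?thesis
          unfolding H_def inner_sum_left using x(2) by (intro sum_nonpos) blast
      qed
    qed (fact ex diam)+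
    then show ?thesis
      by (simp add: top_mb(2))
  qed
  show "cone_configuration I J R h w W"
  proof
    show "x = 0" if x: "x \<in> W" "\<And>i. i \<in> I \<Longrightarrow> h i \<bullet> x = 0" for x
    proof -
      \<comment> \<open>A point at which all rows vanish lies in the face of the least element,
        whose span has dimension 0.\<close>
      have "x \<in> gcone w J"
        using x by (intro cone) auto
      moreover have "H (bot_mb I J R) \<bullet> x = 0"
        using x(2) by (simp add: H_def bot_mb(2) inner_sum_left)
      ultimately have "x \<in> gcone w {j\<in>J. H (bot_mb I J R) \<bullet> w j = 0}"
        using H_le0[OF bot_mb(1)] by (intro gcone_face finite_J)
      moreover have "{j\<in>J. H (bot_mb I J R) \<bullet> w j = 0} = snd (bot_mb I J R)"
        using H_eq0_iff[OF bot_mb(1)] snd_sub[OF bot_mb(1)] by auto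
      ultimately have "x \<in> U (bot_mb I J R)"
        using gcone_sub_U[of "bot_mb I J R"] by auto
      then show "x = 0"
        using rbot unfolding r_def by (metis dim_eq_0 singletonD subsetD)
    qed
  qed (fact sW wW cone)+
qed

end

section \<open>Facets, rays and polar of a cone of type \<open>R\<close>\<close>

locale cone_type_configuration = cone_configuration I J R h w W
  for I :: "'i set" and J :: "'j set" and R and h :: "'i \<Rightarrow> 'v::euclidean_space" and w :: "'j \<Rightarrow> 'v"
    and W +
  assumes h_in_W: "\<And>i. i \<in> I \<Longrightarrow> h i \<in> W"
    and span_w: "span (w ` J) = W"
    and dim_pos: "0 < dim W"
    and reduced: "reduced_relation I J R"
begin

abbreviation C where "C \<equiv> gcone w J"

lemma U_top: "U (top_mb I J R) = W"
  by (simp add: U_def top_mb(2) span_w)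

lemma r_top: "r (top_mb I J R) = dim W"
  by (simp add: r_def U_top)

lemma top_neq_bot: "top_mb I J R \<noteq> bot_mb I J R"
  using r_top r_bot dim_pos by (metis less_irrefl)

definition atom :: "'j \<Rightarrow> 'i set \<times> 'j set" where
  "atom j = (SOME a. a \<in> MB \<and> snd a = {j})"

definition coatom :: "'i \<Rightarrow> 'i set \<times> 'j set" where
  "coatom i = (SOME a. a \<in> MB \<and> fst a = {i})"

lemma atom: 
  assumes "j \<in> J" shows "atom j \<in> MB" "snd (atom j) = {j}"
proof -
  obtain I0 where "(I0, {j}) \<in> MB"
    using reduced assms by (auto simp: reduced_relation_def)
  then have "\<exists>a. a \<in> MB \<and> snd a = {j}"
    by (intro exI[of _ "(I0, {j})"]) simp
  then have "atom j \<in> MB \<and> snd (atom j) = {j}"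
    unfolding atom_def by (rule someI_ex)
  then show "atom j \<in> MB" "snd (atom j) = {j}"
    by auto
qed

lemma coatom:
  assumes "i \<in> I" shows "coatom i \<in> MB" "fst (coatom i) = {i}" "snd (coatom i) = {j\<in>J. (i, j) \<in> R}"
proof -
  obtain J0 where "({i}, J0) \<in> MB"
    using reduced assms by (auto simp: reduced_relation_def)
  then have "\<exists>a. a \<in> MB \<and> fst a = {i}"
    by (intro exI[of _ "({i}, J0)"]) simp
  then have "coatom i \<in> MB \<and> fst (coatom i) = {i}"
    unfolding coatom_def by (rule someI_ex)
  then show "coatom i \<in> MB" "fst (coatom i) = {i}"
    by auto
  then show "snd (coatom i) = {j\<in>J. (i, j) \<in> R}"
    using snd_maxbiclique[of "coatom i" I J R] by auto
qed

text \<open>A column incident with all rows lies in every maxbiclique. Then all atoms coincide,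
  \<open>J\<close> has a single element, and the least and greatest elements agree, against
  \<open>dim_pos\<close>.\<close>

lemma ex_nonincident_row:
  assumes j: "j \<in> J"
  obtains i where "i \<in> I" "(i, j) \<notin> R"
proof (rule ccontr)
  assume "\<not> thesis"
  then have jb: "j \<in> snd (bot_mb I J R)"
    using that j by (auto simp: bot_mb_def)
  have "k = j" if "k \<in> J" for k
    using bot_le_snd[OF atom(1)[OF that]] atom(2)[OF that] jb by auto
  then have "snd (bot_mb I J R) = snd (top_mb I J R)"
    using jb snd_sub[OF bot_mb(1)] unfolding top_mb(2) by blast
  then show False
    using top_neq_bot maxbiclique_eqI[OF bot_mb(1) top_mb(1)] by metis
qed

lemma ex_nonincident_column:
  assumes i: "i \<in> I"
  obtains j where "j \<in> J" "(i, j) \<notin> R"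
proof (rule ccontr)
  assume "\<not> thesis"
  then have all: "\<And>j. j \<in> J \<Longrightarrow> (i, j) \<in> R"
    using that by blast
  have "k = i" if "k \<in> I" for k
  proof -
    have "snd (coatom k) \<subseteq> J"
      using snd_sub coatom(1)[OF that] by blast
    then have "i \<in> fst (coatom k)"
      using i all by (subst fst_maxbiclique[OF coatom(1)[OF that]]) blast
    then show ?thesis
      using coatom(2)[OF that] by simp
  qed
  then have "I = {i}"
    using i by blast
  then have "top_mb I J R = bot_mb I J R"
    unfolding top_mb_def bot_mb_def using all by blast
  then show False
    using top_neq_bot by contradiction
qed

lemma w_nonzero: "j \<in> J \<Longrightarrow> w j \<noteq> 0"
  using ex_nonincident_row eq0_iff by (metis inner_zero_right)

lemma h_nonzero: "i \<in> I \<Longrightarrow> h i \<noteq> 0"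
  using ex_nonincident_column eq0_iff by (metis inner_zero_left)

text \<open>A lower cover of the top that lies above the coatom has a nonempty set of rows contained
  in \<open>{i}\<close>, so it is the coatom.\<close>

lemma lcover_coatom:
  assumes i: "i \<in> I"
  shows "lcover (top_mb I J R) (coatom i)"
proof -
  note a = coatom[OF i]
  obtain j where j: "j \<in> J" "j \<notin> snd (coatom i)"
    using ex_nonincident_column[OF i] a(3) by auto
  obtain c where c: "lcover (top_mb I J R) c" "snd (coatom i) \<subseteq> snd c"
    using separating_lcover[OF a(1) top_mb(1) _ _ j(2)] j(1) snd_sub[OF a(1)] unfolding top_mb(2) by metis
  then have mb: "c \<in> MB" "snd c \<subset> J"
    using top_mb(2)[of I J R] by (auto simp: lcover_def)
  have "fst c \<noteq> {}"
    using snd_maxbiclique[OF mb(1)] mb(2) by auto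
  moreover have "fst c \<subseteq> fst (coatom i)"
    using fst_maxbiclique[OF mb(1)] fst_maxbiclique[OF a(1)] c(2) by blast
  ultimately have "fst c = fst (coatom i)"
    using a(2) by auto
  then have "snd c = snd (coatom i)"
    using snd_maxbiclique[OF mb(1)] snd_maxbiclique[OF a(1)] by auto
  then have "c = coatom i"
    by (rule maxbiclique_eqI[OF mb(1) a(1)])
  then show ?thesis
    using c(1) by simp
qed

lemma cone_subset_W: "C \<subseteq> W"
  using gcone_subset_span[of w J] span_w by simp

lemma aff_dim_C: "aff_dim C = int (dim W)"
  by (simp add: aff_dim_gcone finite_J span_w)

lemma snd_coatom: "i \<in> I \<Longrightarrow> snd (coatom i) = {j\<in>J. h i \<bullet> w j = 0}"
  using coatom(3) eq0_iff by auto

lemma facet_eq: "i \<in> I \<Longrightarrow> {x\<in>C. h i \<bullet> x = 0} = gcone w (snd (coatom i))"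
  by (subst gcone_exposed(1)[OF finite_J le0 snd_coatom]) auto

lemma facet_face_of: "i \<in> I \<Longrightarrow> {x\<in>C. h i \<bullet> x = 0} face_of C"
  by (simp only: facet_eq) (rule gcone_exposed(2)[OF finite_J le0 snd_coatom])

lemma aff_dim_facet:
  assumes "i \<in> I"
  shows "aff_dim {x\<in>C. h i \<bullet> x = 0} = int (dim W) - 1"
proof -
  have "r (coatom i) + 1 = dim W"
    using lcover_coatom[OF assms] r_top by (simp add: lcover_def)
  then have "int (r (coatom i)) = int (dim W) - 1"
    by linarith
  then show ?thesis
    using facet_eq[OF assms] finite_snd[OF coatom(1)[OF assms]] by (simp add: aff_dim_gcone r_def U_def)
qed

lemma w_in_facet_iff: "i \<in> I \<Longrightarrow> j \<in> J \<Longrightarrow> w j \<in> {x\<in>C. h i \<bullet> x = 0} \<longleftrightarrow> (i, j) \<in> R"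
  using gcone_base[OF finite_J] eq0_iff by auto

text \<open>At a relative interior point of a facet some row vanishes; otherwise a neighbourhood in
  the affine hull would satisfy all inequalities and the point would be relatively interior to the
  cone. Equal dimensions then identify the facet with that of the row.\<close>

lemma facets_C: "facets C = (\<lambda>i. {x\<in>C. h i \<bullet> x = 0}) ` I"
proof (intro equalityI subsetI)
  fix G assume "G \<in> facets C"
  then have G: "G face_of C" "aff_dim G = int (dim W) - 1"
    by (auto simp: facets_def aff_dim_C)
  have "G \<noteq> {}"
  proof
    assume "G = {}"
    then have "int (dim W) = 0"
      using G(2) by simp
    then show False
      using dim_pos by linarith
  qed
  then obtain x where x: "x \<in> rel_interior G"
    using rel_interior_eq_empty[OF face_of_imp_convex[OF G(1)]] convex_gcone by blast
  then have xC: "x \<in> C" "x \<in> G"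
    using rel_interior_subset face_of_imp_subset[OF G(1)] by auto
  have "\<exists>i\<in>I. h i \<bullet> x = 0"
  proof (rule ccontr)
    assume "\<not> ?thesis"
    then have neg: "\<And>i. i \<in> I \<Longrightarrow> h i \<bullet> x < 0"
      using h_gcone_le0[OF _ xC(1)] by (metis less_eq_real_def)
    let ?T = "\<Inter>i\<in>I. {y. h i \<bullet> y < 0}"
    have "open ?T"
      using finite_I by (intro open_INT) (auto simp: open_halfspace_lt)
    moreover have "affine hull C \<subseteq> W"
      using cone_subset_W subspace_W by (intro hull_minimal) (auto simp: subspace_imp_affine)
    then have "?T \<inter> affine hull C \<subseteq> C"
      using cone_eq by fastforce
    ultimately have "x \<in> rel_interior C"
      unfolding mem_rel_interior using neg xC by blast
    moreover have "G \<noteq> C"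
      using G(2) aff_dim_C by auto
    ultimately show False
      using face_of_disjoint_rel_interior[OF G(1)] xC(2) by blast
  qed
  then obtain i where i: "i \<in> I" "h i \<bullet> x = 0"
    by blast
  have "G \<subseteq> {x\<in>C. h i \<bullet> x = 0}"
    using subset_of_face_of[OF facet_face_of[OF i(1)] face_of_imp_subset[OF G(1)]] i(2) x xC by blast
  then have "G face_of {x\<in>C. h i \<bullet> x = 0}"
    using face_of_subset[OF G(1)] by auto
  then have "G = {x\<in>C. h i \<bullet> x = 0}"
    using face_of_aff_dim_lt[OF face_of_imp_convex[OF facet_face_of[OF i(1)]], of G] convex_gcone
      aff_dim_facet[OF i(1)] G(2) by force
  then show "G \<in> (\<lambda>i. {x\<in>C. h i \<bullet> x = 0}) ` I"
    using i(1) by blast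
next
  fix G assume "G \<in> (\<lambda>i. {x\<in>C. h i \<bullet> x = 0}) ` I"
  then show "G \<in> facets C"
    using facet_face_of aff_dim_facet by (auto simp: facets_def aff_dim_C)
qed

lemma inj_facets: "inj_on (\<lambda>i. {x\<in>C. h i \<bullet> x = 0}) I"
proof (rule inj_onI)
  fix i k assume ik: "i \<in> I" "k \<in> I" "{x\<in>C. h i \<bullet> x = 0} = {x\<in>C. h k \<bullet> x = 0}"
  then have "snd (coatom i) = snd (coatom k)"
    using w_in_facet_iff[OF ik(1)] w_in_facet_iff[OF ik(2)] coatom(3) by auto
  then have "coatom i = coatom k"
    using coatom(1) ik by (intro maxbiclique_eqI) auto
  then show "i = k"
    using coatom(2) ik by (metis singleton_inject)
qed

lemma ray_w_face: "j \<in> J \<Longrightarrow> ray (w j) face_of C"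
  unfolding ray_eq_gcone using H_le0[OF atom(1)] H_eq0_iff[OF atom(1)] atom(2)
  by (intro gcone_exposed(2)[OF finite_J, of "H (atom j)"]) auto

lemma rays_C: "rays C = (\<lambda>j. ray (w j)) ` J"
  using edge_gcone_iff[OF finite_J ray_w_face w_nonzero] by (auto simp: rays_def)

lemma inj_rays_w: "inj_on (\<lambda>j. ray (w j)) J"
proof (rule inj_onI)
  fix j k assume jk: "j \<in> J" "k \<in> J" "ray (w j) = ray (w k)"
  obtain t where t: "0 < t" "w j = t *\<^sub>R w k"
    using ray_eqD[OF jk(3) w_nonzero[OF jk(2)]] .
  have "H (atom j) \<bullet> w j = 0"
    using H_eq0_iff[OF atom(1)] atom(2) jk(1) by auto
  then have "H (atom j) \<bullet> w k = 0"
    using t by (metis inner_scaleR_right mult_eq_0_iff less_irrefl)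
  then show "j = k"
    using H_eq0_iff[OF atom(1)] atom(2) jk by auto
qed

lemma polar_C: "polar_cone W C = gcone h I"
proof (intro equalityI subsetI)
  fix y assume "y \<in> polar_cone W C"
  then show "y \<in> gcone h I"
    using cone_eq h_in_W by (intro farkas[OF finite_I subspace_W]) (auto simp: polar_cone_def)
next
  fix y assume y: "y \<in> gcone h I"
  have "span (h ` I) \<subseteq> W"
    using h_in_W subspace_W by (intro span_minimal) auto
  then have "y \<in> W"
    using y gcone_subset_span[of h I] by auto
  moreover have "y \<bullet> x \<le> 0" if "x \<in> C" for x
    using y h_gcone_le0[OF _ that] by (auto elim!: gconeE simp: inner_sum_left intro!: sum_nonpos mult_nonneg_nonpos)
  ultimately show "y \<in> polar_cone W C"
    by (simp add: polar_cone_def)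
qed

text \<open>The mirror image of \<open>H_eq0_iff\<close>: as a functional on the polar cone,
  \<open>Z a\<close> exposes the rows of \<open>a\<close>. For coatoms this gives the extreme rays
  of the polar.\<close>

lemma h_Z_eq0_iff:
  assumes a: "a \<in> MB" and i: "i \<in> I"
  shows "Z a \<bullet> h i = 0 \<longleftrightarrow> i \<in> fst a"
proof -
  have "Z a \<bullet> h i = 0 \<longleftrightarrow> (\<Sum>j\<in>snd a. - (h i \<bullet> w j)) = 0"
    by (simp add: Z_def inner_sum_right sum_negf inner_commute[of _ "h i"])
  also have "\<dots> \<longleftrightarrow> (\<forall>j\<in>snd a. - (h i \<bullet> w j) = 0)"
    using finite_snd[OF a] le0[OF i] snd_sub[OF a] by (intro sum_nonneg_eq_0_iff) auto
  also have "\<dots> \<longleftrightarrow> (\<forall>j\<in>snd a. (i, j) \<in> R)"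
    using eq0_iff[OF i] snd_sub[OF a] by auto
  also have "\<dots> \<longleftrightarrow> i \<in> fst a"
    using fst_maxbiclique[OF a] i by blast
  finally show ?thesis .
qed

lemma ray_h_face:
  assumes i: "i \<in> I"
  shows "ray (h i) face_of gcone h I"
  unfolding ray_eq_gcone
proof (rule gcone_exposed(2)[OF finite_I])
  have "Z (coatom i) \<in> C"
    using Z_gcone[OF coatom(1)[OF i]] gcone_mono[OF finite_J snd_sub[OF coatom(1)[OF i]]] by blast
  then show "Z (coatom i) \<bullet> h k \<le> 0" if "k \<in> I" for k
    using h_gcone_le0[OF that, of "Z (coatom i)"] by (simp add: inner_commute)
  show "{i} = {k\<in>I. Z (coatom i) \<bullet> h k = 0}"
    using h_Z_eq0_iff[OF coatom(1)[OF i]] coatom(2)[OF i] i by auto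
qed

lemma inj_rays_h: "inj_on (\<lambda>i. ray (h i)) I"
proof (rule inj_onI)
  fix i k assume ik: "i \<in> I" "k \<in> I" "ray (h i) = ray (h k)"
  obtain t where t: "0 < t" "h i = t *\<^sub>R h k"
    using ray_eqD[OF ik(3) h_nonzero[OF ik(2)]] .
  have "Z (coatom i) \<bullet> h i = 0"
    using h_Z_eq0_iff[OF coatom(1)] coatom(2) ik(1) by auto
  then have "Z (coatom i) \<bullet> h k = 0"
    using t by (metis inner_scaleR_right mult_eq_0_iff less_irrefl)
  then show "i = k"
    using h_Z_eq0_iff[OF coatom(1)] coatom(2) ik by auto
qed

lemma rays_polar: "rays (polar_cone W C) = (\<lambda>i. ray (h i)) ` I"
  unfolding polar_C using edge_gcone_iff[OF finite_I ray_h_face h_nonzero] by (auto simp: rays_def)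

lemma inj_w: "inj_on w J"
  using inj_rays_w by (auto simp: inj_on_def)

lemma is_cone_C: "is_cone C"
  unfolding is_cone_def
proof (intro conjI exI notI)
  show "finite (w ` J)"
    using finite_J by simp
  have "(\<Sum>v\<in>w ` J. c v *\<^sub>R v) = (\<Sum>j\<in>J. c (w j) *\<^sub>R w j)" for c
    using inj_w by (simp add: sum.reindex)
  \<comment> \<open>\<open>is_cone\<close> wants coefficients indexed by vectors; injectivity of
    \<open>w\<close> transports them from indices.\<close>
  moreover have "\<exists>c'. (\<forall>v\<in>w ` J. 0 \<le> c' v) \<and> (\<Sum>j\<in>J. c j *\<^sub>R w j) = (\<Sum>v\<in>w ` J. c' v *\<^sub>R v)"
    if "\<forall>j\<in>J. 0 \<le> c j" for c
  proof (intro exI[of _ "\<lambda>v. c (the_inv_into J w v)"] conjI)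
    show "\<forall>v\<in>w ` J. 0 \<le> c (the_inv_into J w v)"
      using that inj_w by (auto simp: the_inv_into_f_f)
    show "(\<Sum>j\<in>J. c j *\<^sub>R w j) = (\<Sum>v\<in>w ` J. c (the_inv_into J w v) *\<^sub>R v)"
      using inj_w by (simp add: sum.reindex the_inv_into_f_f)
  qed
  ultimately show "C = {\<Sum>v\<in>w ` J. c v *\<^sub>R v |c. \<forall>v\<in>w ` J. 0 \<le> c v}"
    unfolding gcone_def by fastforce
next
  assume "\<exists>a u. u \<noteq> 0 \<and> (\<forall>t. a + t *\<^sub>R u \<in> C)"
  then obtain a u where u: "u \<noteq> 0" and line: "\<And>t. a + t *\<^sub>R u \<in> C"
    by blast
  have "a + 0 *\<^sub>R u \<in> W" "a + 1 *\<^sub>R u \<in> W"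
    using line cone_subset_W by blast+
  then have "(a + 1 *\<^sub>R u) - (a + 0 *\<^sub>R u) \<in> W"
    by (intro subspace_diff subspace_W)
  then have uW: "u \<in> W"
    by simp
  have "h i \<bullet> u = 0" if i: "i \<in> I" for i
  proof (rule ccontr)
    assume nz: "h i \<bullet> u \<noteq> 0"
    \<comment> \<open>The parameter is chosen so that \<open>h i\<close> takes the positive value 1
      on the line.\<close>
    have "h i \<bullet> (a + ((1 - h i \<bullet> a) / (h i \<bullet> u)) *\<^sub>R u) \<le> 0"
      by (intro h_gcone_le0 i line)
    then show False
      using nz by (simp add: inner_add_right)
  qed
  then show False
    using pointed[OF uW] u by blast
qed

lemma cone_of_type_C: "cone_of_type I J R C (\<lambda>i. {x\<in>C. h i \<bullet> x = 0}) (\<lambda>j. ray (w j))"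
  unfolding cone_of_type_def bij_betw_def
proof (intro conjI is_cone_C inj_facets inj_rays_w facets_C[symmetric] rays_C[symmetric] ballI)
  fix i j assume ij: "i \<in> I" "j \<in> J"
  have "ray (w j) \<subseteq> {x\<in>C. h i \<bullet> x = 0} \<longleftrightarrow> w j \<in> {x\<in>C. h i \<bullet> x = 0}"
    using ray_base[of "w j"] conic_gcone[of w J] by (auto simp: ray_def conic_def)
  then show "(i, j) \<in> R \<longleftrightarrow> ray (w j) \<subseteq> {x\<in>C. h i \<bullet> x = 0}"
    using w_in_facet_iff[OF ij] by simp
qed

lemma full_dim_C: "full_dim_in W C"
  by (simp add: full_dim_in_def cone_subset_W aff_dim_C)

lemma facet_ray_matrix_C:
  "(\<And>i j. i \<in> I \<Longrightarrow> j \<in> J \<Longrightarrow> N i j = h i \<bullet> w j) \<Longrightarrow>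
    facet_ray_matrix W I J C (\<lambda>i. {x\<in>C. h i \<bullet> x = 0}) (\<lambda>j. ray (w j)) N"
  unfolding facet_ray_matrix_def
  by (intro exI[of _ h] exI[of _ w]) (auto simp: bij_betw_def inj_rays_h rays_polar)

end

lemma cone_type_configuration_of_lattice:
  assumes "configuration I J R h w"
    and sW: "subspace W" and dimW: "dim W = n" and n: "0 < n"
    and wW: "\<And>j. j \<in> J \<Longrightarrow> w j \<in> W" and hW: "\<And>i. i \<in> I \<Longrightarrow> h i \<in> W"
    and dia: "diamond (maxbiclique_lattice I J R)" and rk: "poset_rank (maxbiclique_lattice I J R) = n"
    and red: "reduced_relation I J R"
  shows "cone_type_configuration I J R h w W"
proof -
  interpret configuration I J R h w by fact
  note c = cone_configuration_of_lattice[OF sW dimW n wW dia rk]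
  interpret cone_configuration I J R h w W
    using c(1) .
  show ?thesis
    using c(2) hW n dimW red by unfold_locales auto
qed

section \<open>Cones over polytopes\<close>

lemma cone_over_iff:
  "p \<in> cone_over P \<longleftrightarrow> p = 0 \<or> (\<exists>t x. 0 < t \<and> x \<in> P \<and> p = t *\<^sub>R (x, 1))"
proof -
  have "t *\<^sub>R (x, 1::real) = 0 \<longleftrightarrow> t = 0" for t and x :: 'a
    by (auto simp: prod_eq_iff)
  then show ?thesis
    unfolding cone_over_def by (auto simp: less_eq_real_def simp del: scaleR_Pair)
qed

lemma cone_overI: "0 \<le> t \<Longrightarrow> x \<in> P \<Longrightarrow> t *\<^sub>R (x, 1) \<in> cone_over P"
  unfolding cone_over_def by blast

lemma cone_over_base: "x \<in> P \<Longrightarrow> (x, 1) \<in> cone_over P"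
  using cone_overI[of 1 x P] by simp

lemma zero_in_cone_over [simp]: "0 \<in> cone_over P"
  by (simp add: cone_over_def)

lemma cone_over_slice: "(x, 1) \<in> cone_over P \<longleftrightarrow> x \<in> P"
proof
  assume "(x, 1) \<in> cone_over P"
  moreover have "(x, 1::real) \<noteq> 0"
    by (simp add: zero_prod_def)
  ultimately obtain t y where "y \<in> P" "(x, 1) = t *\<^sub>R (y, 1::real)"
    unfolding cone_over_iff by metis
  then show "x \<in> P"
    by auto
qed (rule cone_over_base)

lemma cone_over_eq_iff: "cone_over A = cone_over B \<longleftrightarrow> A = B"
  by (metis cone_over_slice subset_antisym subsetI)

lemma cone_over_mono: "A \<subseteq> B \<Longrightarrow> cone_over A \<subseteq> cone_over B"
  unfolding cone_over_def by blast

lemma snd_cone_over: "p \<in> cone_over P \<Longrightarrow> 0 \<le> snd p"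
  by (auto simp: cone_over_iff)

lemma snd_cone_over_pos: "p \<in> cone_over P \<Longrightarrow> p \<noteq> 0 \<Longrightarrow> 0 < snd p"
  by (auto simp: cone_over_iff)

lemma conic_cone_over: "conic (cone_over P)"
  unfolding conic_def
proof (intro allI impI)
  fix p :: "'a \<times> real" and c :: real
  assume p: "p \<in> cone_over P" and c: "0 \<le> c"
  show "c *\<^sub>R p \<in> cone_over P"
  proof (cases "p = 0")
    case False
    then obtain t x where "0 < t" "x \<in> P" "p = t *\<^sub>R (x, 1)"
      using p by (auto simp: cone_over_iff)
    then show ?thesis
      using cone_overI[of "c * t" x P] c by simp
  qed simp
qed

text \<open>A conic combination of the points \<open>(w j, 1)\<close> has height \<open>s\<close>,
  the sum of its coefficients. Division by \<open>s\<close> gives a convex combination, and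
  \<open>s = 0\<close> leaves only the origin.\<close>

lemma cone_over_convex_hull:
  fixes w :: "'j \<Rightarrow> 'a::euclidean_space"
  assumes fin: "finite J"
  shows "cone_over (convex hull (w ` J)) = gcone (\<lambda>j. (w j, 1)) J"
proof
  have "convex hull (w ` J) \<subseteq> {x. (x, 1) \<in> gcone (\<lambda>j. (w j, 1::real)) J}"
  proof (rule hull_minimal)
    show "w ` J \<subseteq> {x. (x, 1) \<in> gcone (\<lambda>j. (w j, 1::real)) J}"
      using gcone_base[OF fin] by force
    show "convex {x. (x, 1) \<in> gcone (\<lambda>j. (w j, 1::real)) J}"
    proof (rule convexI)
      fix x y and u v :: real
      assume xy: "x \<in> {x. (x, 1) \<in> gcone (\<lambda>j. (w j, 1::real)) J}" "y \<in> {x. (x, 1) \<in> gcone (\<lambda>j. (w j, 1::real)) J}"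
        and uv: "0 \<le> u" "0 \<le> v" "u + v = 1"
      have "u *\<^sub>R (x, 1::real) + v *\<^sub>R (y, 1) \<in> gcone (\<lambda>j. (w j, 1)) J"
        using xy uv by (intro gcone_add gcone_scale) auto
      then show "u *\<^sub>R x + v *\<^sub>R y \<in> {x. (x, 1) \<in> gcone (\<lambda>j. (w j, 1::real)) J}"
        using uv by simp
    qed
  qed
  then show "cone_over (convex hull (w ` J)) \<subseteq> gcone (\<lambda>j. (w j, 1)) J"
    unfolding cone_over_iff subset_iff
    by (metis (mono_tags, lifting) gcone_scale gcone_zero less_imp_le mem_Collect_eq)
next
  show "gcone (\<lambda>j. (w j, 1)) J \<subseteq> cone_over (convex hull (w ` J))"
  proof
    fix p assume "p \<in> gcone (\<lambda>j. (w j, 1::real)) J"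
    then obtain c where c': "\<forall>j\<in>J. 0 \<le> c j" "p = (\<Sum>j\<in>J. c j *\<^sub>R (w j, 1))"
      unfolding gcone_def by blast
    note c = c'(1)[rule_format] c'(2)
    define s where "s = sum c J"
    show "p \<in> cone_over (convex hull (w ` J))"
    proof (cases "s = 0")
      case True
      then have "\<forall>j\<in>J. c j = 0"
        unfolding s_def by (subst (asm) sum_nonneg_eq_0_iff[OF fin c(1)])
      then have "p = 0"
        unfolding c(2) by (intro sum.neutral) (auto simp: zero_prod_def)
      then show ?thesis
        by simp
    next
      case False
      then have s: "s > 0"
        using c(1) sum_nonneg[of J c] by (auto simp: s_def less_eq_real_def)
      have "(\<Sum>j\<in>J. (c j / s) *\<^sub>R w j) \<in> convex hull (w ` J)"
      proof (rule convex_sum[OF fin convex_convex_hull])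
        show "(\<Sum>j\<in>J. c j / s) = 1"
          using s by (simp add: sum_divide_distrib[symmetric] s_def)
      qed (use c(1) s in \<open>auto intro: hull_inc\<close>)
      moreover have "p = s *\<^sub>R (\<Sum>j\<in>J. (c j / s) *\<^sub>R w j, 1)"
        using s unfolding c(2) by (simp add: prod_eq_iff fst_sum snd_sum scaleR_sum_right s_def)
      ultimately show ?thesis
        using s cone_overI by (metis less_imp_le)
    qed
  qed
qed

lemma convex_cone_over: 
  assumes "convex P"
  shows "convex (cone_over P)"
proof (rule convexI)
  fix p q and u v :: real
  assume pq: "p \<in> cone_over P" "q \<in> cone_over P" and uv: "0 \<le> u" "0 \<le> v"
  have "p' + q' \<in> cone_over P" if p': "p' \<in> cone_over P" and q': "q' \<in> cone_over P" for p' q'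
  proof (cases "p' = 0 \<or> q' = 0")
    case False
    then obtain s x t y where st: "0 < s" "x \<in> P" "p' = s *\<^sub>R (x, 1)" "0 < t" "y \<in> P" "q' = t *\<^sub>R (y, 1)"
      using p' q' by (auto simp: cone_over_iff)
    have "(s / (s + t)) *\<^sub>R x + (t / (s + t)) *\<^sub>R y \<in> P"
      using st by (intro convexD[OF assms]) (auto simp: add_divide_distrib[symmetric])
    moreover have "p' + q' = (s + t) *\<^sub>R ((s / (s + t)) *\<^sub>R x + (t / (s + t)) *\<^sub>R y, 1)"
      using st by (simp add: scaleR_add_right)
    ultimately show ?thesis
      using st by (metis add_pos_pos cone_overI less_imp_le)
  qed (use p' q' in auto)
  then show "u *\<^sub>R p + v *\<^sub>R q \<in> cone_over P"
    using conic_cone_over[of P] pq uv unfolding conic_def by blast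
qed

lemma span_cone_over: "span (cone_over P) = span ((\<lambda>x. (x, 1)) ` P)"
proof
  show "span (cone_over P) \<subseteq> span ((\<lambda>x. (x, 1)) ` P)"
  proof (intro span_minimal subsetI subspace_span)
    fix p assume "p \<in> cone_over P"
    then show "p \<in> span ((\<lambda>x. (x, 1)) ` P)"
      unfolding cone_over_iff by (elim disjE exE conjE) (simp_all only: span_zero span_scale span_base image_eqI)
  qed
  show "span ((\<lambda>x. (x, 1)) ` P) \<subseteq> span (cone_over P)"
    by (intro span_mono) (auto intro: cone_over_base)
qed

text \<open>At height 1 the affine hull of \<open>P\<close> misses the origin, so adjoining the
  origin raises the dimension by one. For empty \<open>P\<close> the cone is \<open>{0}\<close>, in
  accordance with \<open>0 = -1 + 1\<close>.\<close>

lemma aff_dim_cone_over: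
  fixes P :: "'a::euclidean_space set"
  shows "aff_dim (cone_over P) = aff_dim P + 1"
proof -
  let ?X = "(\<lambda>x. (x, 1::real)) ` P"
  have X: "?X = (+) (0, 1) ` ((\<lambda>x. (x, 0)) ` P)"
    by (auto simp: image_image)
  have "linear (\<lambda>x::'a. (x, 0::real))" "inj (\<lambda>x::'a. (x, 0::real))"
    by (auto simp: linear_iff inj_on_def)
  then have dX: "aff_dim ?X = aff_dim P"
    unfolding X aff_dim_translation_eq by (rule aff_dim_injective_linear_image)
  have "affine hull ?X \<subseteq> {p. snd p = 1}"
    by (rule hull_minimal) (auto simp: affine_def)
  then have "0 \<notin> affine hull ?X"
    by auto
  then have "aff_dim (insert 0 ?X) = aff_dim P + 1"
    by (simp add: aff_dim_insert dX)
  moreover have "aff_dim (insert 0 ?X) = int (dim (insert 0 ?X))"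
    by (intro aff_dim_zero hull_inc) auto
  moreover have "dim (insert 0 ?X) = dim (cone_over P)"
    by (metis dim_span span_cone_over span_insert_0)
  moreover have "aff_dim (cone_over P) = int (dim (cone_over P))"
    by (intro aff_dim_zero hull_inc) auto
  ultimately show ?thesis
    by simp
qed

text \<open>Points are compared after rescaling to height 1. If one endpoint is the origin, the
  other is a multiple of the inner point; otherwise the segment projects to a segment in
  \<open>P\<close> or to a single point.\<close>

lemma face_of_cone_over:
  assumes G: "G face_of P"
  shows "cone_over G face_of cone_over P"
  unfolding face_of_def
proof (intro conjI ballI impI)
  show "cone_over G \<subseteq> cone_over P"
    using G by (intro cone_over_mono) (rule face_of_imp_subset)
  show "convex (cone_over G)"
    using G by (intro convex_cone_over) (rule face_of_imp_convex)
  fix a b x assume a: "a \<in> cone_over P" and b: "b \<in> cone_over P" and x: "x \<in> cone_over G"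
    and seg: "x \<in> open_segment a b"
  obtain u where u: "0 < u" "u < 1" "x = (1 - u) *\<^sub>R a + u *\<^sub>R b" and ne: "a \<noteq> b"
    using seg by (auto simp: in_segment)
  have sa: "0 \<le> snd a" and sb: "0 \<le> snd b"
    using snd_cone_over[OF a] snd_cone_over[OF b] by auto
  have sx: "snd x = (1 - u) * snd a + u * snd b"
    by (simp add: u(3))
  have "x \<noteq> 0"
  proof
    assume "x = 0"
    then have "(1 - u) * snd a + u * snd b = 0"
      using sx by simp
    then have "snd a = 0" "snd b = 0"
      using sa sb u by (auto simp: add_nonneg_eq_0_iff)
    then have "a = 0" "b = 0"
      using snd_cone_over_pos[OF a] snd_cone_over_pos[OF b] by auto
    then show False
      using ne by simp
  qed
  then obtain t g where g: "0 < t" "g \<in> G" "x = t *\<^sub>R (g, 1)"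
    using x by (auto simp: cone_over_iff)
  have scaled: "c = (t / v) *\<^sub>R (g, 1)" if "x = v *\<^sub>R c" "0 < v" for c v
    using that g(3) by (metis divide_inverse divideR_right less_irrefl mult.commute scaleR_scaleR)
  have "a \<in> cone_over G \<and> b \<in> cone_over G"
  proof (cases "a = 0 \<or> b = 0")
    case True
    then show ?thesis
    proof
      assume "a = 0"
      then have "b = (t / u) *\<^sub>R (g, 1)"
        using u by (intro scaled) auto
      then show ?thesis
        using \<open>a = 0\<close> g u cone_overI[of "t / u" g G] by auto
    next
      assume "b = 0"
      then have "a = (t / (1 - u)) *\<^sub>R (g, 1)"
        using u by (intro scaled) auto
      then show ?thesis
        using \<open>b = 0\<close> g u cone_overI[of "t / (1 - u)" g G] by auto
    qed
  next
    case False
    then obtain \<alpha> p \<beta> q where ab: "0 < \<alpha>" "p \<in> P" "a = \<alpha> *\<^sub>R (p, 1)" "0 < \<beta>" "q \<in> P" "b = \<beta> *\<^sub>R (q, 1)"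
      using a b by (auto simp: cone_over_iff)
    have t: "t = (1 - u) * \<alpha> + u * \<beta>"
      using sx g(3) ab by simp
    have "fst x = t *\<^sub>R g" "fst x = ((1 - u) * \<alpha>) *\<^sub>R p + (u * \<beta>) *\<^sub>R q"
      using g(3) by (simp, simp add: u(3) ab(3,6))
    then have tg: "t *\<^sub>R g = ((1 - u) * \<alpha>) *\<^sub>R p + (u * \<beta>) *\<^sub>R q"
      by simp
    have "p \<in> G \<and> q \<in> G"
    proof (cases "p = q")
      case True
      then have "t *\<^sub>R g = t *\<^sub>R p"
        using tg t by (simp add: scaleR_add_left)
      then show ?thesis
        using g True by simp
    next
      case False
      \<comment> \<open>The weight of \<open>q\<close> after rescaling: the heights
        \<open>\<alpha>\<close> and \<open>\<beta>\<close> multiply the weights \<open>1 - u\<close>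
        and \<open>u\<close>, and \<open>t\<close> is the resulting total.\<close>
      define v where "v = (u * \<beta>) / t"
      have v: "0 < v" "1 - v = ((1 - u) * \<alpha>) / t"
        using u ab g(1) t by (auto simp: v_def field_simps)
      then have "v < 1"
        using u ab g(1) by (smt (verit) divide_pos_pos mult_pos_pos)
      have "g = (1 / t) *\<^sub>R (t *\<^sub>R g)"
        using g(1) by simp
      also have "\<dots> = (1 - v) *\<^sub>R p + v *\<^sub>R q"
        unfolding tg v(2) by (simp add: scaleR_add_right v_def)
      finally have "g \<in> open_segment p q"
        using False v(1) \<open>v < 1\<close> by (auto simp: in_segment)
      then show ?thesis
        using G g(2) ab unfolding face_of_def by blast
    qed
    then show ?thesis
      using ab cone_overI by (metis less_imp_le)
  qed
  then show "a \<in> cone_over G" "b \<in> cone_over G"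
    by auto
qed

text \<open>The face of \<open>P\<close> is the slice of \<open>K\<close> at height 1, from which
  \<open>K\<close> is recovered because a face of a cone is conic. The empty face is excluded, as a
  cone over a set contains the origin.\<close>

lemma face_of_cone_over_slice:
  assumes K: "K face_of cone_over P" and ne: "K \<noteq> {}"
  obtains G where "G face_of P" "K = cone_over G"
proof
  let ?G = "{x. (x, 1) \<in> K}"
  have sub: "K \<subseteq> cone_over P"
    using K by (rule face_of_imp_subset)
  have conK: "conic K"
    using face_of_conic[OF conic_cone_over K] .
  show "?G face_of P"
    unfolding face_of_def
  proof (intro conjI ballI impI)
    show "?G \<subseteq> P"
      using sub cone_over_slice by blast
    have "convex K"
      using K by (rule face_of_imp_convex)
    then show "convex ?G"
      unfolding convex_def by force
    fix a b x assume ab: "a \<in> P" "b \<in> P" "x \<in> ?G" "x \<in> open_segment a b"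
    obtain u where u: "a \<noteq> b" "0 < u" "u < 1" "x = (1 - u) *\<^sub>R a + u *\<^sub>R b"
      using ab(4) by (auto simp: in_segment)
    then have "(x, 1) \<in> open_segment (a, 1) (b, 1::real)"
      unfolding in_segment by (intro conjI exI[of _ u]) auto
    then have "(a, 1) \<in> K \<and> (b, 1) \<in> K"
      using K ab cone_over_base unfolding face_of_def by blast
    then show "a \<in> ?G" "b \<in> ?G"
      by auto
  qed
  show "K = cone_over ?G"
  proof (intro equalityI subsetI)
    fix p assume p: "p \<in> K"
    show "p \<in> cone_over ?G"
    proof (cases "p = 0")
      case False
      then obtain t x where tx: "0 < t" "x \<in> P" "p = t *\<^sub>R (x, 1)"
        using p sub cone_over_iff by blast
      have "(1 / t) *\<^sub>R p \<in> K"
        using conK p tx(1) unfolding conic_def by (metis divide_nonneg_nonneg less_imp_le zero_le_one)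
      then have "x \<in> ?G"
        using tx by simp
      then show ?thesis
        using tx cone_overI by (metis less_imp_le)
    qed simp
  next
    fix p assume p: "p \<in> cone_over ?G"
    obtain k where "k \<in> K"
      using ne by blast
    then have "0 *\<^sub>R k \<in> K"
      using conK unfolding conic_def by blast
    then have "0 \<in> K"
      by simp
    then show "p \<in> K"
      using p conK unfolding cone_over_iff conic_def by (metis less_imp_le mem_Collect_eq)
  qed
qed

text \<open>If \<open>P\<close> is a point, its facet is the empty face, which corresponds to the
  face \<open>{0}\<close>. Empty \<open>P\<close> is excluded: the cone \<open>{0}\<close> has the
  empty facet, which is not the cone over any set.\<close>

lemma facets_cone_over:
  fixes P :: "'a::euclidean_space set"
  assumes "0 \<le> aff_dim P"
  shows "facets (cone_over P) = cone_over ` facets P"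
proof (intro equalityI subsetI)
  fix K assume "K \<in> facets (cone_over P)"
  then have K: "K face_of cone_over P" "aff_dim K = aff_dim P"
    by (auto simp: facets_def aff_dim_cone_over)
  then have "K \<noteq> {}"
    using assms by auto
  then obtain G where "G face_of P" "K = cone_over G"
    using face_of_cone_over_slice[OF K(1)] by metis
  then show "K \<in> cone_over ` facets P"
    using K(2) by (auto simp: facets_def aff_dim_cone_over)
qed (auto simp: facets_def aff_dim_cone_over face_of_cone_over)

lemma rays_cone_over:
  fixes P :: "'a::euclidean_space set"
  shows "rays (cone_over P) = (\<lambda>v. cone_over {v}) ` vertices P"
proof (intro equalityI subsetI)
  fix K assume "K \<in> rays (cone_over P)"
  then have K: "K face_of cone_over P" "aff_dim K = 1"
    by (auto simp: rays_def edge_of_def)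
  then have "K \<noteq> {}"
    by auto
  then obtain G where G: "G face_of P" "K = cone_over G"
    using face_of_cone_over_slice[OF K(1)] by metis
  then have "aff_dim G = 0"
    using K(2) by (simp add: aff_dim_cone_over)
  then obtain v where "G = {v}"
    by (auto simp: aff_dim_eq_0)
  then show "K \<in> (\<lambda>v. cone_over {v}) ` vertices P"
    using G by (auto simp: vertices_def face_of_singleton)
next
  fix K assume "K \<in> (\<lambda>v. cone_over {v}) ` vertices P"
  then show "K \<in> rays (cone_over P)"
    by (auto simp: vertices_def rays_def edge_of_def aff_dim_cone_over face_of_cone_over simp flip: face_of_singleton)
qed

lemma cone_over_singleton: "cone_over {v} = ray (v, 1)"
  unfolding cone_over_def ray_def by (auto simp: zero_prod_def)

section \<open>Normals of polyhedral cones and configurations from polytopes\<close>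

lemma proportional_functionals:
  fixes W :: "'v::euclidean_space set"
  assumes sW: "subspace W" and T: "T \<subseteq> W" "dim W \<le> dim T + 1"
    and h: "\<And>x. x \<in> T \<Longrightarrow> h \<bullet> x = 0" and a: "\<And>x. x \<in> T \<Longrightarrow> a \<bullet> x = 0"
    and z: "z \<in> W" "h \<bullet> z < 0"
  shows "x \<in> W \<Longrightarrow> a \<bullet> x = (a \<bullet> z) / (h \<bullet> z) * (h \<bullet> x)"
proof -
  have orth: "c \<bullet> x = 0" if "\<And>x. x \<in> T \<Longrightarrow> c \<bullet> x = 0" "x \<in> span T" for c x
    using that(2) by (induction rule: span_induct_alt) (auto simp: inner_add_right that(1))
  have "z \<notin> span T"
    using orth[of h z] h z(2) by auto
  then have "dim (insert z T) = dim T + 1"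
    by (simp add: dim_insert)
  moreover have "span (insert z T) \<subseteq> W"
    using T(1) z(1) sW by (intro span_minimal) auto
  ultimately have eq: "span (insert z T) = W"
    using T(2) sW by (intro subspace_dim_equal) auto
  show "a \<bullet> x = (a \<bullet> z) / (h \<bullet> z) * (h \<bullet> x)" if xW: "x \<in> W"
  proof -
    obtain k where k: "x - k *\<^sub>R z \<in> span T"
      using xW unfolding eq[symmetric] span_insert by blast
    have "h \<bullet> x = k * (h \<bullet> z)" "a \<bullet> x = k * (a \<bullet> z)"
      using orth[OF h k] orth[OF a k] by (auto simp: inner_diff_right)
    then show ?thesis
      using z(2) by simp
  qed
qed

text \<open>Each halfspace of a minimal description defines a facet, hence some \<open>G i\<close>.
  Its normal and \<open>h i\<close> both vanish on this set of codimension 1 in the span, so they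
  are proportional there with a nonnegative factor, and the inequality of \<open>h i\<close> implies
  that of the halfspace.\<close>

lemma polyhedral_cone_normals:
  fixes C :: "'v::euclidean_space set"
  assumes poly: "polyhedron C" and con: "conic C" and zero: "0 \<in> C" and dimC: "0 < dim C"
    and facets: "facets C = G ` I"
  obtains h where "\<And>i. i \<in> I \<Longrightarrow> h i \<in> span C"
    "\<And>i. i \<in> I \<Longrightarrow> G i = {x\<in>C. h i \<bullet> x = 0}"
    "\<And>i x. i \<in> I \<Longrightarrow> x \<in> C \<Longrightarrow> h i \<bullet> x \<le> 0"
    "\<And>x. x \<in> span C \<Longrightarrow> (\<And>i. i \<in> I \<Longrightarrow> h i \<bullet> x \<le> 0) \<Longrightarrow> x \<in> C"
proof -
  have ad: "aff_dim C = int (dim C)"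
    using zero by (intro aff_dim_zero hull_inc)
  have ah: "affine hull C = span C"
    using zero by (intro affine_hull_span_0 hull_inc)
  have facet_iff: "K \<in> facets C \<longleftrightarrow> K facet_of C" for K
  proof -
    have "aff_dim K \<noteq> aff_dim C - 1" if "K = {}"
    proof -
      have "aff_dim K = -1"
        using that by simp
      then show ?thesis
        using ad dimC by linarith
    qed
    then show ?thesis
      unfolding facets_def facet_of_def by blast
  qed
  have conic0: "0 \<in> K" if "K facet_of C" for K
  proof -
    have "conic K" "K \<noteq> {}"
      using that face_of_conic[OF con] by (auto simp: facet_of_def)
    then obtain k where "0 *\<^sub>R k \<in> K"
      unfolding conic_def by (metis ex_in_conv order_refl)
    then show ?thesis
      by simp
  qed
  have ex: "\<exists>a. a \<in> span C \<and> G i = {x\<in>C. a \<bullet> x = 0} \<and> (\<forall>x\<in>C. a \<bullet> x \<le> 0)" if i: "i \<in> I" for i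
  proof -
    have Gi: "G i facet_of C"
      using facet_iff facets i by blast
    obtain a b where ab: "C \<subseteq> {x. a \<bullet> x \<le> b}" "G i = C \<inter> {x. a \<bullet> x = b}"
      using facet_of_polyhedron[OF poly Gi] by metis
    \<comment> \<open>A facet is a nonempty face of a cone and so contains the origin.\<close>
    have b: "b = 0"
      using conic0[OF Gi] ab(2) by auto
    obtain p where p: "p \<in> span C" "\<And>x. x \<in> span C \<Longrightarrow> p \<bullet> x = a \<bullet> x"
      using subspace_projection[OF subspace_span] by metis
    then have "p \<bullet> x = a \<bullet> x" if "x \<in> C" for x
      using that span_base by metis
    then show ?thesis
      using ab p(1) unfolding b by (intro exI[of _ p]) auto
  qed
  obtain h where h: "\<And>i. i \<in> I \<Longrightarrow> h i \<in> span C \<and> G i = {x\<in>C. h i \<bullet> x = 0} \<and> (\<forall>x\<in>C. h i \<bullet> x \<le> 0)"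
    using ex by metis
  obtain Fs where Fs: "finite Fs" "C = affine hull C \<inter> \<Inter>Fs"
    and half: "\<forall>k\<in>Fs. \<exists>a b. a \<noteq> 0 \<and> k = {x. a \<bullet> x \<le> b}"
    and min: "\<And>F'. F' \<subset> Fs \<Longrightarrow> C \<subset> affine hull C \<inter> \<Inter>F'"
    using poly unfolding polyhedron_Int_affine_minimal by blast
  obtain a b where ab: "\<And>k. k \<in> Fs \<Longrightarrow> a k \<noteq> 0 \<and> k = {x. a k \<bullet> x \<le> b k}"
    using half by metis
  have explicit: "K facet_of C \<longleftrightarrow> (\<exists>k. k \<in> Fs \<and> K = C \<inter> {x. a k \<bullet> x = b k})" for K
    by (rule facet_of_polyhedron_explicit[OF Fs]) (erule ab, erule min)
  have cut: "x \<in> C" if x: "x \<in> span C" "\<And>i. i \<in> I \<Longrightarrow> h i \<bullet> x \<le> 0" for x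
  proof -
    have "x \<in> k" if k: "k \<in> Fs" for k
    proof -
      have fk: "(C \<inter> {x. a k \<bullet> x = b k}) facet_of C"
        using explicit k by blast
      then have "C \<inter> {x. a k \<bullet> x = b k} \<in> G ` I"
        using facet_iff unfolding facets by simp
      then obtain i where i: "i \<in> I" "G i = C \<inter> {x. a k \<bullet> x = b k}"
        by (metis imageE)
      have bk: "b k = 0"
        using conic0[OF fk] by auto
      have Gh: "G i = {x\<in>C. h i \<bullet> x = 0}"
        using h[OF i(1)] by blast
      have "G i \<noteq> C"
        using fk i(2) facet_of_irrefl by metis
      then obtain z where z: "z \<in> C" "h i \<bullet> z \<noteq> 0"
        using Gh by auto
      then have hz: "h i \<bullet> z < 0"
        using h[OF i(1)] by force
      have "aff_dim (G i) = int (dim (G i))"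
        using conic0[OF fk] i(2) by (intro aff_dim_zero hull_inc) auto
      then have dimG: "dim (span C) \<le> dim (G i) + 1"
        using fk i(2) ad by (auto simp: facet_of_def)
      have "a k \<bullet> x = (a k \<bullet> z) / (h i \<bullet> z) * (h i \<bullet> x)"
      proof (rule proportional_functionals[OF subspace_span _ dimG])
        show "G i \<subseteq> span C"
          using Gh span_base by auto
        show "h i \<bullet> y = 0" "a k \<bullet> y = 0" if "y \<in> G i" for y
          using that Gh i(2) bk by auto
        show "z \<in> span C"
          using z(1) by (rule span_base)
      qed (fact hz x(1))+
      moreover have "a k \<bullet> z \<le> 0"
        using z(1) Fs(2) ab[OF k] bk k by auto
      ultimately have "a k \<bullet> x \<le> 0"
        using hz x(2)[OF i(1)] by (metis divide_nonpos_neg mult_nonneg_nonpos)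
      then show ?thesis
        using ab[OF k] bk by auto
    qed
    then show ?thesis
      using Fs(2) x(1) ah by auto
  qed
  show thesis
  proof (rule that)
    show "G i = {x\<in>C. h i \<bullet> x = 0}" "h i \<in> span C" if "i \<in> I" for i
      using h[OF that] by blast+
    show "h i \<bullet> x \<le> 0" if "i \<in> I" "x \<in> C" for i x
      using h[OF that(1)] that(2) by blast
  qed (rule cut)
qed

text \<open>Columns: if all rows through \<open>j\<close> pass through \<open>m\<close>, then
  \<open>w j - \<epsilon> *\<^sub>R w m\<close> stays in the cone for small
  \<open>\<epsilon>\<close>, so the face \<open>ray (w j)\<close> contains
  \<open>w j + \<epsilon> *\<^sub>R w m\<close>, and the two rays coincide. Rows: an inclusion
  between facets of equal dimension is an equality.\<close>

lemma (in cone_configuration) reduced_of_faces: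
  assumes rays: "\<And>j. j \<in> J \<Longrightarrow> ray (w j) face_of gcone w J" and inj_rays: "inj_on (\<lambda>j. ray (w j)) J"
    and nz: "\<And>j. j \<in> J \<Longrightarrow> w j \<noteq> 0"
    and facets: "\<And>i. i \<in> I \<Longrightarrow> aff_dim {x\<in>gcone w J. h i \<bullet> x = 0} = k"
    and inj_facets: "inj_on (\<lambda>i. {x\<in>gcone w J. h i \<bullet> x = 0}) I"
  shows "reduced_relation I J R"
  unfolding reduced_relation_def
proof (intro conjI ballI)
  fix j assume j: "j \<in> J"
  have uniq: "m = j" if m: "m \<in> J" and inc: "\<And>i. i \<in> I \<Longrightarrow> (i, j) \<in> R \<Longrightarrow> (i, m) \<in> R" for m
  proof -
    let ?S = "{i\<in>I. (i, j) \<notin> R}"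
    have fin: "finite ?S"
      using finite_I by simp
    have neg: "h i \<bullet> w j < 0" if "i \<in> ?S" for i
      using that le0[of i j] eq0_iff[of i j] j by auto
    obtain \<epsilon> where \<epsilon>: "\<epsilon> > 0" "\<And>i. i \<in> ?S \<Longrightarrow> h i \<bullet> w j + \<epsilon> * (- (h i \<bullet> w m)) \<le> 0"
      by (rule strict_perturbation[of ?S "\<lambda>i. h i \<bullet> w j" "\<lambda>i. - (h i \<bullet> w m)", OF fin])
        (erule neg, blast intro: that)
    let ?a = "w j - \<epsilon> *\<^sub>R w m" and ?b = "w j + \<epsilon> *\<^sub>R w m"
    have wC: "w j \<in> gcone w J" "w m \<in> gcone w J"
      using gcone_base[OF finite_J] j m by auto
    have a: "?a \<in> gcone w J"
    proof (rule cone_eq)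
      show "?a \<in> W"
        using subspace_W w_in_W j m by (intro subspace_diff subspace_scale)
      show "h i \<bullet> ?a \<le> 0" if i: "i \<in> I" for i
      proof (cases "(i, j) \<in> R")
        case True
        then have "h i \<bullet> w j = 0" "h i \<bullet> w m = 0"
          using eq0_iff i j m inc by auto
        then show ?thesis
          by (simp add: inner_diff_right)
      next
        case False
        then show ?thesis
          using \<epsilon>(2)[of i] i by (simp add: inner_diff_right)
      qed
    qed
    have b: "?b \<in> gcone w J"
      using wC \<epsilon>(1) by (intro gcone_add gcone_scale) auto
    have "?a \<noteq> ?b"
    proof
      assume "?a = ?b"
      then have "(2 * \<epsilon>) *\<^sub>R w m = 0"
        by (simp add: algebra_simps scaleR_2 flip: scaleR_scaleR)
      then show False
        using nz[OF m] \<epsilon>(1) by simp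
    qed
    moreover have "w j = (1 - 1 / 2) *\<^sub>R ?a + (1 / 2) *\<^sub>R ?b"
      by (simp add: scaleR_diff_right scaleR_add_right flip: scaleR_add_left)
    ultimately have "w j \<in> open_segment ?a ?b"
      unfolding in_segment by (intro conjI exI[of _ "1/2"]) auto
    then have "?b \<in> ray (w j)"
      using rays[OF j] a b ray_base unfolding face_of_def by blast
    then obtain t where "w j + \<epsilon> *\<^sub>R w m = t *\<^sub>R w j"
      by (auto simp: ray_def)
    then have "\<epsilon> *\<^sub>R w m = (t - 1) *\<^sub>R w j"
      by (simp add: scaleR_left_diff_distrib algebra_simps)
    then have "(1 / \<epsilon>) *\<^sub>R (\<epsilon> *\<^sub>R w m) = (1 / \<epsilon>) *\<^sub>R ((t - 1) *\<^sub>R w j)"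
      by (rule arg_cong)
    then have mj: "w m = ((t - 1) / \<epsilon>) *\<^sub>R w j"
      using \<epsilon>(1) by simp
    define s where "s = (t - 1) / \<epsilon>"
    \<comment> \<open>A row that is nonzero at \<open>w j\<close> fixes the sign of
      \<open>s\<close>, as rows are nonpositive at all generators.\<close>
    obtain i where i: "i \<in> I" "h i \<bullet> w j \<noteq> 0"
      using pointed[OF w_in_W[OF j]] nz[OF j] by blast
    have "h i \<bullet> w m = s * (h i \<bullet> w j)"
      unfolding mj s_def by simp
    moreover have "h i \<bullet> w j < 0" "h i \<bullet> w m \<le> 0"
      using i le0[OF i(1)] j m by (auto simp: less_le)
    ultimately have "s \<ge> 0"
      by (metis linorder_not_le mult_neg_neg)
    moreover have "s \<noteq> 0"
      using nz[OF m] mj s_def by auto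
    ultimately have s: "s > 0"
      by simp
    have "ray (w m) = ray (w j)"
      unfolding ray_def mj[folded s_def]
    proof (intro equalityI subsetI)
      fix x assume "x \<in> {t *\<^sub>R s *\<^sub>R w j |t. 0 \<le> t}"
      then obtain t where "0 \<le> t" "x = (t * s) *\<^sub>R w j"
        by auto
      then show "x \<in> {t *\<^sub>R w j |t. 0 \<le> t}"
        using s by (intro CollectI exI[of _ "t * s"]) auto
    next
      fix x assume "x \<in> {t *\<^sub>R w j |t. 0 \<le> t}"
      then obtain t where "0 \<le> t" "x = t *\<^sub>R w j"
        by auto
      then show "x \<in> {t *\<^sub>R s *\<^sub>R w j |t. 0 \<le> t}"
        using s by (intro CollectI exI[of _ "t / s"]) auto
    qed
    then show ?thesis
      using inj_rays j m by (metis (mono_tags, lifting) inj_on_def)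
  qed
  show "\<exists>I0. (I0, {j}) \<in> MB"
  proof (intro exI)
    show "({i\<in>I. (i, j) \<in> R}, {j}) \<in> MB"
      unfolding maxbicliques_iff using uniq j by auto
  qed
next
  fix i assume i: "i \<in> I"
  let ?G = "\<lambda>i. {x\<in>gcone w J. h i \<bullet> x = 0}" and ?A = "\<lambda>i. {j\<in>J. h i \<bullet> w j = 0}"
  have G: "?G m = gcone w (?A m)" "gcone w (?A m) face_of gcone w J" if "m \<in> I" for m
    using gcone_exposed[OF finite_J le0[OF that] refl] by auto
  have uniq: "m = i" if m: "m \<in> I" and inc: "\<And>j. j \<in> J \<Longrightarrow> (i, j) \<in> R \<Longrightarrow> (m, j) \<in> R" for m
  proof -
    have "?A i \<subseteq> ?A m"
      using eq0_iff i m inc by auto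
    then have sub: "?G i \<subseteq> ?G m"
      unfolding G[OF i] G[OF m] using finite_J by (intro gcone_mono) auto
    then have "?G i face_of ?G m"
      using face_of_subset[of "?G i" "gcone w J" "?G m"] G[OF i] by auto
    then have "?G i = ?G m"
      using face_of_aff_dim_lt[of "?G m" "?G i"] facets[OF i] facets[OF m] G(1)[OF m] convex_gcone
      by force
    then show ?thesis
      using inj_facets i m by (metis (mono_tags, lifting) inj_on_def)
  qed
  show "\<exists>J0. ({i}, J0) \<in> MB"
  proof (intro exI)
    show "({i}, {j\<in>J. (i, j) \<in> R}) \<in> MB"
      unfolding maxbicliques_iff using uniq i by auto
  qed
qed

lemma (in cone_type_configuration) lattice_conditions:
  "condition_C L" "poset_rank L = dim W" "diamond L"
  by (rule condition_C_L poset_rank_L[OF r_top] diamond_L)+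

lemma polytope_vertices:
  assumes "polytope_of_type I J R P F w"
  shows "P = convex hull (w ` J)" "vertices P = w ` J" "facets P = F ` I" "inj_on w J" "inj_on F I"
    "polytope P" "\<And>i j. i \<in> I \<Longrightarrow> j \<in> J \<Longrightarrow> (i, j) \<in> R \<longleftrightarrow> w j \<in> F i"
proof -
  show *: "vertices P = w ` J" "facets P = F ` I" "inj_on w J" "inj_on F I" "polytope P"
    "\<And>i j. i \<in> I \<Longrightarrow> j \<in> J \<Longrightarrow> (i, j) \<in> R \<longleftrightarrow> w j \<in> F i"
    using assms by (auto simp: polytope_of_type_def bij_betw_def)
  have "P = convex hull (vertices P)"
    unfolding vertices_def using Krein_Milman_Minkowski *(5) polytope_imp_compact polytope_imp_convex
    by blast
  then show "P = convex hull (w ` J)"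
    using *(1) by simp
qed

lemma dim_span_cone_over: "0 \<le> aff_dim P \<Longrightarrow> int (dim (span (cone_over P))) = aff_dim P + 1"
  using aff_dim_zero[OF hull_inc[OF zero_in_cone_over[of P]]] by (simp add: aff_dim_cone_over)

text \<open>The span of the cone itself serves as \<open>W\<close>, so polytopes in arbitrary
  position are covered, centered or not.\<close>

lemma polytope_configuration:
  assumes fin: "finite I" "finite J" and P: "polytope_of_type I J R P F w" and dimP: "0 \<le> aff_dim P"
  obtains h where "cone_type_configuration I J R h (\<lambda>j. (w j, 1)) (span (cone_over P))"
    "gcone (\<lambda>j. (w j, 1)) J = cone_over P"
    "\<And>i. i \<in> I \<Longrightarrow> cone_over (F i) = {x\<in>cone_over P. h i \<bullet> x = 0}"
proof -
  note v = polytope_vertices[OF P]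
  let ?w = "\<lambda>j. (w j, 1::real)"
  have C: "gcone ?w J = cone_over P"
    using cone_over_convex_hull[OF fin(2), of w] v(1) by simp
  have dimC: "int (dim (cone_over P)) = aff_dim P + 1"
    using dim_span_cone_over[OF dimP] by simp
  have facets: "facets (cone_over P) = (\<lambda>i. cone_over (F i)) ` I"
    using facets_cone_over[OF dimP] v(3) by (simp add: image_image)
  have poly: "polyhedron (cone_over P)"
    using polyhedron_gcone[OF fin(2), of ?w] C by simp
  have pos: "0 < dim (cone_over P)"
    using dimC dimP by linarith
  obtain h where h: "\<And>i. i \<in> I \<Longrightarrow> h i \<in> span (cone_over P)"
    "\<And>i. i \<in> I \<Longrightarrow> cone_over (F i) = {x\<in>cone_over P. h i \<bullet> x = 0}"
    "\<And>i x. i \<in> I \<Longrightarrow> x \<in> cone_over P \<Longrightarrow> h i \<bullet> x \<le> 0"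
    "\<And>x. x \<in> span (cone_over P) \<Longrightarrow> (\<And>i. i \<in> I \<Longrightarrow> h i \<bullet> x \<le> 0) \<Longrightarrow> x \<in> cone_over P"
    by (rule polyhedral_cone_normals[OF poly conic_cone_over zero_in_cone_over pos facets]) (blast intro: that)
  have wC: "?w j \<in> cone_over P" if "j \<in> J" for j
    using gcone_base[OF fin(2) that, of ?w] C by simp
  interpret configuration I J R h ?w
  proof
    show "h i \<bullet> ?w j \<le> 0" if "i \<in> I" "j \<in> J" for i j
      using h(3)[OF that(1) wC[OF that(2)]] .
    show "h i \<bullet> ?w j = 0 \<longleftrightarrow> (i, j) \<in> R" if "i \<in> I" "j \<in> J" for i j
    proof -
      have "h i \<bullet> ?w j = 0 \<longleftrightarrow> ?w j \<in> cone_over (F i)"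
        using h(2)[OF that(1)] wC[OF that(2)] by auto
      then show ?thesis
        using cone_over_slice v(7)[OF that] by blast
    qed
  qed (fact fin)+
  interpret cone_configuration I J R h ?w "span (cone_over P)"
  proof
    show "?w j \<in> span (cone_over P)" if "j \<in> J" for j
      using wC[OF that] by (rule span_base)
    show "x \<in> gcone ?w J" if "x \<in> span (cone_over P)" "\<And>i. i \<in> I \<Longrightarrow> h i \<bullet> x \<le> 0" for x
      unfolding C using that by (rule h(4))
    show "x = 0" if x: "x \<in> span (cone_over P)" "\<And>i. i \<in> I \<Longrightarrow> h i \<bullet> x = 0" for x
    proof -
      \<comment> \<open>Nonzero points of the cone have positive height, so a nonzero
        \<open>x\<close> and its negative cannot both belong to it.\<close>
      have "x \<in> cone_over P" "- x \<in> cone_over P"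
        using x by (auto intro!: h(4) span_neg)
      then have "\<not> x \<noteq> 0"
        using snd_cone_over_pos[of x P] snd_cone_over[of "- x" P] by auto
      then show ?thesis
        by simp
    qed
  qed simp
  have ray: "ray (?w j) = cone_over {w j}" for j
    by (simp add: cone_over_singleton)
  have red: "reduced_relation I J R"
  proof (rule reduced_of_faces)
    fix j assume j: "j \<in> J"
    have "{w j} face_of P"
      using v(2) j by (auto simp: vertices_def face_of_singleton)
    then show "ray (?w j) face_of gcone ?w J"
      unfolding ray C by (rule face_of_cone_over)
    show "?w j \<noteq> 0"
      by (simp add: zero_prod_def)
  next
    show "inj_on (\<lambda>j. ray (?w j)) J"
      unfolding ray using v(4) by (auto simp: inj_on_def cone_over_eq_iff)
    show "aff_dim {x\<in>gcone ?w J. h i \<bullet> x = 0} = aff_dim P" if "i \<in> I" for i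
    proof -
      have "F i \<in> facets P"
        using v(3) that by blast
      then show ?thesis
        unfolding C h(2)[OF that, symmetric] by (simp add: aff_dim_cone_over facets_def)
    qed
    show "inj_on (\<lambda>i. {x\<in>gcone ?w J. h i \<bullet> x = 0}) I"
      unfolding C
    proof (rule inj_onI)
      fix i m assume im: "i \<in> I" "m \<in> I" "{x\<in>cone_over P. h i \<bullet> x = 0} = {x\<in>cone_over P. h m \<bullet> x = 0}"
      then have "cone_over (F i) = cone_over (F m)"
        unfolding h(2)[OF im(1)] h(2)[OF im(2)] by blast
      then have "F i = F m"
        unfolding cone_over_eq_iff .
      then show "i = m"
        using v(5) im by (metis inj_onD)
    qed
  qed
  have conf: "cone_type_configuration I J R h ?w (span (cone_over P))"
  proof
    show "span (?w ` J) = span (cone_over P)"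
      using span_gcone[OF fin(2), of ?w] C by simp
    show "0 < dim (span (cone_over P))"
      using pos by simp
  qed (fact h(1) red)+
  show thesis
  proof (rule that)
    show "cone_over (F i) = {x\<in>cone_over P. h i \<bullet> x = 0}" if "i \<in> I" for i
      using that by (rule h(2))
  qed (rule conf C)+
qed

section \<open>Rank bounds and the passage from cones to polytopes\<close>

lemma filled_configuration:
  assumes "finite I" "finite J" "filled_incidence_matrix I J R 0 N"
    and "\<And>i j. i \<in> I \<Longrightarrow> j \<in> J \<Longrightarrow> N i j = h i \<bullet> w j"
  shows "configuration I J R h w"
proof
  fix i j assume ij: "i \<in> I" "j \<in> J"
  then have "if (i, j) \<in> R then h i \<bullet> w j = 0 else h i \<bullet> w j < 0"
    using assms(3,4) unfolding filled_incidence_matrix_def by metis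
  then show "h i \<bullet> w j \<le> 0" "h i \<bullet> w j = 0 \<longleftrightarrow> (i, j) \<in> R"
    by (auto split: if_splits)
qed (fact assms)+

text \<open>A matrix of smaller rank would factor through a smaller subspace, in which the
  generators cannot span the \<open>n\<close> dimensions that \<open>elem_rank_unique\<close>
  demands.\<close>

lemma rank_ge_poset_rank:
  fixes W :: "'v::euclidean_space set"
  assumes fin: "finite I" "finite J" and sW: "subspace W" and dimW: "dim W = n" and n: "0 < n"
    and gr: "graded (maxbiclique_lattice I J R)" and rk: "poset_rank (maxbiclique_lattice I J R) = n"
    and N: "filled_incidence_matrix I J R 0 N"
  shows "n \<le> matrix_rank I J N"
proof (rule ccontr)
  assume "\<not> n \<le> matrix_rank I J N"
  then have lt: "matrix_rank I J N < n"
    by simp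
  then obtain T where T: "subspace T" "T \<subseteq> span W" "dim T = matrix_rank I J N"
    using choose_subspace_of_subspace[of "matrix_rank I J N" W] dimW by auto
  then obtain h w where hw: "\<And>i. h i \<in> T" "\<And>j. w j \<in> T"
    "\<And>i j. i \<in> I \<Longrightarrow> j \<in> J \<Longrightarrow> N i j = h i \<bullet> w j"
    using rank_factorization[OF fin(1), of T J N] by auto
  interpret configuration I J R h w
    by (rule filled_configuration[OF fin N hw(3)])
  have "span (w ` J) \<subseteq> T"
    using hw(2) T(1) by (intro span_minimal) auto
  then have le: "r (top_mb I J R) \<le> matrix_rank I J N"
    unfolding r_def U_def top_mb(2) using T(3) dim_subset by metis
  have "r (top_mb I J R) = n"
    using le lt by (intro elem_rank_unique(1)[where r = r, OF fin gr rk n] r_mono) auto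
  then show False
    using le lt by simp
qed

text \<open>One more coordinate absorbs the constant: the factors become \<open>(h i, c)\<close> and
  \<open>(w j, 1)\<close>. The space \<open>V\<close> provides the room for a factorization.\<close>

lemma rank_add_constant:
  fixes V :: "'a::euclidean_space set"
  assumes fin: "finite I" and V: "subspace V" "matrix_rank I J M \<le> dim V"
  shows "matrix_rank I J (\<lambda>i j. M i j + c) \<le> matrix_rank I J M + 1"
proof -
  have "\<exists>T :: 'a set. subspace T \<and> dim T = matrix_rank I J M"
    using choose_subspace_of_subspace[OF V(2)] by blast
  then obtain T :: "'a set" where T: "subspace T" "dim T = matrix_rank I J M"
    by blast
  obtain h w where hw: "\<And>i. h i \<in> T" "\<And>j. w j \<in> T"
    "\<And>i j. i \<in> I \<Longrightarrow> j \<in> J \<Longrightarrow> M i j = h i \<bullet> w j"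
    using rank_factorization[OF fin T(1), of J M] T(2) by auto
  have "matrix_rank I J (\<lambda>i j. M i j + c) \<le> dim (T \<times> (UNIV :: real set))"
    using hw T by (intro rank_le_dim_rows[where h = "\<lambda>i. (h i, c)" and w = "\<lambda>j. (w j, 1)"] subspace_Times) auto
  also have "\<dots> = matrix_rank I J M + 1"
    using T by (simp add: dim_Times)
  finally show ?thesis .
qed

lemma cone_of_type_cong:
  assumes "\<And>i. i \<in> I \<Longrightarrow> F i = F' i" "\<And>j. j \<in> J \<Longrightarrow> r j = r' j"
  shows "cone_of_type I J R C F r \<longleftrightarrow> cone_of_type I J R C F' r'"
  using bij_betw_cong[of I F F' "facets C"] bij_betw_cong[of J r r' "rays C"] assms
  unfolding cone_of_type_def by auto

lemma facet_ray_matrix_cong: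
  assumes "\<And>i. i \<in> I \<Longrightarrow> F i = F' i" "\<And>j. j \<in> J \<Longrightarrow> r j = r' j"
  shows "facet_ray_matrix W I J C F r N \<longleftrightarrow> facet_ray_matrix W I J C F' r' N"
  using assms unfolding facet_ray_matrix_def by simp

text \<open>\<open>cone_over\<close> is injective on sets, so the bijections onto facets and rays of
  the cone descend to the polytope.\<close>

lemma polytope_of_type_from_cone:
  assumes "polytope P" and dimP: "0 \<le> aff_dim P"
    and C: "cone_of_type I J R (cone_over P) (\<lambda>i. cone_over (F i)) (\<lambda>j. cone_over {w j})"
  shows "polytope_of_type I J R P F w"
  unfolding polytope_of_type_def
proof (intro conjI ballI)
  have F: "inj_on (\<lambda>i. cone_over (F i)) I" "(\<lambda>i. cone_over (F i)) ` I = cone_over ` facets P"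
    using C facets_cone_over[OF dimP] by (auto simp: cone_of_type_def bij_betw_def)
  have inj: "inj_on cone_over X" for X :: "'a set set"
    by (auto simp: inj_on_def cone_over_eq_iff)
  have "cone_over ` F ` I = cone_over ` facets P"
    using F(2) by (simp add: image_image)
  then have "F ` I = facets P"
    using inj_on_image_eq_iff[OF inj[of UNIV], of "F ` I" "facets P"] by simp
  moreover have "inj_on F I"
    using F(1) by (auto simp: inj_on_def)
  ultimately show "bij_betw F I (facets P)"
    by (simp add: bij_betw_def)
  have w: "inj_on (\<lambda>j. cone_over {w j}) J" "(\<lambda>j. cone_over {w j}) ` J = (\<lambda>v. cone_over {v}) ` vertices P"
    using C rays_cone_over[of P] by (auto simp: cone_of_type_def bij_betw_def)
  have inj': "inj_on (\<lambda>v::'a. cone_over {v}) UNIV"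
    by (auto simp: inj_on_def cone_over_eq_iff)
  have "(\<lambda>v. cone_over {v}) ` w ` J = (\<lambda>v. cone_over {v}) ` vertices P"
    using w(2) by (simp add: image_image)
  then have "w ` J = vertices P"
    using inj_on_image_eq_iff[OF inj', of "w ` J" "vertices P"] by simp
  moreover have "inj_on w J"
    using w(1) by (auto simp: inj_on_def)
  ultimately show "bij_betw w J (vertices P)"
    by (simp add: bij_betw_def)
  show "(i, j) \<in> R \<longleftrightarrow> w j \<in> F i" if "i \<in> I" "j \<in> J" for i j
  proof -
    have "(i, j) \<in> R \<longleftrightarrow> cone_over {w j} \<subseteq> cone_over (F i)"
      using C that by (simp add: cone_of_type_def)
    also have "\<dots> \<longleftrightarrow> w j \<in> F i"
      using cone_over_slice[of "w j" "F i"] cone_over_base[of "w j" "{w j}"] cone_over_mono[of "{w j}" "F i"]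
      by auto
    finally show ?thesis .
  qed
qed fact

lemma gcone_Pair:
  "(y, s) \<in> gcone (\<lambda>i. (h i, t)) I \<longleftrightarrow>
    (\<exists>c. (\<forall>i\<in>I. 0 \<le> c i) \<and> y = (\<Sum>i\<in>I. c i *\<^sub>R h i) \<and> s = sum c I * t)"
proof -
  have "(\<Sum>i\<in>I. c i *\<^sub>R (h i, t)) = (\<Sum>i\<in>I. c i *\<^sub>R h i, sum c I * t)" for c
    by (simp add: prod_eq_iff fst_sum snd_sum sum_distrib_right)
  then show ?thesis
    unfolding gcone_def by auto
qed

lemma gcone_rescale:
  assumes b: "\<And>j. j \<in> J \<Longrightarrow> 0 < b j"
  shows "gcone (\<lambda>j. b j *\<^sub>R w j) J = gcone w J"
proof (intro equalityI subsetI)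
  fix x assume "x \<in> gcone (\<lambda>j. b j *\<^sub>R w j) J"
  then obtain c where c: "\<forall>j\<in>J. 0 \<le> c j" "x = (\<Sum>j\<in>J. c j *\<^sub>R b j *\<^sub>R w j)"
    unfolding gcone_def by blast
  have "(\<Sum>j\<in>J. (c j * b j) *\<^sub>R w j) \<in> gcone w J"
    using c(1) b by (intro gconeI mult_nonneg_nonneg) (auto simp: less_imp_le)
  then show "x \<in> gcone w J"
    by (simp add: c(2))
next
  fix x assume "x \<in> gcone w J"
  then obtain c where c: "\<forall>j\<in>J. 0 \<le> c j" "x = (\<Sum>j\<in>J. c j *\<^sub>R w j)"
    unfolding gcone_def by blast
  have "(\<Sum>j\<in>J. (c j / b j) *\<^sub>R b j *\<^sub>R w j) \<in> gcone (\<lambda>j. b j *\<^sub>R w j) J"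
    using c(1) b by (intro gconeI divide_nonneg_pos) auto
  moreover have "(\<Sum>j\<in>J. (c j / b j) *\<^sub>R b j *\<^sub>R w j) = x"
    unfolding c(2) using b by (intro sum.cong) (auto simp: less_imp_neq[symmetric])
  ultimately show "x \<in> gcone (\<lambda>j. b j *\<^sub>R w j) J"
    by simp
qed

text \<open>The cone over a centered polytope with vertices \<open>w j\<close> and covertices \<open>h i\<close>.\<close>

locale centered_configuration =
  cone_type_configuration I J R "\<lambda>i. (h i, -1 :: real)" "\<lambda>j. (w j, 1 :: real)" "V \<times> (UNIV :: real set)"
  for I :: "'i set" and J :: "'j set" and R and h :: "'i \<Rightarrow> 'a::euclidean_space" and w :: "'j \<Rightarrow> 'a" and V +
  assumes subspace_V: "subspace V"
begin

definition P where "P = convex hull (w ` J)"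
definition F where "F i = {x\<in>P. h i \<bullet> x = 1}"

lemma C_eq: "C = cone_over P"
  unfolding P_def by (rule cone_over_convex_hull[OF finite_J, symmetric])

lemma w_in_V: "j \<in> J \<Longrightarrow> w j \<in> V"
  using w_in_W by auto

lemma h_in_V: "i \<in> I \<Longrightarrow> h i \<in> V"
  using h_in_W by auto

lemma P_sub_V: "P \<subseteq> V"
  unfolding P_def using w_in_V subspace_V by (intro hull_minimal) (auto simp: subspace_imp_convex)

lemma dim_V_UNIV: "dim (V \<times> (UNIV :: real set)) = dim V + 1"
  using subspace_V by (simp add: dim_Times)

lemma aff_dim_P: "aff_dim P = int (dim V)"
  using aff_dim_C unfolding C_eq aff_dim_cone_over dim_V_UNIV by simp

lemma cone_over_F: "cone_over (F i) = {x\<in>C. (h i, -1) \<bullet> x = 0}"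
proof -
  have "(h i, -1 :: real) \<bullet> (t *\<^sub>R (x, 1)) = 0 \<longleftrightarrow> t = 0 \<or> h i \<bullet> x = 1" for t x
  proof -
    have "(h i, -1 :: real) \<bullet> (t *\<^sub>R (x, 1)) = t * (h i \<bullet> x - 1)"
      by (simp add: algebra_simps)
    then show ?thesis
      by auto
  qed
  then have eq: "(h i, -1) \<bullet> (t *\<^sub>R (x, 1 :: real)) = 0 \<longleftrightarrow> h i \<bullet> x = 1" if "0 < t" for t x
    using that by simp
  have "p \<in> cone_over (F i) \<longleftrightarrow> p \<in> C \<and> (h i, -1) \<bullet> p = 0" for p
  proof (cases "p = 0")
    case False
    then show ?thesis
      unfolding C_eq cone_over_iff F_def mem_Collect_eq using eq by metis
  qed simp
  then show ?thesis
    by blast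
qed

lemma cone_of_type_P: "cone_of_type I J R (cone_over P) (\<lambda>i. cone_over (F i)) (\<lambda>j. cone_over {w j})"
  using cone_of_type_C unfolding cone_over_F cone_over_singleton C_eq .

lemma polytope_P: "polytope_of_type I J R P F w"
proof (rule polytope_of_type_from_cone)
  show "polytope P"
    unfolding P_def using finite_J by (auto simp: polytope_def)
qed (simp_all add: aff_dim_P cone_of_type_P)

lemma P_iff: "x \<in> P \<longleftrightarrow> x \<in> V \<and> (\<forall>i\<in>I. h i \<bullet> x \<le> 1)"
proof -
  have "x \<in> P \<longleftrightarrow> (x, 1) \<in> C"
    unfolding C_eq cone_over_slice ..
  also have "\<dots> \<longleftrightarrow> (x, 1) \<in> V \<times> UNIV \<and> (\<forall>i\<in>I. (h i, -1) \<bullet> (x, 1::real) \<le> 0)"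
    using cone_eq[of "(x, 1)"] h_gcone_le0[of _ "(x, 1)"] cone_subset_W by blast
  finally show ?thesis
    by simp
qed

lemma full_dim_P: "full_dim_in V P"
  by (simp add: full_dim_in_def P_sub_V aff_dim_P)

lemma centered_P: "centered_in V P"
  unfolding centered_in_def
proof (intro conjI full_dim_P)
  let ?T = "V \<inter> (\<Inter>i\<in>I. {x. h i \<bullet> x < 1})"
  have "open (\<Inter>i\<in>I. {x. h i \<bullet> x < 1})"
    using finite_I by (intro open_INT) (auto simp: open_halfspace_lt)
  then have "openin (top_of_set V) ?T"
    by (rule openin_open_Int)
  moreover have "0 \<in> ?T"
    using subspace_0[OF subspace_V] by simp
  moreover have "?T \<subseteq> P"
    by (auto simp: P_iff less_imp_le)
  ultimately show "0 \<in> top_of_set V interior_of P"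
    unfolding interior_of_def by blast
qed

text \<open>A point \<open>y\<close> is in the polar iff \<open>(y, -1)\<close> is in the polar
  cone, which is generated by the \<open>(h i, -1)\<close>. Changing the sign of the height turns
  this into the slice at height 1 of the cone over the \<open>h i\<close>.\<close>

lemma polar_P: "polar V P = convex hull (h ` I)"
proof (rule Set.set_eqI)
  fix y
  have "y \<in> polar V P \<longleftrightarrow> (y, -1 :: real) \<in> polar_cone (V \<times> (UNIV :: real set)) C"
  proof
    assume y: "y \<in> polar V P"
    have "(y, -1) \<bullet> p \<le> 0" if p: "p \<in> C" for p
    proof (cases "p = 0")
      case False
      then obtain t x where tx: "0 < t" "x \<in> P" "p = t *\<^sub>R (x, 1)"
        using p unfolding C_eq cone_over_iff by blast
      have "(y, -1) \<bullet> p = t * (y \<bullet> x - 1)"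
        by (simp add: tx(3) algebra_simps)
      also have "\<dots> \<le> 0"
        using y tx by (intro mult_nonneg_nonpos) (auto simp: polar_def)
      finally show ?thesis .
    qed simp
    then show "(y, -1 :: real) \<in> polar_cone (V \<times> (UNIV :: real set)) C"
      using y by (simp add: polar_cone_def polar_def)
  next
    assume y: "(y, -1 :: real) \<in> polar_cone (V \<times> (UNIV :: real set)) C"
    have "y \<bullet> x \<le> 1" if "x \<in> P" for x
    proof -
      have "(x, 1) \<in> C"
        unfolding C_eq using that by (rule cone_over_base)
      then have "(y, -1) \<bullet> (x, 1::real) \<le> 0"
        using y unfolding polar_cone_def by blast
      then show ?thesis
        by simp
    qed
    then show "y \<in> polar V P"
      using y by (simp add: polar_cone_def polar_def)
  qed
  also have "\<dots> \<longleftrightarrow> (y, -1 :: real) \<in> gcone (\<lambda>i. (h i, -1 :: real)) I"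
    by (simp add: polar_C)
  also have "\<dots> \<longleftrightarrow> (y, 1 :: real) \<in> gcone (\<lambda>i. (h i, 1 :: real)) I"
    unfolding gcone_Pair by simp
  also have "\<dots> \<longleftrightarrow> y \<in> convex hull (h ` I)"
    by (simp add: cone_over_slice flip: cone_over_convex_hull[OF finite_I])
  finally show "y \<in> polar V P \<longleftrightarrow> y \<in> convex hull (h ` I)" .
qed

lemma vertices_polar_P: "vertices (polar V P) = h ` I"
proof -
  let ?k = "\<lambda>i. (h i, 1::real)"
  have face: "ray (?k i) face_of gcone ?k I" if i: "i \<in> I" for i
    unfolding ray_eq_gcone[of ?k i]
  proof (rule gcone_exposed(2)[OF finite_I])
    let ?Z = "Z (coatom i)"
    \<comment> \<open>Negating the height of \<open>?Z\<close> compensates for the passage from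
      \<open>(h m, -1)\<close> to \<open>(h m, 1)\<close>, so the functional exposing a ray of the
      polar cone can be reused.\<close>
    have eq: "(fst ?Z, - snd ?Z) \<bullet> ?k m = ?Z \<bullet> (h m, -1)" for m
      by (simp add: inner_prod_def)
    have ZC: "?Z \<in> C"
      using Z_gcone[OF coatom(1)[OF i]] gcone_mono[OF finite_J snd_sub[OF coatom(1)[OF i]]] by blast
    show "(fst ?Z, - snd ?Z) \<bullet> ?k m \<le> 0" if "m \<in> I" for m
      unfolding eq using h_gcone_le0[OF that ZC] by (simp add: inner_commute)
    show "{i} = {m\<in>I. (fst ?Z, - snd ?Z) \<bullet> ?k m = 0}"
      unfolding eq using h_Z_eq0_iff[OF coatom(1)[OF i]] coatom(2)[OF i] i by auto
  qed
  have "rays (gcone ?k I) = (\<lambda>i. ray (?k i)) ` I"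
    using edge_gcone_iff[OF finite_I, of ?k] face by (auto simp: rays_def zero_prod_def)
  then have "(\<lambda>v. cone_over {v}) ` vertices (convex hull (h ` I)) = (\<lambda>v. cone_over {v}) ` h ` I"
    using rays_cone_over[of "convex hull (h ` I)"]
    by (simp add: cone_over_convex_hull[OF finite_I] image_image cone_over_singleton)
  moreover have "inj_on (\<lambda>v::'a. cone_over {v}) UNIV"
    by (auto simp: inj_on_def cone_over_eq_iff)
  ultimately show ?thesis
    unfolding polar_P using inj_on_image_eq_iff by (metis subset_UNIV)
qed

lemma inj_h: "inj_on h I"
  using inj_rays_h by (auto simp: inj_on_def)

lemma facet_vertex_matrix_P:
  assumes "\<And>i j. i \<in> I \<Longrightarrow> j \<in> J \<Longrightarrow> M i j = h i \<bullet> w j"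
  shows "facet_vertex_matrix V I J P F w M"
  unfolding facet_vertex_matrix_def using assms
  by (intro exI[of _ h]) (auto simp: bij_betw_def inj_h vertices_polar_P F_def)

end

lemma facet_vertex_matrix_cong:
  assumes "\<And>i. i \<in> I \<Longrightarrow> F i = F' i"
  shows "facet_vertex_matrix V I J P F w M \<longleftrightarrow> facet_vertex_matrix V I J P F' w M"
  using assms unfolding facet_vertex_matrix_def by simp

lemma centered_configuration_of_lattice:
  fixes V :: "'a::euclidean_space set"
  assumes fin: "finite I" "finite J" and V: "subspace V"
    and h: "\<And>i. i \<in> I \<Longrightarrow> h i \<in> V" and w: "\<And>j. j \<in> J \<Longrightarrow> w j \<in> V"
    and filled: "filled_incidence_matrix I J R 1 M" and M: "\<And>i j. i \<in> I \<Longrightarrow> j \<in> J \<Longrightarrow> M i j = h i \<bullet> w j"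
    and dia: "diamond (maxbiclique_lattice I J R)" and rk: "poset_rank (maxbiclique_lattice I J R) = dim V + 1"
    and red: "reduced_relation I J R"
  shows "centered_configuration I J R h w V"
proof -
  have "filled_incidence_matrix I J R 0 (\<lambda>i j. M i j - 1)"
    using filled unfolding filled_incidence_matrix_def by (auto split: if_splits)
  then have "configuration I J R (\<lambda>i. (h i, -1 :: real)) (\<lambda>j. (w j, 1 :: real))"
    by (rule filled_configuration[OF fin]) (simp add: M)
  then have "cone_type_configuration I J R (\<lambda>i. (h i, -1 :: real)) (\<lambda>j. (w j, 1 :: real)) (V \<times> (UNIV :: real set))"
    using V h w by (intro cone_type_configuration_of_lattice[OF _ _ _ _ _ _ dia rk red] subspace_Times)
      (auto simp: dim_Times)
  then show ?thesis
    using V by (simp add: centered_configuration_def centered_configuration_axioms_def)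
qed

lemma span_cone_over_full_dim:
  assumes V: "subspace V" and P: "full_dim_in V P"
  shows "span (cone_over P) = V \<times> (UNIV :: real set)"
proof (rule subspace_dim_equal)
  have sub: "cone_over P \<subseteq> V \<times> UNIV"
    using P subspace_0[OF V] subspace_scale[OF V] unfolding full_dim_in_def
    by (auto simp: cone_over_def zero_prod_def)
  then show "span (cone_over P) \<subseteq> V \<times> UNIV"
    using V by (intro span_minimal subspace_Times) auto
  have "0 \<le> aff_dim P"
    using P by (simp add: full_dim_in_def)
  then have "int (dim (span (cone_over P))) = int (dim V) + 1"
    using dim_span_cone_over[of P] P unfolding full_dim_in_def by linarith
  then show "dim (V \<times> (UNIV :: real set)) \<le> dim (span (cone_over P))"
    using V by (simp add: dim_Times)
qed (use V in \<open>auto intro: subspace_Times\<close>)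

text \<open>At the interior point 0 all facet inequalities are strict, so the last coordinate of
  each normal is negative and can be scaled to \<open>-1\<close>; the remaining coordinates are then
  the covertices.\<close>

lemma centered_polytope_configuration:
  fixes V :: "'a::euclidean_space set"
  assumes fin: "finite I" "finite J" and V: "subspace V"
    and P: "polytope_of_type I J R P F w" and cen: "centered_in V P"
  obtains h where "centered_configuration I J R h w V" "P = convex hull (w ` J)"
    "\<And>i. i \<in> I \<Longrightarrow> F i = {x\<in>P. h i \<bullet> x = 1}"
proof -
  have full: "full_dim_in V P" and "0 \<in> top_of_set V interior_of P"
    using cen by (auto simp: centered_in_def)
  then obtain T where T: "openin (top_of_set V) T" "0 \<in> T" "T \<subseteq> P"
    by (auto simp: interior_of_def)
  then have "\<exists>\<epsilon>>0. \<forall>x\<in>V. dist x 0 < \<epsilon> \<longrightarrow> x \<in> T"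
    unfolding openin_euclidean_subtopology_iff by blast
  then obtain \<epsilon> where e0: "\<epsilon> > 0" "\<forall>x\<in>V. dist x 0 < \<epsilon> \<longrightarrow> x \<in> T"
    by blast
  then have \<epsilon>: "\<epsilon> > 0" "\<And>x. x \<in> V \<Longrightarrow> norm x < \<epsilon> \<Longrightarrow> x \<in> P"
    using T(3) by auto
  have dimP: "0 \<le> aff_dim P"
    using full by (simp add: full_dim_in_def)
  obtain k where k: "cone_type_configuration I J R k (\<lambda>j. (w j, 1)) (span (cone_over P))"
    "gcone (\<lambda>j. (w j, 1)) J = cone_over P"
    "\<And>i. i \<in> I \<Longrightarrow> cone_over (F i) = {x\<in>cone_over P. k i \<bullet> x = 0}"
    by (rule polytope_configuration[OF fin P dimP]) (blast intro: that)
  have W: "span (cone_over P) = V \<times> UNIV"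
    by (rule span_cone_over_full_dim[OF V full])
  interpret K: cone_type_configuration I J R k "\<lambda>j. (w j, 1)" "V \<times> UNIV"
    using k(1) unfolding W .
  have neg: "snd (k i) < 0" if i: "i \<in> I" for i
  proof -
    let ?g = "fst (k i)" and ?s = "snd (k i)"
    have gV: "?g \<in> V"
      using K.h_in_W[OF i] by auto
    have le: "?g \<bullet> x + ?s \<le> 0" if "x \<in> P" for x
      using K.h_gcone_le0[OF i, of "(x, 1)"] cone_over_base[OF that] k(2) by (simp add: inner_prod_def)
    \<comment> \<open>Small enough for \<open>e *\<^sub>R ?g\<close> to stay in the ball inside
      \<open>P\<close>. The inequality there forces \<open>?s < 0\<close> unless
      \<open>?g = 0\<close>, in which case \<open>?s \<ge> 0\<close> would make the whole normal
      zero.\<close>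
    define e where "e = \<epsilon> / (2 * (norm ?g + 1))"
    have e: "0 < e"
      using \<epsilon>(1) by (simp add: e_def add_nonneg_pos)
    have "norm (e *\<^sub>R ?g) = e * norm ?g"
      using e by simp
    also have "\<dots> = \<epsilon> * (norm ?g / (2 * (norm ?g + 1)))"
      by (simp add: e_def)
    also have "\<dots> < \<epsilon> * 1"
      using \<epsilon>(1) by (intro mult_strict_left_mono) (auto simp: divide_less_eq add_nonneg_pos)
    finally have "e *\<^sub>R ?g \<in> P"
      using \<epsilon>(2) subspace_scale[OF V gV] by simp
    then have 1: "e * (?g \<bullet> ?g) + ?s \<le> 0"
      using le by fastforce
    show ?thesis
    proof (rule ccontr)
      assume "\<not> ?s < 0"
      then have "e * (?g \<bullet> ?g) \<le> 0"
        using 1 by simp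
      then have "?g = 0"
        using e by (metis inner_gt_zero_iff mult_pos_pos not_le)
      then have "?s = 0"
        using 1 \<open>\<not> ?s < 0\<close> by simp
      then have "k i = 0"
        using \<open>?g = 0\<close> by (simp add: prod_eq_iff)
      then show False
        using K.h_nonzero[OF i] by simp
    qed
  qed
  define h where "h = (\<lambda>i. (1 / - snd (k i)) *\<^sub>R fst (k i))"
  have kh: "k i = (- snd (k i)) *\<^sub>R (h i, -1)" if "i \<in> I" for i
    using neg[OF that] by (simp add: h_def prod_eq_iff)
  have pos: "0 < - snd (k i)" if "i \<in> I" for i
    using neg[OF that] by simp
  have scale: "k i \<bullet> x = (- snd (k i)) * ((h i, -1) \<bullet> x)" if "i \<in> I" for i x
    using arg_cong[OF kh[OF that], of "\<lambda>v. v \<bullet> x"] unfolding inner_scaleR_left .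
  have zero_iff: "k i \<bullet> x = 0 \<longleftrightarrow> (h i, -1) \<bullet> x = 0" and le_iff: "k i \<bullet> x \<le> 0 \<longleftrightarrow> (h i, -1) \<bullet> x \<le> 0"
    if "i \<in> I" for i x
    unfolding scale[OF that] using pos[OF that] by (auto simp: mult_le_0_iff zero_le_mult_iff)
  have conf: "configuration I J R (\<lambda>i. (h i, -1 :: real)) (\<lambda>j. (w j, 1 :: real))"
    using K.le0 K.eq0_iff zero_iff le_iff by unfold_locales (auto simp: fin simp del: inner_Pair)
  have "cone_type_configuration I J R (\<lambda>i. (h i, -1 :: real)) (\<lambda>j. (w j, 1 :: real)) (V \<times> (UNIV :: real set))"
  proof (rule cone_type_configuration_of_lattice[OF conf K.subspace_W refl K.dim_pos K.w_in_W _ _ _ K.reduced])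
    show "(h i, -1) \<in> V \<times> UNIV" if "i \<in> I" for i
      using K.h_in_W[OF that] unfolding h_def by (auto simp: mem_Times_iff intro!: subspace_neg subspace_scale V)
  qed (use K.lattice_conditions in auto)
  then have "centered_configuration I J R h w V"
    using V by (simp add: centered_configuration_def centered_configuration_axioms_def)
  moreover have "F i = {x\<in>P. h i \<bullet> x = 1}" if i: "i \<in> I" for i
  proof -
    have "x \<in> F i \<longleftrightarrow> x \<in> P \<and> h i \<bullet> x = 1" for x
    proof -
      have "x \<in> F i \<longleftrightarrow> (x, 1) \<in> cone_over P \<and> (h i, -1) \<bullet> (x, 1::real) = 0"
        using cone_over_slice[of x "F i"] k(3)[OF i] zero_iff[OF i] by auto
      then show ?thesis
        by (simp add: cone_over_slice)
    qed
    then show ?thesis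
      by auto
  qed
  ultimately show thesis
    using polytope_vertices(1)[OF P] by (intro that) auto
qed

lemma polytope_lattice_conditions:
  assumes fin: "finite I" "finite J" and P: "polytope_of_type I J R P F w" and dimP: "aff_dim P = int d"
  shows "reduced_relation I J R" "condition_C (maxbiclique_lattice I J R)"
    "poset_rank (maxbiclique_lattice I J R) = d + 1" "diamond (maxbiclique_lattice I J R)"
proof -
  have dimP': "0 \<le> aff_dim P"
    using dimP by simp
  obtain k where "cone_type_configuration I J R k (\<lambda>j. (w j, 1)) (span (cone_over P))"
    by (rule polytope_configuration[OF fin P dimP']) (blast intro: that)
  then interpret cone_type_configuration I J R k "\<lambda>j. (w j, 1)" "span (cone_over P)" .
  have "dim (span (cone_over P)) = d + 1"
    using dim_span_cone_over[OF dimP'] dimP by linarith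
  then show "reduced_relation I J R" "condition_C L" "poset_rank L = d + 1" "diamond L"
    using lattice_conditions reduced by auto
qed

text \<open>Scaling gives every column the value \<open>s\<close> under \<open>?y\<close> and every
  row the value \<open>-1\<close> at \<open>?z\<close>. The new entries are the inner products of
  \<open>(1 / a i) *\<^sub>R h i + (1 / s) *\<^sub>R ?y\<close> with
  \<open>(1 / b j) *\<^sub>R w j\<close>; the second summand contributes the 1, and the left factors
  vanish at \<open>?z\<close>, which costs one dimension.\<close>

lemma (in cone_type_configuration) scaled_filled_matrix:
  obtains a b where "\<And>i. i \<in> I \<Longrightarrow> 0 < a i" "\<And>j. j \<in> J \<Longrightarrow> 0 < b j"
    "filled_incidence_matrix I J R 1 (\<lambda>i j. 1 + (h i \<bullet> w j) / (a i * b j))"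
    "matrix_rank I J (\<lambda>i j. 1 + (h i \<bullet> w j) / (a i * b j)) \<le> dim W - 1"
proof -
  let ?z = "Z (top_mb I J R)" and ?y = "H (bot_mb I J R)"
  define s where "s = ?y \<bullet> ?z"
  have hz: "h i \<bullet> ?z < 0" if i: "i \<in> I" for i
  proof -
    obtain j where "j \<in> J" "(i, j) \<notin> R"
      using ex_nonincident_column[OF i] .
    then have "\<not> snd (top_mb I J R) \<subseteq> snd (coatom i)"
      unfolding top_mb(2) coatom(3)[OF i] by blast
    then have "H (coatom i) \<bullet> ?z < 0"
      by (intro H_Z_neg top_mb(1) coatom(1)[OF i])
    then show ?thesis
      by (simp add: H_def coatom(2)[OF i])
  qed
  have yw: "?y \<bullet> w j < 0" if j: "j \<in> J" for j
  proof -
    obtain i where "i \<in> I" "(i, j) \<notin> R"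
      using ex_nonincident_row[OF j] .
    then have "j \<notin> snd (bot_mb I J R)"
      by (auto simp: bot_mb_def)
    then show ?thesis
      by (intro H_neg bot_mb(1) j)
  qed
  have s: "s < 0"
  proof -
    have "snd (top_mb I J R) \<noteq> snd (bot_mb I J R)"
      using maxbiclique_eqI[OF top_mb(1) bot_mb(1)] top_neq_bot by (rule contrapos_nn[rotated])
    then have "\<not> snd (top_mb I J R) \<subseteq> snd (bot_mb I J R)"
      using bot_le_snd[OF top_mb(1), of I J R] by (metis subset_antisym)
    then show ?thesis
      unfolding s_def by (intro H_Z_neg top_mb(1) bot_mb(1))
  qed
  \<comment> \<open>Row sums, column sums and their total \<open>s\<close> are all negative; the
    signs are arranged to make both scalings positive.\<close>
  define a where "a = (\<lambda>i. - (h i \<bullet> ?z))"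
  define b where "b = (\<lambda>j. (?y \<bullet> w j) / s)"
  have a: "0 < a i" if "i \<in> I" for i
    using hz[OF that] by (simp add: a_def)
  have b: "0 < b j" if "j \<in> J" for j
    using yw[OF that] s by (simp add: b_def divide_neg_neg)
  let ?M = "\<lambda>i j. 1 + (h i \<bullet> w j) / (a i * b j)"
  have filled: "filled_incidence_matrix I J R 1 ?M"
    unfolding filled_incidence_matrix_def
  proof (intro ballI)
    fix i j assume ij: "i \<in> I" "j \<in> J"
    then have ab: "0 < a i * b j"
      using a b by simp
    show "if (i, j) \<in> R then ?M i j = 1 else ?M i j < 1"
    proof (cases "(i, j) \<in> R")
      case True
      then show ?thesis
        using eq0_iff[OF ij] by simp
    next
      case False
      then have "h i \<bullet> w j < 0"
        using eq0_iff[OF ij] le0[OF ij] by simp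
      then show ?thesis
        using False ab by (simp add: divide_neg_pos)
    qed
  qed
  let ?T = "{x\<in>W. ?z \<bullet> x = 0}"
  have T: "subspace ?T"
    using subspace_W by (auto simp: subspace_def inner_add_right)
  have zW: "?z \<in> W"
    using Z_in_U[OF top_mb(1)] U_sub_W[OF top_mb(1)] by blast
  have yW: "?y \<in> W"
    unfolding H_def using h_in_W by (intro subspace_sum subspace_W) (simp add: bot_mb(2))
  have "?z \<noteq> 0"
    using s by (auto simp: s_def)
  then have "?z \<notin> ?T"
    by simp
  then have "?T \<subset> W"
    using zW by blast
  then have "span ?T \<subset> span W"
    unfolding T[folded span_eq_iff] subspace_W[folded span_eq_iff] .
  then have "dim ?T < dim W"
    by (rule dim_psubset)
  then have dT: "dim ?T \<le> dim W - 1"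
    by linarith
  have "matrix_rank I J ?M \<le> dim ?T"
  proof (rule rank_le_dim_rows[OF T])
    show "(1 / a i) *\<^sub>R h i + (1 / s) *\<^sub>R ?y \<in> ?T" if i: "i \<in> I" for i
    proof -
      have "?z \<bullet> ((1 / a i) *\<^sub>R h i + (1 / s) *\<^sub>R ?y) = (h i \<bullet> ?z) / a i + s / s"
        by (simp add: inner_add_right s_def inner_commute)
      also have "\<dots> = 0"
        using a[OF i] s by (simp add: a_def)
      finally show ?thesis
        using yW h_in_W[OF i] subspace_W by (auto intro!: subspace_add subspace_scale)
    qed
    show "?M i j = ((1 / a i) *\<^sub>R h i + (1 / s) *\<^sub>R ?y) \<bullet> ((1 / b j) *\<^sub>R w j)"
      if ij: "i \<in> I" "j \<in> J" for i j
    proof -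
      have "?y \<bullet> w j = b j * s"
        using s by (simp add: b_def)
      then show ?thesis
        using a[OF ij(1)] b[OF ij(2)] s by (simp add: inner_add_left field_simps)
    qed
  qed
  then show thesis
    using that[of a b] a b filled dT by simp
qed

lemma filled_shift:
  "filled_incidence_matrix I J R 1 M \<Longrightarrow> filled_incidence_matrix I J R 0 (\<lambda>i j. M i j - 1)"
  unfolding filled_incidence_matrix_def by (auto split: if_splits)

section \<open>Matrices and configurations over a fixed lattice\<close>

locale polytopal_lattice =
  fixes I :: "'i set" and J :: "'j set" and R :: "('i \<times> 'j) set" and V :: "'a::euclidean_space set"
  assumes finite_IJ: "finite I" "finite J" and sV: "subspace V"
    and red: "reduced_relation I J R" and dia: "diamond (maxbiclique_lattice I J R)"
    and rk: "poset_rank (maxbiclique_lattice I J R) = dim V + 1"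
begin

abbreviation W :: "('a \<times> real) set" where "W \<equiv> V \<times> UNIV"

lemma W: "subspace W" "dim W = dim V + 1"
  using sV by (auto intro: subspace_Times simp: dim_Times)

lemma rank_filled0_ge: "filled_incidence_matrix I J R 0 N \<Longrightarrow> dim V + 1 \<le> matrix_rank I J N"
  using dia rk by (intro rank_ge_poset_rank[OF finite_IJ W]) (auto simp: diamond_def)

text \<open>Subtracting 1 from all entries gives a filled 0-incidence matrix, of rank at least
  \<open>dim V + 1\<close>, and raises the rank by at most one.\<close>

lemma rank_filled1_ge:
  assumes "filled_incidence_matrix I J R 1 M" "matrix_rank I J M \<le> dim V"
  shows "matrix_rank I J M = dim V"
  using rank_filled0_ge[OF filled_shift[OF assms(1)]]
    rank_add_constant[OF finite_IJ(1) sV assms(2), of "- 1"] assms(2) by simp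

lemma cone_configuration_of_matrix:
  assumes N: "filled_incidence_matrix I J R 0 N" "matrix_rank I J N = dim V + 1"
  obtains h w where "cone_type_configuration I J R h w W" "\<And>i j. i \<in> I \<Longrightarrow> j \<in> J \<Longrightarrow> N i j = h i \<bullet> w j"
proof -
  obtain h w where hw: "\<And>i. h i \<in> W" "\<And>j. w j \<in> W" "\<And>i j. i \<in> I \<Longrightarrow> j \<in> J \<Longrightarrow> N i j = h i \<bullet> w j"
    using rank_factorization[OF finite_IJ(1) W(1), of J N] N(2) W(2) by auto
  have "configuration I J R h w"
    by (rule filled_configuration[OF finite_IJ N(1) hw(3)])
  then have "cone_type_configuration I J R h w W"
    using hw W rk by (intro cone_type_configuration_of_lattice[OF _ _ _ _ _ _ dia rk red]) auto
  then show thesis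
    using hw(3) by (rule that)
qed

lemma centered_configuration_of_matrix:
  assumes M: "filled_incidence_matrix I J R 1 M" "matrix_rank I J M \<le> dim V"
  obtains h w where "centered_configuration I J R h w V" "\<And>i j. i \<in> I \<Longrightarrow> j \<in> J \<Longrightarrow> M i j = h i \<bullet> w j"
proof -
  obtain h w where hw: "\<And>i. h i \<in> V" "\<And>j. w j \<in> V" "\<And>i j. i \<in> I \<Longrightarrow> j \<in> J \<Longrightarrow> M i j = h i \<bullet> w j"
    using rank_factorization[OF finite_IJ(1) sV, of J M] M(2) by auto
  have "centered_configuration I J R h w V"
    by (rule centered_configuration_of_lattice[OF finite_IJ sV hw(1,2) M(1) hw(3) dia rk red])
  then show thesis
    using hw(3) by (rule that)
qed

text \<open>Up to positive scaling of rows and columns, every such \<open>N\<close> is the shifted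
  matrix of a centered polytope; so each type of cone considered here is a cone over a polytope in
  \<open>V\<close>.\<close>

lemma scaled_centered_configuration:
  assumes N: "filled_incidence_matrix I J R 0 N" "matrix_rank I J N = dim V + 1"
  obtains h w a b where "centered_configuration I J R h w V"
    "\<And>i. i \<in> I \<Longrightarrow> 0 < a i" "\<And>j. j \<in> J \<Longrightarrow> 0 < b j"
    "\<And>i j. i \<in> I \<Longrightarrow> j \<in> J \<Longrightarrow> N i j = a i * (h i \<bullet> w j - 1) * b j"
    "filled_incidence_matrix I J R 1 (\<lambda>i j. h i \<bullet> w j)"
proof -
  obtain k u where ku: "cone_type_configuration I J R k u W" "\<And>i j. i \<in> I \<Longrightarrow> j \<in> J \<Longrightarrow> N i j = k i \<bullet> u j"
    by (rule cone_configuration_of_matrix[OF N]) (blast intro: that)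
  interpret K: cone_type_configuration I J R k u W
    using ku(1) .
  obtain a b where ab: "\<And>i. i \<in> I \<Longrightarrow> 0 < a i" "\<And>j. j \<in> J \<Longrightarrow> 0 < b j"
    and M: "filled_incidence_matrix I J R 1 (\<lambda>i j. 1 + (k i \<bullet> u j) / (a i * b j))"
      "matrix_rank I J (\<lambda>i j. 1 + (k i \<bullet> u j) / (a i * b j)) \<le> dim W - 1"
    by (rule K.scaled_filled_matrix) (blast intro: that)
  obtain h w where hw: "centered_configuration I J R h w V"
    "\<And>i j. i \<in> I \<Longrightarrow> j \<in> J \<Longrightarrow> 1 + (k i \<bullet> u j) / (a i * b j) = h i \<bullet> w j"
    using centered_configuration_of_matrix[OF M(1)] M(2) W(2) by auto
  show thesis
  proof (rule that)
    show "N i j = a i * (h i \<bullet> w j - 1) * b j" if "i \<in> I" "j \<in> J" for i j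
      using ku(2)[OF that] ab(1)[OF that(1)] ab(2)[OF that(2)] hw(2)[OF that, symmetric]
      by (simp add: field_simps)
    show "filled_incidence_matrix I J R 1 (\<lambda>i j. h i \<bullet> w j)"
      using M(1) unfolding filled_incidence_matrix_def by (metis hw(2))
  qed (fact hw(1) ab)+
qed

end

lemma ray_scale:
  fixes v :: "'v::euclidean_space"
  assumes "0 < t"
  shows "ray (t *\<^sub>R v) = ray v"
proof (intro equalityI subsetI)
  fix x assume "x \<in> ray (t *\<^sub>R v)"
  then obtain s where "0 \<le> s" "x = (s * t) *\<^sub>R v"
    by (auto simp: ray_def)
  then show "x \<in> ray v"
    using assms unfolding ray_def by (intro CollectI exI[of _ "s * t"]) auto
next
  fix x assume "x \<in> ray v"
  then obtain s where "0 \<le> s" "x = s *\<^sub>R v"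
    by (auto simp: ray_def)
  then show "x \<in> ray (t *\<^sub>R v)"
    using assms unfolding ray_def by (intro CollectI exI[of _ "s / t"]) auto
qed

lemma (in centered_configuration) polytope_cone_matrix_P:
  assumes a: "\<And>i. i \<in> I \<Longrightarrow> 0 < a i" and b: "\<And>j. j \<in> J \<Longrightarrow> 0 < b j"
    and N: "\<And>i j. i \<in> I \<Longrightarrow> j \<in> J \<Longrightarrow> N i j = a i * (h i \<bullet> w j - 1) * b j"
  shows "polytope_cone_matrix V I J R N (P, F, w)"
  unfolding polytope_cone_matrix_def prod.case
proof (intro conjI)
  show "full_dim_in (V \<times> UNIV) (cone_over P)"
    using full_dim_C unfolding C_eq .
  show "cone_of_type I J R (cone_over P) (\<lambda>i. cone_over (F i)) (\<lambda>j. cone_over {w j})"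
    by (rule cone_of_type_P)
  let ?h = "\<lambda>i. a i *\<^sub>R (h i, -1 :: real)" and ?w = "\<lambda>j. b j *\<^sub>R (w j, 1 :: real)"
  show "facet_ray_matrix (V \<times> UNIV) I J (cone_over P) (\<lambda>i. cone_over (F i)) (\<lambda>j. cone_over {w j}) N"
    unfolding facet_ray_matrix_def
  proof (intro exI[of _ ?h] exI[of _ ?w] conjI ballI)
    have "bij_betw (\<lambda>i. ray (h i, -1 :: real)) I (rays (polar_cone (V \<times> UNIV) (cone_over P)))"
      using inj_rays_h rays_polar unfolding C_eq by (simp add: bij_betw_def)
    moreover have "ray (?h i) = ray (h i, -1 :: real)" if "i \<in> I" for i
      using a[OF that] by (rule ray_scale)
    ultimately show "bij_betw (\<lambda>i. ray (?h i)) I (rays (polar_cone (V \<times> UNIV) (cone_over P)))"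
      by (simp cong: bij_betw_cong del: scaleR_Pair)
    show "cone_over (F i) = {x\<in>cone_over P. ?h i \<bullet> x = 0}" if "i \<in> I" for i
      unfolding cone_over_F C_eq inner_scaleR_left using a[OF that] by simp
    show "cone_over {w j} = ray (?w j)" if "j \<in> J" for j
      unfolding cone_over_singleton ray_scale[OF b[OF that]] ..
    show "N i j = ?h i \<bullet> ?w j" if "i \<in> I" "j \<in> J" for i j
      using N[OF that] by (simp add: algebra_simps)
  qed
qed

lemma facet_vertex_matrixE:
  assumes "facet_vertex_matrix V I J P F w M"
  obtains h where "\<And>i. i \<in> I \<Longrightarrow> h i \<in> V" "\<And>i x. i \<in> I \<Longrightarrow> x \<in> P \<Longrightarrow> h i \<bullet> x \<le> 1"
    "\<And>i. i \<in> I \<Longrightarrow> F i = {x\<in>P. h i \<bullet> x = 1}" "\<And>i j. i \<in> I \<Longrightarrow> j \<in> J \<Longrightarrow> M i j = h i \<bullet> w j"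
proof -
  obtain h where h: "bij_betw h I (vertices (polar V P))" "\<forall>i\<in>I. F i = {x \<in> P. h i \<bullet> x = 1}"
    "\<forall>i\<in>I. \<forall>j\<in>J. M i j = h i \<bullet> w j"
    using assms unfolding facet_vertex_matrix_def by blast
  have "h i \<in> polar V P" if "i \<in> I" for i
    using bij_betwE[OF h(1)] that by (auto simp: vertices_def extreme_point_of_def)
  then show thesis
    using h by (intro that[of h]) (auto simp: polar_def)
qed

lemma facet_ray_matrixE:
  assumes "facet_ray_matrix W I J C F r N"
  obtains h w where "\<And>i. i \<in> I \<Longrightarrow> h i \<in> W" "\<And>i x. i \<in> I \<Longrightarrow> x \<in> C \<Longrightarrow> h i \<bullet> x \<le> 0"
    "\<And>i. i \<in> I \<Longrightarrow> F i = {x\<in>C. h i \<bullet> x = 0}" "\<And>j. j \<in> J \<Longrightarrow> r j = ray (w j)"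
    "\<And>i j. i \<in> I \<Longrightarrow> j \<in> J \<Longrightarrow> N i j = h i \<bullet> w j"
proof -
  obtain h w where h: "bij_betw (\<lambda>i. ray (h i)) I (rays (polar_cone W C))"
    "\<forall>i\<in>I. F i = {x \<in> C. h i \<bullet> x = 0}" "\<forall>j\<in>J. r j = ray (w j)" "\<forall>i\<in>I. \<forall>j\<in>J. N i j = h i \<bullet> w j"
    using assms unfolding facet_ray_matrix_def by blast
  have "h i \<in> polar_cone W C" if "i \<in> I" for i
  proof -
    have "ray (h i) \<in> rays (polar_cone W C)"
      using bij_betwE[OF h(1)] that by blast
    then have "ray (h i) \<subseteq> polar_cone W C"
      by (simp add: rays_def edge_of_imp_subset)
    then show ?thesis
      using ray_base by blast
  qed
  then show thesis
    using h by (intro that[of h w]) (auto simp: polar_cone_def)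
qed

lemma facet_ray_matrix_filled:
  assumes C: "cone_of_type I J R C F r" and N: "facet_ray_matrix W I J C F r N" and W: "subspace W"
  shows "filled_incidence_matrix I J R 0 N" "matrix_rank I J N \<le> dim W"
proof -
  obtain h w where hw: "\<And>i. i \<in> I \<Longrightarrow> h i \<in> W" "\<And>i x. i \<in> I \<Longrightarrow> x \<in> C \<Longrightarrow> h i \<bullet> x \<le> 0"
    "\<And>i. i \<in> I \<Longrightarrow> F i = {x\<in>C. h i \<bullet> x = 0}" "\<And>j. j \<in> J \<Longrightarrow> r j = ray (w j)"
    "\<And>i j. i \<in> I \<Longrightarrow> j \<in> J \<Longrightarrow> N i j = h i \<bullet> w j"
    by (rule facet_ray_matrixE[OF N]) (blast intro: that)
  show "matrix_rank I J N \<le> dim W"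
    using hw(1,5) by (rule rank_le_dim_rows[OF W])
  show "filled_incidence_matrix I J R 0 N"
    unfolding filled_incidence_matrix_def
  proof (intro ballI)
    fix i j assume ij: "i \<in> I" "j \<in> J"
    have "r j \<in> rays C"
      using C ij bij_betwE unfolding cone_of_type_def by blast
    then have rC: "ray (w j) \<subseteq> C"
      using hw(4)[OF ij(2)] edge_of_imp_subset by (auto simp: rays_def)
    then have wC: "w j \<in> C"
      using ray_base by blast
    have "(i, j) \<in> R \<longleftrightarrow> ray (w j) \<subseteq> F i"
      using C ij hw(4) by (simp add: cone_of_type_def)
    also have "\<dots> \<longleftrightarrow> h i \<bullet> w j = 0"
      unfolding hw(3)[OF ij(1)] using rC ray_base[of "w j"] by (auto simp: ray_def)
    finally show "if (i, j) \<in> R then N i j = 0 else N i j < 0"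
      using hw(2)[OF ij(1) wC] hw(5)[OF ij] by auto
  qed
qed

lemma facet_vertex_matrix_filled:
  assumes P: "polytope_of_type I J R P F w" and sub: "P \<subseteq> V"
    and M: "facet_vertex_matrix V I J P F w M" and V: "subspace V"
  shows "filled_incidence_matrix I J R 1 M" "matrix_rank I J M \<le> dim V"
proof -
  obtain h where h: "\<And>i. i \<in> I \<Longrightarrow> h i \<in> V" "\<And>i x. i \<in> I \<Longrightarrow> x \<in> P \<Longrightarrow> h i \<bullet> x \<le> 1"
    "\<And>i. i \<in> I \<Longrightarrow> F i = {x\<in>P. h i \<bullet> x = 1}" "\<And>i j. i \<in> I \<Longrightarrow> j \<in> J \<Longrightarrow> M i j = h i \<bullet> w j"
    by (rule facet_vertex_matrixE[OF M]) (blast intro: that)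
  show "matrix_rank I J M \<le> dim V"
    using h(1,4) by (rule rank_le_dim_rows[OF V])
  note v = polytope_vertices[OF P]
  show "filled_incidence_matrix I J R 1 M"
    unfolding filled_incidence_matrix_def
  proof (intro ballI)
    fix i j assume ij: "i \<in> I" "j \<in> J"
    have "w j \<in> P"
      unfolding v(1) using ij by (intro hull_inc) auto
    then show "if (i, j) \<in> R then M i j = 1 else M i j < 1"
      using v(7)[OF ij] h(2)[OF ij(1)] h(3)[OF ij(1)] h(4)[OF ij] by (auto simp: less_le)
  qed
qed

section \<open>Linear and projective equivalence\<close>

text \<open>From matrices to maps this is the uniqueness of full-rank factorizations. Conversely, a
  facet lies on \<open>h i = 1\<close>, off the origin, and therefore spans \<open>V\<close>; on it
  \<open>h' i\<close> after \<open>A\<close> agrees with \<open>h i\<close>, hence on all of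
  \<open>V\<close>.\<close>

lemma linearly_equivalent_iff:
  fixes V :: "'a::euclidean_space set"
  assumes V: "subspace V"
    and P: "polytope_of_type I J R P F w" "full_dim_in V P" "facet_vertex_matrix V I J P F w M"
    and P': "polytope_of_type I J R P' F' w'" "full_dim_in V P'" "facet_vertex_matrix V I J P' F' w' M'"
    and rk: "matrix_rank I J M = dim V" "matrix_rank I J M' = dim V"
  shows "matrix_eq_on I J M M' \<longleftrightarrow> linearly_equivalent V I J (P, F, w) (P', F', w')"
proof -
  obtain h where h: "\<And>i. i \<in> I \<Longrightarrow> h i \<in> V" "\<And>i. i \<in> I \<Longrightarrow> F i = {x\<in>P. h i \<bullet> x = 1}"
    "\<And>i j. i \<in> I \<Longrightarrow> j \<in> J \<Longrightarrow> M i j = h i \<bullet> w j"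
    by (rule facet_vertex_matrixE[OF P(3)]) (blast intro: that)
  obtain h' where h': "\<And>i. i \<in> I \<Longrightarrow> h' i \<in> V" "\<And>i. i \<in> I \<Longrightarrow> F' i = {x\<in>P'. h' i \<bullet> x = 1}"
    "\<And>i j. i \<in> I \<Longrightarrow> j \<in> J \<Longrightarrow> M' i j = h' i \<bullet> w' j"
    by (rule facet_vertex_matrixE[OF P'(3)]) (blast intro: that)
  note v = polytope_vertices[OF P(1)] and v' = polytope_vertices[OF P'(1)]
  have PV: "P \<subseteq> V" "P' \<subseteq> V"
    using P(2) P'(2) by (auto simp: full_dim_in_def)
  have wP: "w j \<in> P" if "j \<in> J" for j
    unfolding v(1) using that by (intro hull_inc) auto
  have wV: "w j \<in> V" if "j \<in> J" for j
    using wP[OF that] PV by blast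
  have wV': "w' j \<in> V" if "j \<in> J" for j
    using PV(2) that hull_inc[of "w' j" "w' ` J" convex] unfolding v'(1) by blast
  show ?thesis
  proof
    assume eq: "matrix_eq_on I J M M'"
    have rk': "dim V \<le> matrix_rank I J M" "dim V \<le> matrix_rank I J M'"
      unfolding rk by simp_all
    have "span (w ` J) = V"
      by (rule span_columns_of_factorization[OF V _ _ rk'(1)]) (erule wV, erule (1) h(3))
    moreover have "span (w' ` J) = V"
      by (rule span_columns_of_factorization[OF V _ _ rk'(2)]) (erule wV', erule (1) h'(3))
    moreover have "span (h ` I) = V"
      by (rule span_rows_of_factorization[OF V _ _ rk'(1)]) (erule h(1), erule (1) h(3))
    moreover have "span (h' ` I) = V"
      by (rule span_rows_of_factorization[OF V _ _ rk'(2)]) (erule h'(1), erule (1) h'(3))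
    moreover have "h i \<bullet> w j = h' i \<bullet> w' j" if "i \<in> I" "j \<in> J" for i j
      using eq that h(3)[OF that] h'(3)[OF that] by (simp add: matrix_eq_on_def)
    ultimately obtain A where A: "linear A" "bij_betw A V V" "\<And>j. j \<in> J \<Longrightarrow> A (w j) = w' j"
      "\<And>i x. i \<in> I \<Longrightarrow> x \<in> V \<Longrightarrow> h' i \<bullet> A x = h i \<bullet> x"
      using linear_map_of_factorizations[OF V, of w J w' h I h'] by blast
    have AP: "A ` P = P'"
    proof -
      have "A ` w ` J = w' ` J"
        using A(3) by (force simp: image_image)
      then show ?thesis
        unfolding v(1) v'(1) convex_hull_linear_image[OF A(1)] by simp
    qed
    have "A ` F i = F' i" if i: "i \<in> I" for i
    proof -
      have "h' i \<bullet> A x = 1 \<longleftrightarrow> h i \<bullet> x = 1" if "x \<in> P" for x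
        using A(4)[OF i] PV(1) that by auto
      then show ?thesis
        unfolding h(2)[OF i] h'(2)[OF i] AP[symmetric] by auto
    qed
    then show "linearly_equivalent V I J (P, F, w) (P', F', w')"
      unfolding linearly_equivalent_def prod.case using A AP by blast
  next
    assume "linearly_equivalent V I J (P, F, w) (P', F', w')"
    then obtain A where A: "linear A" "A ` P = P'" "\<And>i. i \<in> I \<Longrightarrow> A ` F i = F' i" "\<And>j. j \<in> J \<Longrightarrow> A (w j) = w' j"
      unfolding linearly_equivalent_def by auto
    show "matrix_eq_on I J M M'"
      unfolding matrix_eq_on_def
    proof (intro ballI)
      fix i j assume ij: "i \<in> I" "j \<in> J"
      have FV: "F i \<subseteq> V"
        using h(2)[OF ij(1)] PV by auto
      have "aff_dim (F i) = aff_dim P - 1"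
        using v(3) ij(1) by (auto simp: facets_def)
      then have dF: "aff_dim (F i) = int (dim V) - 1"
        using P(2) by (simp add: full_dim_in_def)
      have "affine hull F i \<subseteq> {x. h i \<bullet> x = 1}"
        using h(2)[OF ij(1)] by (intro hull_minimal) (auto simp: affine_hyperplane)
      then have "0 \<notin> affine hull F i"
        by auto
      then have "aff_dim (insert 0 (F i)) = int (dim V)"
        by (simp add: aff_dim_insert dF)
      moreover have "aff_dim (insert 0 (F i)) = int (dim (insert 0 (F i)))"
        by (intro aff_dim_zero hull_inc) simp
      moreover have "dim (insert 0 (F i)) = dim (span (F i))"
        by (metis dim_span span_insert_0)
      ultimately have "dim V = dim (span (F i))"
        by simp
      then have spanF: "span (F i) = V"
        using FV V by (intro subspace_dim_equal span_minimal) auto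
      have "h' i \<bullet> A x = h i \<bullet> x" if "x \<in> span (F i)" for x
        using that
      proof (induction rule: span_induct_alt)
        case base
        then show ?case
          by (simp add: linear_0[OF A(1)])
      next
        case (step c x y)
        have "A x \<in> F' i"
          using A(3)[OF ij(1)] step(1) by blast
        then have "h' i \<bullet> A x = h i \<bullet> x"
          using h(2)[OF ij(1)] h'(2)[OF ij(1)] step(1) by auto
        then show ?case
          using step by (simp add: linear_add[OF A(1)] linear_scale[OF A(1)] inner_add_right)
      qed
      then have "h' i \<bullet> A (w j) = h i \<bullet> w j"
        using wV[OF ij(2)] spanF by auto
      then show "M' i j = M i j"
        using h(3)[OF ij] h'(3)[OF ij] A(4)[OF ij(2)] by simp
    qed
  qed
qed

text \<open>The height of \<open>g (x, 1)\<close> is the denominator of the projective map. It is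
  positive because the image is a nonzero point of a cone over a set, and normalizing it to 1 gives
  the map of slices.\<close>

lemma projective_map_cone_over:
  assumes g: "linear g" and im: "g ` cone_over A = cone_over A'" and nz: "\<And>x. x \<in> A \<Longrightarrow> g (x, 1) \<noteq> 0"
  shows "projective_map g ` A = A'" and "\<And>x. x \<in> A \<Longrightarrow> 0 < snd (g (x, 1))"
proof -
  have *: "0 < snd (g (x, 1)) \<and> projective_map g x \<in> A'" if x: "x \<in> A" for x
  proof -
    have "g (x, 1) \<in> cone_over A'"
      using im cone_over_base[OF x] by blast
    then obtain t y where ty: "0 < t" "y \<in> A'" "g (x, 1) = t *\<^sub>R (y, 1)"
      using nz[OF x] unfolding cone_over_iff by metis
    then show ?thesis
      by (simp add: projective_map_def)
  qed
  then show "0 < snd (g (x, 1))" if "x \<in> A" for x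
    using that by blast
  have "y \<in> projective_map g ` A" if y: "y \<in> A'" for y
  proof -
    have "(y, 1) \<in> g ` cone_over A"
      unfolding im using y by (rule cone_over_base)
    then obtain p where p: "p \<in> cone_over A" "(y, 1) = g p"
      by blast
    have "p \<noteq> 0"
    proof
      assume "p = 0"
      then show False
        using p(2) linear_0[OF g] by (simp add: zero_prod_def)
    qed
    then obtain t x where tx: "0 < t" "x \<in> A" "p = t *\<^sub>R (x, 1)"
      using p(1) unfolding cone_over_iff by metis
    then have "(y, 1) = t *\<^sub>R g (x, 1)"
      using p(2) linear_scale[OF g, of t "(x, 1)"] by simp
    then have "y = t *\<^sub>R fst (g (x, 1))" "1 = t * snd (g (x, 1))"
      by (simp_all add: prod_eq_iff)
    moreover from this(2) have "t = inverse (snd (g (x, 1)))"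
      using tx(1) by (metis inverse_unique mult.commute)
    ultimately have "y = projective_map g x"
      by (simp add: projective_map_def)
    then show ?thesis
      using tx(2) by blast
  qed
  then show "projective_map g ` A = A'"
    using * by blast
qed

lemma cone_over_projective_map:
  assumes g: "linear g" and im: "projective_map g ` A = A'" and pos: "\<And>x. x \<in> A \<Longrightarrow> 0 < snd (g (x, 1))"
  shows "g ` cone_over A = cone_over A'"
proof -
  have gx: "g (x, 1) = snd (g (x, 1)) *\<^sub>R (projective_map g x, 1)" if "x \<in> A" for x
    using pos[OF that] by (simp add: projective_map_def prod_eq_iff)
  show ?thesis
  proof (intro equalityI subsetI)
    fix q assume "q \<in> g ` cone_over A"
    then obtain p where p: "p \<in> cone_over A" "q = g p"
      by blast
    show "q \<in> cone_over A'"
    proof (cases "p = 0")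
      case True
      then show ?thesis
        using p(2) linear_0[OF g] by simp
    next
      case False
      then obtain t x where tx: "0 < t" "x \<in> A" "p = t *\<^sub>R (x, 1)"
        using p(1) unfolding cone_over_iff by metis
      have "q = t *\<^sub>R g (x, 1)"
        unfolding p(2) tx(3) by (rule linear_scale[OF g])
      also have "\<dots> = (t * snd (g (x, 1))) *\<^sub>R (projective_map g x, 1)"
        by (subst gx[OF tx(2)]) simp
      also have "\<dots> \<in> cone_over A'"
        using im tx pos[OF tx(2)] by (intro cone_overI) auto
      finally show ?thesis .
    qed
  next
    fix q assume q: "q \<in> cone_over A'"
    show "q \<in> g ` cone_over A"
    proof (cases "q = 0")
      case True
      then show ?thesis
        using linear_0[OF g] by (metis image_eqI zero_in_cone_over)
    next
      case False
      then obtain t y where ty: "0 < t" "y \<in> A'" "q = t *\<^sub>R (y, 1)"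
        using q unfolding cone_over_iff by metis
      then obtain x where x: "x \<in> A" "y = projective_map g x"
        using im by blast
      let ?s = "snd (g (x, 1))"
      have "(t / ?s) *\<^sub>R (x, 1) \<in> cone_over A"
        using ty(1) pos[OF x(1)] x(1) by (intro cone_overI) auto
      moreover have "g ((t / ?s) *\<^sub>R (x, 1)) = q"
      proof -
        have "g ((t / ?s) *\<^sub>R (x, 1)) = (t / ?s) *\<^sub>R g (x, 1)"
          by (rule linear_scale[OF g])
        also have "\<dots> = (t / ?s) *\<^sub>R ?s *\<^sub>R (y, 1)"
          using gx[OF x(1)] x(2) by simp
        also have "\<dots> = q"
          using pos[OF x(1)] by (simp add: ty(3))
        finally show ?thesis .
      qed
      ultimately show ?thesis
        by (metis image_eqI)
    qed
  qed
qed

lemma image_gcone: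
  assumes "linear g"
  shows "g ` gcone w B = gcone (\<lambda>j. g (w j)) B"
proof -
  have "g (\<Sum>j\<in>B. c j *\<^sub>R w j) = (\<Sum>j\<in>B. c j *\<^sub>R g (w j))" for c
    by (simp add: linear_sum[OF assms] linear_scale[OF assms])
  then show ?thesis
    unfolding gcone_def by (auto simp: image_iff) metis+
qed

lemma image_ray:
  assumes "linear g"
  shows "g ` ray v = ray (g v)"
  using image_gcone[OF assms, of "\<lambda>_. v" "{()}"] ray_eq_gcone[of "\<lambda>_. v" "()"] ray_eq_gcone[of "\<lambda>_. g v" "()"]
  by simp

text \<open>The denominator is affine in \<open>x\<close>, so a change of sign on a convex set would
  produce a zero on a segment.\<close>

lemma nonzero_affine_sign:
  fixes g :: "'a::real_vector \<times> real \<Rightarrow> 'b::real_vector \<times> real"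
  assumes g: "linear g" and P: "convex P" and nz: "\<And>x. x \<in> P \<Longrightarrow> snd (g (x, 1)) \<noteq> 0"
    and x: "x \<in> P" and y: "y \<in> P" and pos: "0 < snd (g (x, 1))"
  shows "0 < snd (g (y, 1))"
proof (rule ccontr)
  let ?f = "\<lambda>x. snd (g (x, 1))"
  assume "\<not> 0 < ?f y"
  then have neg: "?f y < 0"
    using nz[OF y] by simp
  define t where "t = ?f x / (?f x - ?f y)"
  have t: "0 \<le> t" "t \<le> 1" "1 - t = - ?f y / (?f x - ?f y)"
    using pos neg by (auto simp: t_def field_simps)
  let ?z = "(1 - t) *\<^sub>R x + t *\<^sub>R y"
  have "?z \<in> P"
    using P x y t by (intro convexD) auto
  moreover have "(?z, 1) = (1 - t) *\<^sub>R (x, 1) + t *\<^sub>R (y, 1 :: real)"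
    by simp
  then have "?f ?z = (1 - t) * ?f x + t * ?f y"
    using linear_add[OF g] linear_scale[OF g] by (metis snd_add snd_scaleR real_scaleR_def)
  moreover have "\<dots> = 0"
    unfolding t(3) using pos neg by (simp add: t_def field_simps)
  ultimately show False
    using nz by metis
qed

text \<open>The scalings are absorbed into the factors of \<open>N\<close>, after which the
  uniqueness of full-rank factorizations gives a linear automorphism that relates the cones.
  Conversely, a linear map between the cones matches normals and generators up to positive
  multiples, which are the scalings.\<close>

lemma projectively_equivalent_iff:
  fixes V :: "'a::euclidean_space set"
  assumes V: "subspace V" and fin: "finite I" "finite J"
    and P: "polytope_of_type I J R P F w" "full_dim_in V P" "polytope_cone_matrix V I J R N (P, F, w)"
    and P': "polytope_of_type I J R P' F' w'" "full_dim_in V P'" "polytope_cone_matrix V I J R N' (P', F', w')"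
    and rk: "matrix_rank I J N = dim V + 1" "matrix_rank I J N' = dim V + 1"
  shows "scaling_equiv I J N N' \<longleftrightarrow> projectively_equivalent V I J (P, F, w) (P', F', w')"
proof -
  let ?W = "V \<times> (UNIV :: real set)"
  have W: "subspace ?W" "dim ?W = dim V + 1"
    using V by (auto intro: subspace_Times simp: dim_Times)
  have cone: "cone_of_type I J R (cone_over P) (\<lambda>i. cone_over (F i)) (\<lambda>j. cone_over {w j})"
    "facet_ray_matrix ?W I J (cone_over P) (\<lambda>i. cone_over (F i)) (\<lambda>j. cone_over {w j}) N"
    and sub: "cone_over P \<subseteq> ?W"
    using P(3) by (auto simp: polytope_cone_matrix_def full_dim_in_def)
  have cone': "cone_of_type I J R (cone_over P') (\<lambda>i. cone_over (F' i)) (\<lambda>j. cone_over {w' j})"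
    "facet_ray_matrix ?W I J (cone_over P') (\<lambda>i. cone_over (F' i)) (\<lambda>j. cone_over {w' j}) N'"
    and sub': "cone_over P' \<subseteq> ?W"
    using P'(3) by (auto simp: polytope_cone_matrix_def full_dim_in_def)
  obtain h u where hu: "\<And>i. i \<in> I \<Longrightarrow> h i \<in> ?W" "\<And>i x. i \<in> I \<Longrightarrow> x \<in> cone_over P \<Longrightarrow> h i \<bullet> x \<le> 0"
    "\<And>i. i \<in> I \<Longrightarrow> cone_over (F i) = {x\<in>cone_over P. h i \<bullet> x = 0}" "\<And>j. j \<in> J \<Longrightarrow> cone_over {w j} = ray (u j)"
    "\<And>i j. i \<in> I \<Longrightarrow> j \<in> J \<Longrightarrow> N i j = h i \<bullet> u j"
    by (rule facet_ray_matrixE[OF cone(2)]) (blast intro: that)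
  obtain h' u' where hu': "\<And>i. i \<in> I \<Longrightarrow> h' i \<in> ?W" "\<And>i x. i \<in> I \<Longrightarrow> x \<in> cone_over P' \<Longrightarrow> h' i \<bullet> x \<le> 0"
    "\<And>i. i \<in> I \<Longrightarrow> cone_over (F' i) = {x\<in>cone_over P'. h' i \<bullet> x = 0}" "\<And>j. j \<in> J \<Longrightarrow> cone_over {w' j} = ray (u' j)"
    "\<And>i j. i \<in> I \<Longrightarrow> j \<in> J \<Longrightarrow> N' i j = h' i \<bullet> u' j"
    by (rule facet_ray_matrixE[OF cone'(2)]) (blast intro: that)
  note v = polytope_vertices[OF P(1)] and v' = polytope_vertices[OF P'(1)]
  have w1: "(w j, 1 :: real) \<noteq> 0" "(w' j, 1 :: real) \<noteq> 0" for j
    by (auto simp: zero_prod_def)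
  have "\<exists>t. 0 < t \<and> u j = t *\<^sub>R (w j, 1)" if "j \<in> J" for j
    using hu(4)[OF that, symmetric] ray_eqD[OF _ w1(1)] unfolding cone_over_singleton by metis
  then obtain b0 where b0: "\<And>j. j \<in> J \<Longrightarrow> 0 < b0 j" "\<And>j. j \<in> J \<Longrightarrow> u j = b0 j *\<^sub>R (w j, 1)"
    by metis
  have "\<exists>t. 0 < t \<and> u' j = t *\<^sub>R (w' j, 1)" if "j \<in> J" for j
    using hu'(4)[OF that, symmetric] ray_eqD[OF _ w1(2)] unfolding cone_over_singleton by metis
  then obtain b0' where b0': "\<And>j. j \<in> J \<Longrightarrow> 0 < b0' j" "\<And>j. j \<in> J \<Longrightarrow> u' j = b0' j *\<^sub>R (w' j, 1)"
    by metis
  have wP: "w j \<in> P" if "j \<in> J" for j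
    unfolding v(1) using that by (intro hull_inc) auto
  have uC: "u j \<in> cone_over P" if "j \<in> J" for j
    using b0[OF that] wP[OF that] by (metis cone_overI less_imp_le)
  have wP': "w' j \<in> P'" if "j \<in> J" for j
    unfolding v'(1) using that by (intro hull_inc) auto
  have uC': "u' j \<in> cone_over P'" if "j \<in> J" for j
    using b0'[OF that] wP'[OF that] by (metis cone_overI less_imp_le)
  have uW: "u j \<in> ?W" "u' j \<in> ?W" if "j \<in> J" for j
    using uC[OF that] uC'[OF that] sub sub' by auto
  have FP: "F i \<subseteq> P" if "i \<in> I" for i
    using v(3) that by (auto simp: facets_def dest: face_of_imp_subset)
  have gen: "gcone u J = cone_over P" "gcone u' J = cone_over P'"
  proof -
    have "gcone u J = gcone (\<lambda>j. b0 j *\<^sub>R (w j, 1)) J" "gcone u' J = gcone (\<lambda>j. b0' j *\<^sub>R (w' j, 1)) J"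
      unfolding gcone_def using b0(2) b0'(2) by (auto cong: sum.cong)
    moreover have "gcone (\<lambda>j. b0 j *\<^sub>R (w j, 1 :: real)) J = gcone (\<lambda>j. (w j, 1)) J"
      by (rule gcone_rescale) (erule b0(1))
    moreover have "gcone (\<lambda>j. b0' j *\<^sub>R (w' j, 1 :: real)) J = gcone (\<lambda>j. (w' j, 1)) J"
      by (rule gcone_rescale) (erule b0'(1))
    ultimately show "gcone u J = cone_over P" "gcone u' J = cone_over P'"
      unfolding v(1) v'(1) cone_over_convex_hull[OF fin(2)] by (simp_all only:)
  qed
  show ?thesis
  proof
    assume "scaling_equiv I J N N'"
    then obtain a b where a: "\<And>i. i \<in> I \<Longrightarrow> 0 < a i" and b: "\<And>j. j \<in> J \<Longrightarrow> 0 < b j"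
      and ab: "\<And>i j. i \<in> I \<Longrightarrow> j \<in> J \<Longrightarrow> N' i j = a i * N i j * b j"
      unfolding scaling_equiv_def by metis
    have rk': "dim ?W \<le> matrix_rank I J N" "dim ?W \<le> matrix_rank I J N'"
      unfolding rk W(2) by simp_all
    let ?h = "\<lambda>i. a i *\<^sub>R h i" and ?u = "\<lambda>j. b j *\<^sub>R u j"
    have N': "N' i j = ?h i \<bullet> ?u j" if "i \<in> I" "j \<in> J" for i j
      using ab[OF that] hu(5)[OF that] by simp
    have "span (?u ` J) = ?W"
      by (rule span_columns_of_factorization[OF W(1) _ _ rk'(2)]) (intro subspace_scale W(1) uW(1), assumption, erule (1) N')
    moreover have "span (u' ` J) = ?W"
      by (rule span_columns_of_factorization[OF W(1) _ _ rk'(2)]) (erule uW(2), erule (1) hu'(5))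
    moreover have "span (?h ` I) = ?W"
      by (rule span_rows_of_factorization[OF W(1) _ _ rk'(2)]) (intro subspace_scale W(1) hu(1), assumption, erule (1) N')
    moreover have "span (h' ` I) = ?W"
      by (rule span_rows_of_factorization[OF W(1) _ _ rk'(2)]) (erule hu'(1), erule (1) hu'(5))
    moreover have "?h i \<bullet> ?u j = h' i \<bullet> u' j" if "i \<in> I" "j \<in> J" for i j
      using N'[OF that] hu'(5)[OF that] by simp
    ultimately obtain g where g: "linear g" "bij_betw g ?W ?W" "\<And>j. j \<in> J \<Longrightarrow> g (?u j) = u' j"
      "\<And>i x. i \<in> I \<Longrightarrow> x \<in> ?W \<Longrightarrow> h' i \<bullet> g x = ?h i \<bullet> x"
      using linear_map_of_factorizations[OF W(1), of ?u J u' ?h I h'] by blast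
    have nz: "g (x, 1) \<noteq> 0" if "x \<in> P" for x
    proof
      assume "g (x, 1) = 0"
      moreover have "(x, 1) \<in> ?W" "0 \<in> ?W"
        using cone_over_base[OF that] sub subspace_0[OF W(1)] by auto
      ultimately have "(x, 1 :: real) = 0"
        using g(2) linear_0[OF g(1)] unfolding bij_betw_def by (metis inj_onD)
      then show False
        by (simp add: zero_prod_def)
    qed
    have gP: "g ` cone_over P = cone_over P'"
    proof -
      have "gcone ?u J = gcone u J"
        by (rule gcone_rescale) (erule b)
      then have "g ` cone_over P = gcone (\<lambda>j. g (?u j)) J"
        using image_gcone[OF g(1), of ?u J] unfolding gen(1) by simp
      also have "\<dots> = gcone u' J"
        unfolding gcone_def using g(3) by (auto cong: sum.cong)
      finally show ?thesis
        unfolding gen(2) .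
    qed
    have gF: "g ` cone_over (F i) = cone_over (F' i)" if i: "i \<in> I" for i
    proof -
      have "h' i \<bullet> g x = 0 \<longleftrightarrow> h i \<bullet> x = 0" if "x \<in> cone_over P" for x
        using g(4)[OF i, of x] sub that a[OF i] by auto
      then show ?thesis
        unfolding hu(3)[OF i] hu'(3)[OF i] gP[symmetric] by auto
    qed
    have gw: "g ` cone_over {w j} = cone_over {w' j}" if j: "j \<in> J" for j
      using hu(4)[OF j] hu'(4)[OF j] g(3)[OF j] ray_scale[OF b[OF j], of "u j"]
        image_ray[OF g(1), of "?u j"] by simp
    have pm: "projective_map g ` {w j} = {w' j}" if j: "j \<in> J" for j
      using projective_map_cone_over(1)[OF g(1) gw[OF j]] nz wP[OF j] by simp
    show "projectively_equivalent V I J (P, F, w) (P', F', w')"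
      unfolding projectively_equivalent_def prod.case
    proof (intro exI[of _ g] conjI ballI g(1,2))
      show "snd (g (x, 1)) \<noteq> 0" if "x \<in> P" for x
        using projective_map_cone_over(2)[OF g(1) gP nz that] by simp
      show "projective_map g ` P = P'"
        by (rule projective_map_cone_over(1)[OF g(1) gP nz])
      show "projective_map g ` F i = F' i" if "i \<in> I" for i
        using FP[OF that] by (intro projective_map_cone_over(1)[OF g(1) gF[OF that]] nz) auto
      show "projective_map g (w j) = w' j" if "j \<in> J" for j
        using pm[OF that] by simp
    qed
  next
    assume "projectively_equivalent V I J (P, F, w) (P', F', w')"
    then obtain g0 where g0: "linear g0" "bij_betw g0 ?W ?W" "\<And>x. x \<in> P \<Longrightarrow> snd (g0 (x, 1)) \<noteq> 0"
      "projective_map g0 ` P = P'" "\<And>i. i \<in> I \<Longrightarrow> projective_map g0 ` F i = F' i"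
      "\<And>j. j \<in> J \<Longrightarrow> projective_map g0 (w j) = w' j"
      unfolding projectively_equivalent_def by auto
    have convP: "convex P"
      using v(6) by (rule polytope_imp_convex)
    \<comment> \<open>A linear map and its negative induce the same projective map. The denominators
      have constant sign on \<open>P\<close>, so one of the two choices makes them positive and maps
      the cone to the cone.\<close>
    have "\<exists>g. linear g \<and> inj_on g ?W \<and> projective_map g = projective_map g0 \<and> (\<forall>x\<in>P. 0 < snd (g (x, 1)))"
    proof (cases "\<exists>x\<in>P. 0 < snd (g0 (x, 1))")
      case True
      then show ?thesis
        using nonzero_affine_sign[OF g0(1) convP g0(3)] g0(1,2) unfolding bij_betw_def by blast
    next
      case False
      let ?g = "\<lambda>x. - g0 x"
      have "linear ?g"
        using g0(1) by (rule linear_compose_neg)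
      moreover have "inj_on ?g ?W"
        using g0(2) unfolding bij_betw_def inj_on_def by simp
      moreover have "projective_map ?g = projective_map g0"
        by (simp add: projective_map_def fun_eq_iff)
      moreover have "\<forall>x\<in>P. 0 < snd (?g (x, 1))"
        using False g0(3) by force
      ultimately show ?thesis
        by blast
    qed
    then obtain g where g: "linear g" "inj_on g ?W" "projective_map g = projective_map g0"
      "\<And>x. x \<in> P \<Longrightarrow> 0 < snd (g (x, 1))"
      by blast
    have gP: "g ` cone_over P = cone_over P'"
      using g0(4) g by (intro cone_over_projective_map) auto
    have gF: "g ` cone_over (F i) = cone_over (F' i)" if "i \<in> I" for i
      using g0(5) g FP[OF that] that by (intro cone_over_projective_map) auto
    have gw: "g ` cone_over {w j} = cone_over {w' j}" if "j \<in> J" for j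
      using g0(6) g wP[OF that] that by (intro cone_over_projective_map) auto
    have ex_a: "\<exists>a>0. \<forall>x\<in>?W. h' i \<bullet> g x = a * (h i \<bullet> x)" if i: "i \<in> I" for i
    proof -
      have "cone_over (F i) \<in> facets (cone_over P)"
        using cone(1) i bij_betwE unfolding cone_of_type_def by fast
      then have "aff_dim (cone_over (F i)) = int (dim V)"
        using P(2) by (simp add: facets_def aff_dim_cone_over full_dim_in_def)
      moreover have "aff_dim (cone_over (F i)) = int (dim (cone_over (F i)))"
        by (intro aff_dim_zero hull_inc) simp
      ultimately have dF: "dim ?W \<le> dim (cone_over (F i)) + 1"
        using W(2) by simp
      have FW: "cone_over (F i) \<subseteq> ?W"
        using cone_over_mono[OF FP[OF i]] sub by blast
      have "cone_over (F i) \<noteq> cone_over P"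
        using \<open>cone_over (F i) \<in> facets _\<close> by (auto simp: facets_def)
      then obtain z where z: "z \<in> cone_over P" "z \<notin> cone_over (F i)"
        using cone_over_mono[OF FP[OF i]] by blast
      then have zW: "z \<in> ?W"
        using sub by blast
      have hz: "h i \<bullet> z < 0"
        using z hu(2)[OF i z(1)] hu(3)[OF i] by (simp add: less_le)
      have gz: "g z \<in> cone_over P'" "g z \<notin> cone_over (F' i)"
        using gP gF[OF i] z g(2) zW FW unfolding inj_on_def by blast+
      then have hgz: "h' i \<bullet> g z < 0"
        using hu'(2)[OF i] hu'(3)[OF i] by (simp add: less_le)
      \<comment> \<open>The adjoint pulls the normal \<open>h' i\<close> back. It vanishes on the
        cone over \<open>F i\<close>, so on \<open>?W\<close> it is a multiple of
        \<open>h i\<close>, with positive factor because both are negative at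
        \<open>z\<close>.\<close>
      let ?k = "adjoint g (h' i)"
      have k: "?k \<bullet> x = h' i \<bullet> g x" for x
        using adjoint_works[OF g(1), of x "h' i"] by (simp add: inner_commute)
      have "?k \<bullet> x = (?k \<bullet> z) / (h i \<bullet> z) * (h i \<bullet> x)" if "x \<in> ?W" for x
      proof (rule proportional_functionals[OF W(1) FW dF _ _ zW hz that])
        show "h i \<bullet> y = 0" if "y \<in> cone_over (F i)" for y
          using that hu(3)[OF i] by simp
        show "?k \<bullet> y = 0" if "y \<in> cone_over (F i)" for y
          using that gF[OF i] hu'(3)[OF i] k by auto
      qed
      then show ?thesis
        using hz hgz by (intro exI[of _ "(h' i \<bullet> g z) / (h i \<bullet> z)"]) (auto simp: k divide_neg_neg)
    qed
    then obtain a where a: "\<And>i. i \<in> I \<Longrightarrow> 0 < a i" "\<And>i x. i \<in> I \<Longrightarrow> x \<in> ?W \<Longrightarrow> h' i \<bullet> g x = a i * (h i \<bullet> x)"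
      by metis
    have ex_b: "\<exists>b>0. u' j = b *\<^sub>R g (u j)" if j: "j \<in> J" for j
    proof -
      have "ray (g (u j)) = ray (u' j)"
        using gw[OF j] hu(4)[OF j] hu'(4)[OF j] image_ray[OF g(1)] by metis
      moreover have "g (u j) \<noteq> 0"
      proof
        assume "g (u j) = 0"
        then have "u j = 0"
          using g(2) linear_0[OF g(1)] uW(1)[OF j] subspace_0[OF W(1)] by (metis inj_onD)
        then show False
          using b0[OF j] by (simp add: zero_prod_def)
      qed
      ultimately show ?thesis
        using ray_eqD by metis
    qed
    then obtain b where b: "\<And>j. j \<in> J \<Longrightarrow> 0 < b j" "\<And>j. j \<in> J \<Longrightarrow> u' j = b j *\<^sub>R g (u j)"
      by metis
    have "N' i j = a i * N i j * b j" if "i \<in> I" "j \<in> J" for i j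
      using hu'(5)[OF that] hu(5)[OF that] b(2)[OF that(2)] a(2)[OF that(1) uW(1)[OF that(2)]] by simp
    then show "scaling_equiv I J N N'"
      unfolding scaling_equiv_def using a(1) b(1) by blast
  qed
qed

section \<open>Realizations and parameterizations\<close>

context polytopal_lattice
begin

lemma centered_polytope_of_matrix:
  assumes M: "filled_incidence_matrix I J R 1 M" "matrix_rank I J M = dim V"
  obtains P F w where "polytope_of_type I J R P F w" "centered_in V P" "facet_vertex_matrix V I J P F w M"
proof -
  have le: "matrix_rank I J M \<le> dim V"
    using M(2) by simp
  obtain h w where hw: "centered_configuration I J R h w V" "\<And>i j. i \<in> I \<Longrightarrow> j \<in> J \<Longrightarrow> M i j = h i \<bullet> w j"
    by (rule centered_configuration_of_matrix[OF M(1) le]) (blast intro: that)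
  interpret centered_configuration I J R h w V
    by (rule hw(1))
  show thesis
    by (rule that[OF polytope_P centered_P facet_vertex_matrix_P]) (rule hw(2))
qed

lemma centered_polytope_has_matrix:
  assumes P: "polytope_of_type I J R P F w" "centered_in V P"
  obtains M where "facet_vertex_matrix V I J P F w M"
proof -
  obtain h where h: "centered_configuration I J R h w V" "P = convex hull (w ` J)"
    "\<And>i. i \<in> I \<Longrightarrow> F i = {x\<in>P. h i \<bullet> x = 1}"
    by (rule centered_polytope_configuration[OF finite_IJ sV P]) (blast intro: that)
  interpret K: centered_configuration I J R h w V
    by (rule h(1))
  have eq: "K.P = P"
    by (simp add: K.P_def h(2))
  have "facet_vertex_matrix V I J K.P K.F w (\<lambda>i j. h i \<bullet> w j)"
    by (rule K.facet_vertex_matrix_P) simp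
  then have "facet_vertex_matrix V I J P K.F w (\<lambda>i j. h i \<bullet> w j)"
    unfolding eq .
  moreover have "K.F i = F i" if "i \<in> I" for i
    unfolding K.F_def eq h(3)[OF that] ..
  ultimately have "facet_vertex_matrix V I J P F w (\<lambda>i j. h i \<bullet> w j)"
    using facet_vertex_matrix_cong[of I K.F F] by blast
  then show thesis
    by (rule that)
qed

lemma facet_vertex_matrix_rank:
  assumes P: "polytope_of_type I J R P F w" "centered_in V P" and M: "facet_vertex_matrix V I J P F w M"
  shows "filled_incidence_matrix I J R 1 M \<and> matrix_rank I J M = dim V"
proof -
  have "P \<subseteq> V"
    using P(2) by (simp add: centered_in_def full_dim_in_def)
  note fvm = facet_vertex_matrix_filled[OF P(1) this M sV]
  show ?thesis
    using fvm(1) rank_filled1_ge[OF fvm] by blast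
qed

lemma facet_vertex_matrices:
  "(\<exists>P F w. polytope_of_type I J R P F w \<and> centered_in V P \<and> facet_vertex_matrix V I J P F w M) \<longleftrightarrow>
    filled_incidence_matrix I J R 1 M \<and> matrix_rank I J M = dim V"
proof
  assume "filled_incidence_matrix I J R 1 M \<and> matrix_rank I J M = dim V"
  then obtain P F w where "polytope_of_type I J R P F w" "centered_in V P" "facet_vertex_matrix V I J P F w M"
    using centered_polytope_of_matrix[of M] by metis
  then show "\<exists>P F w. polytope_of_type I J R P F w \<and> centered_in V P \<and> facet_vertex_matrix V I J P F w M"
    by blast
qed (use facet_vertex_matrix_rank in blast)

lemma parameterizesI:
  assumes "\<And>P F w. (P, F, w) \<in> Xs \<Longrightarrow> \<exists>m\<in>Ms. \<rho> m (P, F, w)"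
    and "\<And>m. m \<in> Ms \<Longrightarrow> \<exists>P F w. (P, F, w) \<in> Xs \<and> \<rho> m (P, F, w)"
    and "\<And>m m' P F w P' F' w'. m \<in> Ms \<Longrightarrow> m' \<in> Ms \<Longrightarrow> (P, F, w) \<in> Xs \<Longrightarrow> (P', F', w') \<in> Xs \<Longrightarrow>
      \<rho> m (P, F, w) \<Longrightarrow> \<rho> m' (P', F', w') \<Longrightarrow> eqM m m' \<longleftrightarrow> eqX (P, F, w) (P', F', w')"
  shows "parameterizes Ms eqM Xs eqX \<rho>"
  unfolding parameterizes_def
proof (intro conjI ballI impI)
  show "\<exists>m\<in>Ms. \<rho> m x" if "x \<in> Xs" for x
    using that assms(1) by (cases x) blast
  show "\<exists>x\<in>Xs. \<rho> m x" if "m \<in> Ms" for m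
    using assms(2)[OF that] by blast
  show "eqM m m' = eqX x x'" if "m \<in> Ms" "m' \<in> Ms" "x \<in> Xs" "x' \<in> Xs" "\<rho> m x \<and> \<rho> m' x'" for m m' x x'
    using that assms(3) by (cases x, cases x') blast
qed

lemma parameterizes_linear:
  "parameterizes {M. filled_incidence_matrix I J R 1 M \<and> matrix_rank I J M = dim V} (matrix_eq_on I J)
    {(P, F, w). polytope_of_type I J R P F w \<and> centered_in V P} (linearly_equivalent V I J)
    (\<lambda>M (P, F, w). facet_vertex_matrix V I J P F w M)"
proof (rule parameterizesI, goal_cases)
  case (1 P F w)
  then have P: "polytope_of_type I J R P F w" "centered_in V P"
    by auto
  obtain M where M: "facet_vertex_matrix V I J P F w M"
    using centered_polytope_has_matrix[OF P] .
  then show ?case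
    using facet_vertex_matrix_rank[OF P M] by auto
next
  case (2 M)
  then have M: "filled_incidence_matrix I J R 1 M" "matrix_rank I J M = dim V"
    by auto
  obtain P F w where "polytope_of_type I J R P F w" "centered_in V P" "facet_vertex_matrix V I J P F w M"
    using centered_polytope_of_matrix[OF M] .
  then show ?case
    by (intro exI[of _ P] exI[of _ F] exI[of _ w]) simp
next
  case 3
  then show ?case
    by (intro linearly_equivalent_iff[where R = R, OF sV]) (simp_all add: centered_in_def)
qed

lemma facet_ray_matrices:
  "(\<exists>(C :: ('a \<times> real) set) F r. cone_of_type I J R C F r \<and> full_dim_in W C \<and> facet_ray_matrix W I J C F r N) \<longleftrightarrow>
    filled_incidence_matrix I J R 0 N \<and> matrix_rank I J N = dim V + 1"
proof
  assume "\<exists>(C :: ('a \<times> real) set) F r. cone_of_type I J R C F r \<and> full_dim_in W C \<and> facet_ray_matrix W I J C F r N"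
  then obtain C :: "('a \<times> real) set" and F r where C: "cone_of_type I J R C F r" "facet_ray_matrix W I J C F r N"
    by blast
  note frm = facet_ray_matrix_filled[OF C W(1)]
  show "filled_incidence_matrix I J R 0 N \<and> matrix_rank I J N = dim V + 1"
    using frm rank_filled0_ge[OF frm(1)] W(2) by simp
next
  assume N: "filled_incidence_matrix I J R 0 N \<and> matrix_rank I J N = dim V + 1"
  obtain h w where hw: "cone_type_configuration I J R h w W" "\<And>i j. i \<in> I \<Longrightarrow> j \<in> J \<Longrightarrow> N i j = h i \<bullet> w j"
    by (rule cone_configuration_of_matrix[OF conjunct1[OF N] conjunct2[OF N]]) (blast intro: that)
  interpret K: cone_type_configuration I J R h w W
    by (rule hw(1))
  have "facet_ray_matrix W I J K.C (\<lambda>i. {x\<in>K.C. h i \<bullet> x = 0}) (\<lambda>j. ray (w j)) N"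
    by (rule K.facet_ray_matrix_C) (rule hw(2))
  then show "\<exists>(C :: ('a \<times> real) set) F r. cone_of_type I J R C F r \<and> full_dim_in W C \<and> facet_ray_matrix W I J C F r N"
    using K.cone_of_type_C K.full_dim_C by blast
qed

lemma polytope_has_cone_matrix:
  assumes P: "polytope_of_type I J R P F w" "full_dim_in V P"
  obtains N where "polytope_cone_matrix V I J R N (P, F, w)"
proof -
  have dimP: "0 \<le> aff_dim P"
    using P(2) by (simp add: full_dim_in_def)
  obtain k where k: "cone_type_configuration I J R k (\<lambda>j. (w j, 1)) (span (cone_over P))"
    "gcone (\<lambda>j. (w j, 1)) J = cone_over P"
    "\<And>i. i \<in> I \<Longrightarrow> cone_over (F i) = {x\<in>cone_over P. k i \<bullet> x = 0}"
    by (rule polytope_configuration[OF finite_IJ P(1) dimP]) (blast intro: that)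
  interpret K: cone_type_configuration I J R k "\<lambda>j. (w j, 1)" W
    using k(1) unfolding span_cone_over_full_dim[OF sV P(2)] .
  have 1: "cone_of_type I J R (cone_over P) (\<lambda>i. cone_over (F i)) (\<lambda>j. cone_over {w j})"
    using K.cone_of_type_C k(3) unfolding k(2) cone_over_singleton
    by (subst cone_of_type_cong[of I _ "\<lambda>i. {x\<in>cone_over P. k i \<bullet> x = 0}" J _ "\<lambda>j. ray (w j, 1)"]) auto
  have "facet_ray_matrix W I J (cone_over P) (\<lambda>i. {x\<in>cone_over P. k i \<bullet> x = 0}) (\<lambda>j. ray (w j, 1))
      (\<lambda>i j. k i \<bullet> (w j, 1))"
    using K.facet_ray_matrix_C[of "\<lambda>i j. k i \<bullet> (w j, 1)"] unfolding k(2) by simp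
  then have 2: "facet_ray_matrix W I J (cone_over P) (\<lambda>i. cone_over (F i)) (\<lambda>j. cone_over {w j})
      (\<lambda>i j. k i \<bullet> (w j, 1))"
    using k(3) unfolding cone_over_singleton
    by (subst facet_ray_matrix_cong[of I _ "\<lambda>i. {x\<in>cone_over P. k i \<bullet> x = 0}" J _ "\<lambda>j. ray (w j, 1)"]) auto
  have 3: "full_dim_in W (cone_over P)"
    using K.full_dim_C unfolding k(2) .
  have "polytope_cone_matrix V I J R (\<lambda>i j. k i \<bullet> (w j, 1)) (P, F, w)"
    unfolding polytope_cone_matrix_def prod.case using 1 2 3 by blast
  then show thesis
    by (rule that)
qed

lemma polytope_cone_matrix_rank:
  assumes "polytope_cone_matrix V I J R N (P, F, w)"
  shows "filled_incidence_matrix I J R 0 N \<and> matrix_rank I J N = dim V + 1"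
  using assms unfolding polytope_cone_matrix_def prod.case facet_ray_matrices[symmetric] by blast

lemma polytope_of_cone_matrix:
  assumes N: "filled_incidence_matrix I J R 0 N" "matrix_rank I J N = dim V + 1"
  obtains P F w where "polytope_of_type I J R P F w" "full_dim_in V P" "polytope_cone_matrix V I J R N (P, F, w)"
proof -
  obtain h w a b where c: "centered_configuration I J R h w V"
    "\<And>i. i \<in> I \<Longrightarrow> 0 < a i" "\<And>j. j \<in> J \<Longrightarrow> 0 < b j"
    "\<And>i j. i \<in> I \<Longrightarrow> j \<in> J \<Longrightarrow> N i j = a i * (h i \<bullet> w j - 1) * b j"
    by (rule scaled_centered_configuration[OF N]) (blast intro: that)
  interpret centered_configuration I J R h w V
    by (rule c(1))
  have "polytope_cone_matrix V I J R N (P, F, w)"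
    by (rule polytope_cone_matrix_P) (erule c(2), erule c(3), erule (1) c(4))
  then show thesis
    by (rule that[OF polytope_P full_dim_P])
qed

lemma parameterizes_projective:
  "parameterizes {N. filled_incidence_matrix I J R 0 N \<and> matrix_rank I J N = dim V + 1} (scaling_equiv I J)
    {(P, F, w). polytope_of_type I J R P F w \<and> full_dim_in V P} (projectively_equivalent V I J)
    (polytope_cone_matrix V I J R)"
proof (rule parameterizesI, goal_cases)
  case (1 P F w)
  then have P: "polytope_of_type I J R P F w" "full_dim_in V P"
    by auto
  obtain N where "polytope_cone_matrix V I J R N (P, F, w)"
    using polytope_has_cone_matrix[OF P] .
  then show ?case
    using polytope_cone_matrix_rank by blast
next
  case (2 N)
  then have N: "filled_incidence_matrix I J R 0 N" "matrix_rank I J N = dim V + 1"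
    by auto
  obtain P F w where "polytope_of_type I J R P F w" "full_dim_in V P" "polytope_cone_matrix V I J R N (P, F, w)"
    using polytope_of_cone_matrix[OF N] .
  then show ?case
    by (intro exI[of _ P] exI[of _ F] exI[of _ w]) simp
next
  case 3
  then show ?case
    by (intro projectively_equivalent_iff[where R = R, OF sV finite_IJ]) simp_all
qed

text \<open>From 1 to 0, all entries are lowered by 1; from 0 to 1, the matrix is scaled to that of
  a centered polytope. Each time the upper bound of the rank comes from a factorization and the
  lower bound from the lattice.\<close>

lemma ex_filled_matrix_iff:
  "(\<exists>M. filled_incidence_matrix I J R 1 M \<and> matrix_rank I J M = dim V) \<longleftrightarrow>
    (\<exists>N. filled_incidence_matrix I J R 0 N \<and> matrix_rank I J N = dim V + 1)"
proof
  assume "\<exists>M. filled_incidence_matrix I J R 1 M \<and> matrix_rank I J M = dim V"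
  then obtain M where M: "filled_incidence_matrix I J R 1 M" "matrix_rank I J M = dim V"
    by blast
  have "matrix_rank I J (\<lambda>i j. M i j + - 1) \<le> dim V + 1"
    using rank_add_constant[OF finite_IJ(1) sV, of J M "- 1"] M(2) by simp
  then have "matrix_rank I J (\<lambda>i j. M i j - 1) = dim V + 1"
    using rank_filled0_ge[OF filled_shift[OF M(1)]] by simp
  then show "\<exists>N. filled_incidence_matrix I J R 0 N \<and> matrix_rank I J N = dim V + 1"
    using filled_shift[OF M(1)] by blast
next
  assume "\<exists>N. filled_incidence_matrix I J R 0 N \<and> matrix_rank I J N = dim V + 1"
  then obtain N where N: "filled_incidence_matrix I J R 0 N" "matrix_rank I J N = dim V + 1"
    by blast
  obtain h w where c: "centered_configuration I J R h w V"
    and filled: "filled_incidence_matrix I J R 1 (\<lambda>i j. h i \<bullet> w j)"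
    by (rule scaled_centered_configuration[OF N]) (blast intro: that)
  interpret centered_configuration I J R h w V
    by (rule c)
  have "matrix_rank I J (\<lambda>i j. h i \<bullet> w j) \<le> dim V"
    by (rule rank_le_dim_rows[OF sV h_in_V]) auto
  then show "\<exists>M. filled_incidence_matrix I J R 1 M \<and> matrix_rank I J M = dim V"
    using filled rank_filled1_ge[OF filled] by blast
qed

end

text \<open>The polytope may lie anywhere. Instead of moving it to a centered position in
  \<open>V\<close>, the 0-incidence matrix of its cone is formed and rescaled through
  \<open>ex_filled_matrix_iff\<close>.\<close>

lemma filled_matrix_of_polytope:
  fixes P :: "'a::euclidean_space set" and V :: "'a set"
  assumes fin: "finite I" "finite J" and V: "subspace V" "dim V = d"
    and P: "polytope_of_type I J R P F w" "aff_dim P = int d"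
  shows "\<exists>M. filled_incidence_matrix I J R 1 M \<and> matrix_rank I J M = d"
proof -
  note lc = polytope_lattice_conditions[OF fin P]
  interpret PL: polytopal_lattice I J R V
    using fin V lc by unfold_locales auto
  have dimP: "0 \<le> aff_dim P"
    using P(2) by simp
  obtain k where k: "cone_type_configuration I J R k (\<lambda>j. (w j, 1)) (span (cone_over P))"
    by (rule polytope_configuration[OF fin P(1) dimP]) (blast intro: that)
  interpret K: cone_type_configuration I J R k "\<lambda>j. (w j, 1)" "span (cone_over P)"
    by (rule k)
  let ?N = "\<lambda>i j. k i \<bullet> (w j, 1)"
  have filled: "filled_incidence_matrix I J R 0 ?N"
    unfolding filled_incidence_matrix_def using K.le0 K.eq0_iff by (auto simp: less_le)
  have "matrix_rank I J ?N \<le> dim (span (cone_over P))"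
    by (rule rank_le_dim_rows[OF subspace_span K.h_in_W]) auto
  also have "dim (span (cone_over P)) = dim V + 1"
    using dim_span_cone_over[OF dimP] P(2) V(2) by linarith
  finally have "matrix_rank I J ?N = dim V + 1"
    using PL.rank_filled0_ge[OF filled] by simp
  then show ?thesis
    using filled PL.ex_filled_matrix_iff V(2) by blast
qed

theorem theorem6:
  fixes I :: "'i set" and J :: "'j set" and R :: "('i \<times> 'j) set"
    and V :: "'a::euclidean_space set" and d :: nat
  assumes "finite I" and "finite J" and "R \<subseteq> I \<times> J"
    and "subspace V" and "dim V = d"
  shows
    "((\<exists>(P :: 'a set) F w. polytope_of_type I J R P F w \<and> aff_dim P = int d) \<longleftrightarrow>
        reduced_relation I J R \<and>
        condition_C (maxbiclique_lattice I J R) \<and>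
        poset_rank (maxbiclique_lattice I J R) = d + 1 \<and>
        diamond (maxbiclique_lattice I J R) \<and>
        (\<exists>M. filled_incidence_matrix I J R 1 M \<and> matrix_rank I J M = d))
     \<and>
     ((\<exists>(P :: 'a set) F w. polytope_of_type I J R P F w \<and> aff_dim P = int d) \<longrightarrow>
        (\<forall>M. (\<exists>P F w. polytope_of_type I J R P F w \<and> centered_in V P \<and>
                facet_vertex_matrix V I J P F w M) \<longleftrightarrow>
              filled_incidence_matrix I J R 1 M \<and> matrix_rank I J M = d) \<and>
        parameterizes
          {M. filled_incidence_matrix I J R 1 M \<and> matrix_rank I J M = d}
          (matrix_eq_on I J)
          {(P, F, w). polytope_of_type I J R P F w \<and> centered_in V P}
          (linearly_equivalent V I J)
          (\<lambda>M (P, F, w). facet_vertex_matrix V I J P F w M))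
     \<and>
     (reduced_relation I J R \<and>
      condition_C (maxbiclique_lattice I J R) \<and>
      poset_rank (maxbiclique_lattice I J R) = d + 1 \<and>
      diamond (maxbiclique_lattice I J R) \<longrightarrow>
        ((\<exists>M. filled_incidence_matrix I J R 1 M \<and> matrix_rank I J M = d) \<longleftrightarrow>
         (\<exists>N. filled_incidence_matrix I J R 0 N \<and> matrix_rank I J N = d + 1)) \<and>
        (\<forall>N. (\<exists>(C :: ('a \<times> real) set) F r. cone_of_type I J R C F r \<and>
                full_dim_in (V \<times> UNIV) C \<and> facet_ray_matrix (V \<times> UNIV) I J C F r N) \<longleftrightarrow>
              filled_incidence_matrix I J R 0 N \<and> matrix_rank I J N = d + 1) \<and>
        parameterizes
          {N. filled_incidence_matrix I J R 0 N \<and> matrix_rank I J N = d + 1}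
          (scaling_equiv I J)
          {(P, F, w). polytope_of_type I J R P F w \<and> full_dim_in V P}
          (projectively_equivalent V I J)
          (polytope_cone_matrix V I J R))"
proof (intro conjI impI)
  note fin = assms(1,2) and V = assms(4,5)
  have loc: "polytopal_lattice I J R V"
    if "reduced_relation I J R" "poset_rank (maxbiclique_lattice I J R) = d + 1"
      "diamond (maxbiclique_lattice I J R)"
    using fin V that by unfold_locales auto
  show realizable: "(\<exists>(P :: 'a set) F w. polytope_of_type I J R P F w \<and> aff_dim P = int d) \<longleftrightarrow>
      reduced_relation I J R \<and> condition_C (maxbiclique_lattice I J R) \<and>
      poset_rank (maxbiclique_lattice I J R) = d + 1 \<and> diamond (maxbiclique_lattice I J R) \<and>
      (\<exists>M. filled_incidence_matrix I J R 1 M \<and> matrix_rank I J M = d)"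
    (is "?real \<longleftrightarrow> ?conds")
  proof
    assume ?real
    then obtain P :: "'a set" and F w where P: "polytope_of_type I J R P F w" "aff_dim P = int d"
      by blast
    show ?conds
      using polytope_lattice_conditions[OF fin P] filled_matrix_of_polytope[OF fin V P] by blast
  next
    assume c: ?conds
    then interpret polytopal_lattice I J R V
      by (intro loc) auto
    have "\<exists>M. filled_incidence_matrix I J R 1 M \<and> matrix_rank I J M = dim V"
      using c V(2) by simp
    then obtain M where M: "filled_incidence_matrix I J R 1 M" "matrix_rank I J M = dim V"
      by (elim exE conjE)
    obtain P F w where P: "polytope_of_type I J R P F w" "centered_in V P" "facet_vertex_matrix V I J P F w M"
      by (rule centered_polytope_of_matrix[OF M])
    then have "aff_dim P = int d"
      using V(2) by (simp add: centered_in_def full_dim_in_def)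
    then show ?real
      using P(1) by blast
  qed
  {
    assume "\<exists>(P :: 'a set) F w. polytope_of_type I J R P F w \<and> aff_dim P = int d"
    \<comment> \<open>The equivalence just shown turns realizability into the lattice conditions,
      which are those of the locale.\<close>
    then interpret polytopal_lattice I J R V
      unfolding realizable by (intro loc) auto
    show "\<forall>M. (\<exists>P F w. polytope_of_type I J R P F w \<and> centered_in V P \<and> facet_vertex_matrix V I J P F w M) \<longleftrightarrow>
        filled_incidence_matrix I J R 1 M \<and> matrix_rank I J M = d"
      using facet_vertex_matrices V(2) by simp
    show "parameterizes {M. filled_incidence_matrix I J R 1 M \<and> matrix_rank I J M = d} (matrix_eq_on I J)
        {(P, F, w). polytope_of_type I J R P F w \<and> centered_in V P} (linearly_equivalent V I J)
        (\<lambda>M (P, F, w). facet_vertex_matrix V I J P F w M)"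
      using parameterizes_linear V(2) by simp
  }
  {
    assume "reduced_relation I J R \<and> condition_C (maxbiclique_lattice I J R) \<and>
      poset_rank (maxbiclique_lattice I J R) = d + 1 \<and> diamond (maxbiclique_lattice I J R)"
    then interpret polytopal_lattice I J R V
      by (intro loc) auto
    show "(\<exists>M. filled_incidence_matrix I J R 1 M \<and> matrix_rank I J M = d) \<longleftrightarrow>
        (\<exists>N. filled_incidence_matrix I J R 0 N \<and> matrix_rank I J N = d + 1)"
      using ex_filled_matrix_iff V(2) by simp
    show "\<forall>N. (\<exists>(C :: ('a \<times> real) set) F r. cone_of_type I J R C F r \<and> full_dim_in (V \<times> UNIV) C \<and>
          facet_ray_matrix (V \<times> UNIV) I J C F r N) \<longleftrightarrow>
        filled_incidence_matrix I J R 0 N \<and> matrix_rank I J N = d + 1"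
      using facet_ray_matrices V(2) by simp
    show "parameterizes {N. filled_incidence_matrix I J R 0 N \<and> matrix_rank I J N = d + 1} (scaling_equiv I J)
        {(P, F, w). polytope_of_type I J R P F w \<and> full_dim_in V P} (projectively_equivalent V I J)
        (polytope_cone_matrix V I J R)"
      using parameterizes_projective V(2) by simp
  }
qed

end
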